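(* Let $G=\widetilde{\mathrm{SL}}_2(\mathbb{R})$ with Lie algebra $\mathfrak{g}=\mathfrak{sl}_2(\mathbb{R})$ and Killing form $K(V,W)=\operatorname{tr}(\operatorname{ad}V\circ\operatorname{ad}W)$. Consider a left-invariant generalized sub-Lorentzian structure on $G$ given by a closed convex acute cone $C^+\subset\mathfrak{g}$ at the identity and an upper semicontinuous anti-norm. If $C^+\setminus\{0\}$ is contained in the interior of the cone $\{v\in\mathfrak{g}: K(v,v)\le 0\}$, then for every point $x_1$ attainable from the identity there exists a longest arc from the identity to $x_1$ (and by left-invariance, the same holds for any starting point $x_0$ and any $x_1$ attainable from $x_0$).
   Context: A generalized sub-Lorentzian structure on a smooth manifold $M$ assigns to each $x\in M$ a closed convex acute cone $C^+_x\subset T_xM$ (acute: containing no nonzero linear subspace) and an anti-norm $\nu_x:T_xM\to\mathbb{R}\cup\{-\infty\}$, i.e. $\nu_x\ge 0$ on $C^+_x$, $\nu_x=-\infty$ outside $C^+_x$, $\nu_x(\lambda v)=\lambda\nu_x(v)$ for $\lambda>0$, and $\nu_x(v+w)\ge\nu_x(v)+\nu_x(w)$. On a Lie group it is left-invariant if $C^+_g=(L_g)_*C^+_{\mathrm{id}}$ and $\nu_g((L_g)_*v)=\nu_{\mathrm{id}}(v)$. An admissible curve is a Lipschitz curve $x:[0,t_1]\to M$ with $\dot x(t)\in C^+_{x(t)}\setminus\{0\}$ for a.e. $t$; its length is $\int_0^{t_1}\nu(\dot x(t))\,dt$. A point $x_1$ is attainable from $x_0$ if some admissible curve goes from $x_0$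 to $x_1$. A longest arc from $x_0$ to $x_1$ is an admissible curve from $x_0$ to $x_1$ whose length equals the (finite) supremum of lengths of all admissible curves from $x_0$ to $x_1$. *)

theory Defs
  imports "HOL-Analysis.Analysis"
begin

definition sl2 :: "(real^2^2) set" where
  "sl2 = {X. trace X = 0}"

definition ad :: "real^2^2 \<Rightarrow> real^2^2 \<Rightarrow> real^2^2" where
  "ad V X = V ** X - X ** V"

definition sl2_basis :: "nat \<Rightarrow> real^2^2" where
  "sl2_basis i =
     (if i = 0 then (\<chi> a b. if a = b then (if a = 1 then 1 else -1) else 0)
      else if i = 1 then (\<chi> a b. if a = 1 \<and> b = 2 then 1 else 0)
      else (\<chi> a b. if a = 2 \<and> b = 1 then 1 else 0))"

definition sl2_coord :: "nat \<Rightarrow> real^2^2 \<Rightarrow> real" where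
  "sl2_coord i X = (if i = 0 then X $ 1 $ 1 else if i = 1 then X $ 1 $ 2 else X $ 2 $ 1)"

text \<open>Killing form K(V,W) = tr(ad V o ad W), trace of the linear map on sl2
  computed in the basis H, E, F.\<close>
definition killing :: "real^2^2 \<Rightarrow> real^2^2 \<Rightarrow> real" where
  "killing V W = (\<Sum>i<3. sl2_coord i (ad V (ad W (sl2_basis i))))"

definition sl2_interior :: "(real^2^2) set \<Rightarrow> (real^2^2) set" where
  "sl2_interior S = {v \<in> sl2. \<exists>e>0. \<forall>w\<in>sl2. dist w v < e \<longrightarrow> w \<in> S}"

definition acute :: "(real^2^2) set \<Rightarrow> bool" where
  "acute C \<longleftrightarrow> (\<forall>S. subspace S \<and> S \<subseteq> C \<longrightarrow> S \<subseteq> {0})"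

definition anti_norm :: "(real^2^2) set \<Rightarrow> (real^2^2 \<Rightarrow> ereal) \<Rightarrow> bool" where
  "anti_norm C nu \<longleftrightarrow>
     (\<forall>v\<in>sl2. nu v \<noteq> \<infinity>) \<and>
     (\<forall>v\<in>C. nu v \<ge> 0) \<and>
     (\<forall>v\<in>sl2 - C. nu v = -\<infinity>) \<and>
     (\<forall>v\<in>sl2. \<forall>l::real. l > 0 \<longrightarrow> nu (l *\<^sub>R v) = ereal l * nu v) \<and>
     (\<forall>v\<in>sl2. \<forall>w\<in>sl2. nu (v + w) \<ge> nu v + nu w)"

definition usc_on :: "(real^2^2) set \<Rightarrow> (real^2^2 \<Rightarrow> ereal) \<Rightarrow> bool" where
  "usc_on S f \<longleftrightarrow>
     (\<forall>v\<in>S. \<forall>a. f v < a \<longrightarrow> (\<exists>e>0. \<forall>w\<in>S. dist w v < e \<longrightarrow> f w < a))"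

text \<open>Model of the universal cover of SL2(R): pairs (A, theta) with det A = 1 and theta
  a choice of argument of the first column of A.  The covering map is (A, theta) \<mapsto> A,
  the identity is (mat 1, 0), and a continuous curve in this set is a continuous curve
  A(t) in SL2(R) together with a continuous lift theta(t) of the angle of A(t) e1.\<close>
definition Gt :: "((real^2^2) \<times> real) set" where
  "Gt = {(A, \<theta>). det A = 1 \<and> (\<exists>r>0. A $ 1 $ 1 = r * cos \<theta> \<and> A $ 2 $ 1 = r * sin \<theta>)}"

definition Gt_id :: "(real^2^2) \<times> real" where
  "Gt_id = (mat 1, 0)"

text \<open>Admissible curve on [0,t1] for the left-invariant structure with cone C at the identity:
  the tangent vector at x(t) = (A(t), theta(t)) lies in (L_{x(t)})_* (C - {0}), i.e.
  A(t)^{-1} A'(t) \<in> C - {0} for a.e. t.\<close>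
definition admissible ::
  "(real^2^2) set \<Rightarrow> (real^2^2) \<times> real \<Rightarrow> (real^2^2) \<times> real \<Rightarrow> real
     \<Rightarrow> (real \<Rightarrow> (real^2^2) \<times> real) \<Rightarrow> bool" where
  "admissible C x0 x1 t1 \<gamma> \<longleftrightarrow>
     0 < t1 \<and> (\<exists>L. L-lipschitz_on {0..t1} \<gamma>) \<and> (\<forall>t\<in>{0..t1}. \<gamma> t \<in> Gt) \<and>
     \<gamma> 0 = x0 \<and> \<gamma> t1 = x1 \<and>
     (AE t in lborel. t \<in> {0..t1} \<longrightarrow>
        (\<lambda>s. fst (\<gamma> s)) differentiable (at t) \<and>
        matrix_inv (fst (\<gamma> t)) ** vector_derivative (\<lambda>s. fst (\<gamma> s)) (at t) \<in> C - {0})"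

definition curve_length ::
  "(real^2^2 \<Rightarrow> ereal) \<Rightarrow> real \<Rightarrow> (real \<Rightarrow> (real^2^2) \<times> real) \<Rightarrow> real" where
  "curve_length nu t1 \<gamma> =
     (LINT t:{0..t1}|lborel.
        real_of_ereal (nu (matrix_inv (fst (\<gamma> t)) ** vector_derivative (\<lambda>s. fst (\<gamma> s)) (at t))))"

definition attainable ::
  "(real^2^2) set \<Rightarrow> (real^2^2) \<times> real \<Rightarrow> (real^2^2) \<times> real \<Rightarrow> bool" where
  "attainable C x0 x1 \<longleftrightarrow> (\<exists>t1 \<gamma>. admissible C x0 x1 t1 \<gamma>)"

end

theory Submission
  imports Defs "HOL-Complex_Analysis.Great_Picard"
begin

text \<open>The condition on the Killing form makes \<open>w \<mapsto> det (w, v w)\<close> definite on \<open>R\<^sup>2\<close> for \<open>v \<in> C - {0}\<close>, uniformly on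
  directions of \<open>C\<close>. Along an admissible curve \<open>A' = A u\<close> the vector \<open>A\<^sup>-\<^sup>1 e\<^sub>1\<close> therefore rotates in one
  direction with a speed comparable to \<open>|u|\<close>. Its angle lifts to a time function on the universal cover, so all
  admissible curves from \<open>x0\<close> to \<open>x1\<close> take the same clock time \<open>S\<close>, and parametrized by the clock
  they are uniformly Lipschitz. Write \<open>U\<close> for the integral of \<open>u\<close> and \<open>l\<close> for the length travelled. By
  Jensen's inequality the increments of \<open>(U, l)\<close> lie in the hypograph of the anti-norm, a closed convex cone, and
  \<open>A(t) - A(s) = A(s) (U(t) - U(s)) + O((t - s)\<^sup>2)\<close>. These conditions survive uniform limits, so
  \<open>l(S)\<close> attains its maximum by Arzela-Ascoli; since Lipschitz functions are differentiable almost everywhere, a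
  limit satisfying them is an admissible curve of length at least \<open>l(S)\<close>, after a reparametrization
  that makes it differentiable everywhere.\<close>

section \<open>Differentiability of Lipschitz functions\<close>

text \<open>In \<open>SL2\<close> itself every nonzero \<open>v\<close> of \<open>C\<close>
  generates a closed admissible curve, so lengths can be unbounded there; this is why the angle has
  to be lifted. The clock uses \<open>A^-1 e1\<close> and not \<open>A e1\<close> because
  \<open>A' = A u\<close> gives \<open>w' = - u w\<close> for \<open>w = A^-1 e1\<close>: the
  angular speed depends only on \<open>u\<close> and the direction of \<open>w\<close>, so its
  bounds do not involve \<open>A\<close>, whereas \<open>A e1\<close> turns with speed
  \<open>u$2$1 / |A e1|^2\<close>, which degenerates as \<open>A\<close> grows. Velocities along a
  maximizing sequence need not converge, so only increments are compared, and \<open>l\<close> obeys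
  an inequality rather than an equation, because equality is lost in the limit. The last obstacle is
  the definition of length: the integral over \<open>lborel\<close> is 0 by convention when the
  integrand is not Borel measurable, and values on a null set can destroy measurability. Hence a
  competitor may count with length 0, and the limit must have a controlled velocity at every
  interior time: a new parameter passes the bad null set with speed 0. The inverse of that parameter
  is a function of Zahorski type, with infinite derivative on a null set.\<close>

lemma Vitali_covering_intervals:
  fixes E U :: "real set"
  assumes U: "open U" "E \<subseteq> U"
    and fine: "\<And>x d. x \<in> E \<Longrightarrow> d > 0 \<Longrightarrow> \<exists>a b. a < b \<and> b - a < d \<and> x \<in> {a..b} \<and> P a b"
  obtains D where "countable D" "\<And>a b. (a, b) \<in> D \<Longrightarrow> a < b \<and> {a..b} \<subseteq> U \<and> P a b"
    "disjoint_family_on (\<lambda>(a, b). {a..b}) D" "negligible (E - (\<Union>(a, b)\<in>D. {a<..<b}))"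
proof -
  \<comment> \<open>Indexing the closed balls by pairs of endpoints lets a covering interval contain
    \<open>x\<close> anywhere, not only at its midpoint; secants through \<open>x\<close> require
    this.\<close>
  define K where "K = {(a, b). a < b \<and> {a..b} \<subseteq> U \<and> P a b}"
  define c where "c = (\<lambda>(a, b). (a + b) / 2 :: real)"
  define r where "r = (\<lambda>(a, b). (b - a) / 2 :: real)"
  have cb: "cball (c i) (r i) = (case i of (a, b) \<Rightarrow> {a..b})" for i
    by (cases i) (auto simp: c_def r_def cball_eq_atLeastAtMost field_simps)
  have r0: "0 < r i" if "i \<in> K" for i
    using that by (auto simp: K_def r_def)
  have cover: "\<exists>i. i \<in> K \<and> x \<in> cball (c i) (r i) \<and> r i < d" if xd: "x \<in> E" "0 < d" for x d
  proof -
    obtain e where e: "e > 0" "ball x e \<subseteq> U"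
      using U xd by (meson open_contains_ball subsetD)
    obtain a b where ab: "a < b" "b - a < min d e" "x \<in> {a..b}" "P a b"
      using fine[OF xd(1), of "min d e"] e(1) xd(2) by auto
    have "{a..b} \<subseteq> ball x e"
      using ab by (auto simp: dist_real_def)
    with ab e have "(a, b) \<in> K"
      by (auto simp: K_def)
    moreover have "x \<in> cball (c (a, b)) (r (a, b))" "r (a, b) < d"
      unfolding cb using ab by (auto simp: r_def)
    ultimately show ?thesis by blast
  qed
  obtain D where D: "countable D" "D \<subseteq> K"
     "pairwise (\<lambda>i j. disjnt (cball (c i) (r i)) (cball (c j) (r j))) D"
     "negligible (E - (\<Union>i \<in> D. cball (c i) (r i)))"
    using Vitali_covering_theorem_cballs[of K r E c] r0 cover by blast
  show thesis
  proof
    show "countable D" by fact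
    show "a < b \<and> {a..b} \<subseteq> U \<and> P a b" if "(a, b) \<in> D" for a b
      using that D(2) by (auto simp: K_def)
    show "disjoint_family_on (\<lambda>(a, b). {a..b}) D"
      using D(3) unfolding cb disjoint_family_on_def pairwise_def disjnt_def by blast
    \<comment> \<open>The endpoints form a countable set, so passing to open intervals costs only a
      null set. Openness is what allows a second covering inside the first.\<close>
    let ?Z = "fst ` D \<union> snd ` D"
    have "negligible ((E - (\<Union>i \<in> D. cball (c i) (r i))) \<union> ?Z)"
    proof (intro negligible_Un[OF D(4)])
      have "?Z \<in> null_sets lborel"
        using D(1) by (intro countable_imp_null_set_lborel) auto
      then show "negligible ?Z"
        unfolding negligible_iff_null_sets by (rule null_sets_completionI)
    qed
    moreover have "E - (\<Union>(a, b)\<in>D. {a<..<b}) \<subseteq> (E - (\<Union>i \<in> D. cball (c i) (r i))) \<union> ?Z"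
    proof
      fix x assume x: "x \<in> E - (\<Union>(a, b)\<in>D. {a<..<b})"
      show "x \<in> (E - (\<Union>i \<in> D. cball (c i) (r i))) \<union> ?Z"
      proof (cases "x \<in> (\<Union>i \<in> D. cball (c i) (r i))")
        case True
        then obtain a b where ab: "(a, b) \<in> D" "x \<in> {a..b}"
          unfolding cb by auto
        with x have "x = a \<or> x = b" by fastforce
        with ab show ?thesis by force
      qed (use x in auto)
    qed
    ultimately show "negligible (E - (\<Union>(a, b)\<in>D. {a<..<b}))"
      using negligible_subset by blast
  qed
qed

text \<open>Used with Lebesgue measure and the Stieltjes measure of a monotone function, to turn
  bounds on mean slopes into bounds on measures.\<close>

lemma emeasure_disjoint_intervals_le:
  fixes M N :: "real measure" and D :: "(real \<times> real) set"
  assumes "countable D" "disjoint_family_on (\<lambda>(a, b). {a..b}) D"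
    and sets: "sets M = sets borel" "sets N = sets borel"
    and le: "\<And>a b. (a, b) \<in> D \<Longrightarrow> c * emeasure M {a..b} \<le> d * emeasure N {a..b}"
  shows "c * emeasure M (\<Union>(a, b)\<in>D. {a..b}) \<le> d * emeasure N (\<Union>(a, b)\<in>D. {a..b})"
proof -
  have "c * emeasure M (\<Union>(a, b)\<in>D. {a..b}) = (\<integral>\<^sup>+i. c * emeasure M (case i of (a, b) \<Rightarrow> {a..b}) \<partial>count_space D)"
    using assms by (subst emeasure_UN_countable) (auto simp: nn_integral_cmult split: prod.splits)
  also have "\<dots> \<le> (\<integral>\<^sup>+i. d * emeasure N (case i of (a, b) \<Rightarrow> {a..b}) \<partial>count_space D)"
    by (intro nn_integral_mono) (use le in \<open>auto split: prod.splits\<close>)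
  also have "\<dots> = d * emeasure N (\<Union>(a, b)\<in>D. {a..b})"
    using assms by (subst emeasure_UN_countable) (auto simp: nn_integral_cmult split: prod.splits)
  finally show ?thesis .
qed

definition slope :: "(real \<Rightarrow> real) \<Rightarrow> real \<Rightarrow> real \<Rightarrow> real" where
  "slope f x h = (f (x + h) - f x) / h"

text \<open>All four Dini derivates are treated at once, since \<open>h\<close> may have either
  sign. For a function with bounded slopes, differentiability at \<open>x\<close> amounts to no
  oscillation across any rational pair \<open>p < q\<close>.\<close>

definition oscillates :: "(real \<Rightarrow> real) \<Rightarrow> real \<Rightarrow> real \<Rightarrow> real \<Rightarrow> bool" where
  "oscillates f p q x \<longleftrightarrow> (\<forall>d>0. (\<exists>h. h \<noteq> 0 \<and> \<bar>h\<bar> < d \<and> slope f x h < p) \<and> (\<exists>h. h \<noteq> 0 \<and> \<bar>h\<bar> < d \<and> q < slope f x h))"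

lemma oscillatesE:
  assumes "oscillates f p q x" "d > 0"
  obtains h k where "h \<noteq> 0" "\<bar>h\<bar> < d" "slope f x h < p" "k \<noteq> 0" "\<bar>k\<bar> < d" "q < slope f x k"
  using assms unfolding oscillates_def by meson

text \<open>For fixed \<open>h\<close> the slope is continuous in \<open>x\<close>, so for fixed
  \<open>d\<close> each of the two conditions is a union of open sets; it suffices to let
  \<open>d\<close> run through \<open>1 / (n + 1)\<close>.\<close>

lemma oscillates_borel [measurable]:
  assumes "continuous_on UNIV f"
  shows "{x. oscillates f p q x} \<in> sets borel"
proof -
  have cs: "continuous_on UNIV (\<lambda>x. slope f x h)" for h
    unfolding slope_def
    by (cases "h = 0") (auto intro!: continuous_intros continuous_on_compose2[OF assms])
  let ?A = "\<lambda>d. \<Union>h\<in>{h. h \<noteq> 0 \<and> \<bar>h\<bar> < d}. {x. slope f x h < p}"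
  let ?B = "\<lambda>d. \<Union>h\<in>{h. h \<noteq> 0 \<and> \<bar>h\<bar> < d}. {x. q < slope f x h}"
  have op: "open (?A d)" "open (?B d)" for d
    using cs by (auto intro!: open_UN open_Collect_less continuous_intros)
  have "oscillates f p q x \<longleftrightarrow> x \<in> (\<Inter>n::nat. ?A (1 / (n + 1)) \<inter> ?B (1 / (n + 1)))" for x
  proof
    assume "oscillates f p q x"
    then have "x \<in> ?A (1 / (real n + 1)) \<inter> ?B (1 / (real n + 1))" for n
    proof -
      obtain h k where "h \<noteq> 0" "\<bar>h\<bar> < 1 / (real n + 1)" "slope f x h < p" "k \<noteq> 0" "\<bar>k\<bar> < 1 / (real n + 1)" "q < slope f x k"
        using oscillatesE[OF \<open>oscillates f p q x\<close>, of "1 / (real n + 1)"] by auto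
      then have "x \<in> ?A (1 / (real n + 1))" "x \<in> ?B (1 / (real n + 1))"
        by (rule_tac UN_I[of h], simp, simp, rule_tac UN_I[of k], simp, simp)
      then show ?thesis by simp
    qed
    then show "x \<in> (\<Inter>n::nat. ?A (1 / (n + 1)) \<inter> ?B (1 / (n + 1)))"
      by blast
  next
    assume R: "x \<in> (\<Inter>n::nat. ?A (1 / (n + 1)) \<inter> ?B (1 / (n + 1)))"
    show "oscillates f p q x"
      unfolding oscillates_def
    proof (intro allI impI)
      fix d :: real assume "d > 0"
      then obtain n where n: "1 / (real n + 1) < d"
        using nat_approx_posE[of d] by (metis of_nat_Suc add.commute)
      have "x \<in> ?A (1 / (real n + 1)) \<inter> ?B (1 / (real n + 1))" using R by blast
      then obtain h k where "h \<noteq> 0" "\<bar>h\<bar> < 1 / (real n + 1)" "slope f x h < p" "k \<noteq> 0" "\<bar>k\<bar> < 1 / (real n + 1)" "q < slope f x k"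
        by auto
      then show "(\<exists>h. h \<noteq> 0 \<and> \<bar>h\<bar> < d \<and> slope f x h < p) \<and> (\<exists>h. h \<noteq> 0 \<and> \<bar>h\<bar> < d \<and> q < slope f x h)"
        using order.strict_trans[OF _ n] by metis
    qed
  qed
  then have "{x. oscillates f p q x} = (\<Inter>n::nat. ?A (1 / (n + 1)) \<inter> ?B (1 / (n + 1)))"
    by blast
  then show ?thesis
    using op by (auto intro!: sets.countable_INT borel_open)
qed

lemma slope_eq_secant:
  assumes "h \<noteq> 0" "\<bar>h\<bar> < d"
  shows "\<exists>a b. a < b \<and> b - a < d \<and> x \<in> {a..b} \<and> (f b - f a) = slope f x h * (b - a)"
proof (cases "h > 0")
  case True
  then show ?thesis using assms by (intro exI[of _ x] exI[of _ "x + h"]) (auto simp: slope_def)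
next
  case False
  then show ?thesis using assms by (intro exI[of _ "x + h"] exI[of _ x]) (auto simp: slope_def field_simps)
qed

text \<open>Cover the set by intervals of mean slope below \<open>p\<close>, then its trace on these by intervals of mean
  slope above \<open>q\<close>, and compare the two increments of \<open>f\<close>.\<close>

lemma mono_oscillates_null:
  assumes "mono f" and cont: "continuous_on UNIV f" and pq: "0 \<le> p" "p < q"
  shows "{x. oscillates f p q x} \<in> null_sets lborel"
proof -
  let ?\<mu> = "interval_measure f"
  note [measurable] = oscillates_borel[OF cont]
  have icc: "emeasure ?\<mu> {a..b} = ennreal (f b - f a)" if "a \<le> b" for a b
    using assms that by (intro emeasure_interval_measure_Icc) (auto simp: mono_def)
  have bounded_part: "emeasure lborel {x\<in>{a<..<b}. oscillates f p q x} = 0" for a b :: real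
  proof -
    define E where "E = {x\<in>{a<..<b}. oscillates f p q x}"
    have "E = {a<..<b} \<inter> {x. oscillates f p q x}" by (auto simp: E_def)
    then have Eb[measurable]: "E \<in> sets borel" by simp
    have "emeasure lborel E \<le> emeasure lborel {a<..<b}"
      by (intro emeasure_mono) (auto simp: E_def)
    then have fin: "emeasure lborel E < \<infinity>"
      by (cases "a \<le> b") (auto simp: less_top[symmetric] top_unique)
    define m where "m = measure lborel E"
    have m: "emeasure lborel E = ennreal m" "m \<ge> 0"
      using fin by (auto simp: m_def emeasure_eq_ennreal_measure)
    have *: "q * m \<le> p * (m + e)" if e: "e > 0" for e
    proof -
      obtain U where U: "open U" "E \<subseteq> U" "emeasure lborel (U - E) < ennreal e"
        using outer_regular_lborel[OF Eb e] by blast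
      have Ule: "emeasure lborel U \<le> ennreal (m + e)"
      proof -
        have "emeasure lborel U = emeasure lborel E + emeasure lborel (U - E)"
          using U by (subst plus_emeasure) (auto simp: Un_absorb1)
        also have "\<dots> \<le> ennreal m + ennreal e" using U m by (auto intro: add_left_mono)
        finally show ?thesis using m e by simp
      qed
      have "\<exists>a b. a < b \<and> b - a < d \<and> x \<in> {a..b} \<and> f b - f a \<le> p * (b - a)" if "x \<in> E" "d > 0" for x d
      proof -
        have osc: "oscillates f p q x" using that by (simp add: E_def)
        obtain h where h: "h \<noteq> 0" "\<bar>h\<bar> < d" "slope f x h < p"
          using oscillatesE[OF osc \<open>d > 0\<close>] by metis
        obtain a b where "a < b \<and> b - a < d \<and> x \<in> {a..b} \<and> (f b - f a) = slope f x h * (b - a)"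
          using slope_eq_secant[OF h(1,2)] by blast
        moreover from this have "slope f x h * (b - a) \<le> p * (b - a)"
          using h(3) by (intro mult_right_mono) auto
        ultimately show ?thesis by metis
      qed
      then obtain D1 where D1: "countable D1"
        "\<And>a b. (a, b) \<in> D1 \<Longrightarrow> a < b \<and> {a..b} \<subseteq> U \<and> f b - f a \<le> p * (b - a)"
        "disjoint_family_on (\<lambda>(a, b). {a..b}) D1" "negligible (E - (\<Union>(a, b)\<in>D1. {a<..<b}))"
        using Vitali_covering_intervals[OF U(1,2), of "\<lambda>a b. f b - f a \<le> p * (b - a)"] by blast
      \<comment> \<open>The second covering is restricted to these open intervals, so that its union
        \<open>B2\<close> lies in \<open>B1\<close> and monotonicity of the Stieltjes measure
        applies.\<close>
      define U1 where "U1 = (\<Union>(a, b)\<in>D1. {a<..<b})"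
      have U1: "open U1" unfolding U1_def by (auto intro!: open_UN)
      have "\<exists>a b. a < b \<and> b - a < d \<and> x \<in> {a..b} \<and> q * (b - a) \<le> f b - f a" if "x \<in> E \<inter> U1" "d > 0" for x d
      proof -
        have osc: "oscillates f p q x" using that by (simp add: E_def)
        obtain h where h: "h \<noteq> 0" "\<bar>h\<bar> < d" "q < slope f x h"
          using oscillatesE[OF osc \<open>d > 0\<close>] by metis
        obtain a b where "a < b \<and> b - a < d \<and> x \<in> {a..b} \<and> (f b - f a) = slope f x h * (b - a)"
          using slope_eq_secant[OF h(1,2)] by blast
        moreover from this have "q * (b - a) \<le> slope f x h * (b - a)"
          using h(3) by (intro mult_right_mono) auto
        ultimately show ?thesis by metis
      qed
      then obtain D2 where D2: "countable D2"
        "\<And>a b. (a, b) \<in> D2 \<Longrightarrow> a < b \<and> {a..b} \<subseteq> U1 \<and> q * (b - a) \<le> f b - f a"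
        "disjoint_family_on (\<lambda>(a, b). {a..b}) D2" "negligible (E \<inter> U1 - (\<Union>(a, b)\<in>D2. {a<..<b}))"
        using Vitali_covering_intervals[OF U1, of "E \<inter> U1" "\<lambda>a b. q * (b - a) \<le> f b - f a"] by blast
      define B1 where "B1 = (\<Union>(a, b)\<in>D1. {a..b})"
      define B2 where "B2 = (\<Union>(a, b)\<in>D2. {a..b})"
      have Bm[measurable]: "B1 \<in> sets borel" "B2 \<in> sets borel"
        unfolding B1_def B2_def using D1(1) D2(1) by (auto intro!: sets.countable_UN' split: prod.splits)
      have "U1 \<subseteq> B1" unfolding U1_def B1_def by fastforce
      moreover have "B2 \<subseteq> U1" using D2(2) unfolding B2_def by fast
      ultimately have B21: "B2 \<subseteq> B1" by blast
      have B1U: "B1 \<subseteq> U" using D1(2) unfolding B1_def by fast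
      have "negligible (E - B2)"
      proof (rule negligible_subset)
        show "negligible ((E - U1) \<union> (E \<inter> U1 - (\<Union>(a, b)\<in>D2. {a<..<b})))"
          using D1(4) D2(4) by (auto simp: U1_def)
        show "E - B2 \<subseteq> (E - U1) \<union> (E \<inter> U1 - (\<Union>(a, b)\<in>D2. {a<..<b}))"
          unfolding B2_def by fastforce
      qed
      then have "emeasure lborel (E - B2) = 0"
        by (simp add: negligible_iff_emeasure0)
      then have "emeasure lborel E \<le> emeasure lborel B2"
        by (intro emeasure_mono_AE AE_I[where N = "E - B2"]) auto
      then have "ennreal q * emeasure lborel E \<le> ennreal q * emeasure lborel B2"
        by (rule mult_left_mono) simp
      also have "\<dots> \<le> 1 * emeasure ?\<mu> B2"
        unfolding B2_def using D2 pq
        by (intro emeasure_disjoint_intervals_le) (auto simp: icc less_imp_le ennreal_mult[symmetric] ennreal_leI)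
      also have "\<dots> \<le> 1 * emeasure ?\<mu> B1"
        by (intro mult_left_mono emeasure_mono B21) auto
      also have "\<dots> \<le> ennreal p * emeasure lborel B1"
        unfolding B1_def using D1 pq
        by (intro emeasure_disjoint_intervals_le) (auto simp: icc less_imp_le ennreal_mult[symmetric] ennreal_leI)
      also have "\<dots> \<le> ennreal p * emeasure lborel U"
        by (intro mult_left_mono emeasure_mono B1U) (use U in auto)
      also have "\<dots> \<le> ennreal p * ennreal (m + e)"
        by (intro mult_left_mono Ule) auto
      finally show ?thesis
        using m pq e by (simp add: ennreal_mult[symmetric] ennreal_le_iff del: ennreal_plus)
    qed
    \<comment> \<open>Let \<open>e\<close> tend to 0; the division by \<open>p + 1\<close> below
      also covers \<open>p = 0\<close>. With \<open>p < q\<close> this forces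
      \<open>m = 0\<close>.\<close>
    have "q * m \<le> p * m"
    proof (rule field_le_epsilon)
      fix e :: real assume "e > 0"
      then show "q * m \<le> p * m + e"
      proof -
        have "p * (e / (p + 1)) \<le> e" using pq \<open>e > 0\<close> by (simp add: field_simps)
        then show ?thesis
          using *[of "e / (p + 1)"] pq \<open>e > 0\<close> by (simp add: distrib_left)
      qed
    qed
    then have "m = 0"
      using m pq by (metis mult_le_cancel_right not_le order_antisym)
    then show ?thesis using m by (simp add: E_def)
  qed
  have "{x. oscillates f p q x} = (\<Union>n::nat. {x\<in>{-real n<..<real n}. oscillates f p q x})"
  proof -
    have "\<exists>n::nat. - real n < x \<and> x < real n" for x
      using reals_Archimedean2[of "\<bar>x\<bar>"] by (metis abs_less_iff minus_less_iff)
    then show ?thesis by auto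
  qed
  also have "\<dots> \<in> null_sets lborel"
  proof (rule null_sets_UN)
    fix n :: nat
    have "{x\<in>{-real n<..<real n}. oscillates f p q x} = {-real n<..<real n} \<inter> {x. oscillates f p q x}"
      by auto
    also have "\<dots> \<in> sets borel" by (intro sets.Int oscillates_borel cont) auto
    finally show "{x\<in>{-real n<..<real n}. oscillates f p q x} \<in> null_sets lborel"
      using bounded_part by (simp add: null_sets_def)
  qed
  finally show ?thesis .
qed

text \<open>\<open>S\<close> collects the eventual lower bounds of the slopes, so
  \<open>Sup S\<close> is the lower derivate. If slopes at arbitrarily small \<open>h\<close>
  exceeded it by \<open>e\<close>, they would oscillate across a rational pair in between.\<close>

lemma differentiable_if_not_oscillates:
  assumes bd: "\<And>h. h \<noteq> 0 \<Longrightarrow> \<bar>slope f x h\<bar> \<le> L"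
    and no: "\<And>p q. p \<in> \<rat> \<Longrightarrow> q \<in> \<rat> \<Longrightarrow> p < q \<Longrightarrow> \<not> oscillates f p q x"
  shows "f differentiable (at x)"
proof -
  define S where "S = {p. \<exists>d>0. \<forall>h. h \<noteq> 0 \<and> \<bar>h\<bar> < d \<longrightarrow> p \<le> slope f x h}"
  have le: "p \<le> L" if p: "p \<in> S" for p
  proof -
    obtain d where d: "d > 0" "\<And>h. h \<noteq> 0 \<Longrightarrow> \<bar>h\<bar> < d \<Longrightarrow> p \<le> slope f x h"
      using p by (auto simp: S_def)
    then have "p \<le> slope f x (d / 2)" by auto
    also have "\<dots> \<le> L" using bd[of "d / 2"] d by auto
    finally show ?thesis .
  qed
  have "- L \<in> S"
    unfolding S_def using bd by (force intro!: exI[of _ 1] simp: abs_le_iff)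
  define l where "l = Sup S"
  have bdd: "bdd_above S" using le by (auto simp: bdd_above_def)
  have "slope f x \<midarrow>0\<rightarrow> l"
  proof (rule LIM_I)
    fix e :: real assume e: "e > 0"
    obtain p0 where p0: "p0 \<in> S" "l - e < p0"
      using less_cSup_iff[of S "l - e"] \<open>- L \<in> S\<close> bdd e by (auto simp: l_def)
    then obtain d0 where d0: "d0 > 0" "\<And>h. h \<noteq> 0 \<Longrightarrow> \<bar>h\<bar> < d0 \<Longrightarrow> p0 \<le> slope f x h"
      by (auto simp: S_def)
    obtain p where p: "p \<in> \<rat>" "l < p" "p < l + e"
      using Rats_dense_in_real[of l "l + e"] e by auto
    obtain q where q: "q \<in> \<rat>" "p < q" "q < l + e"
      using Rats_dense_in_real[of p "l + e"] p by auto
    have "p \<notin> S" using p(2) cSup_upper[OF _ bdd] by (force simp: l_def)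
    then have *: "\<exists>h. h \<noteq> 0 \<and> \<bar>h\<bar> < d \<and> slope f x h < p" if "d > 0" for d
      using that by (auto simp: S_def not_le)
    obtain d1 where d1: "d1 > 0" "\<And>h. h \<noteq> 0 \<Longrightarrow> \<bar>h\<bar> < d1 \<Longrightarrow> slope f x h \<le> q"
      using no[OF p(1) q(1,2)] * unfolding oscillates_def by (meson not_le)
    show "\<exists>s>0. \<forall>h. h \<noteq> 0 \<and> norm (h - 0) < s \<longrightarrow> norm (slope f x h - l) < e"
    proof (intro exI[of _ "min d0 d1"] conjI allI impI)
      show "min d0 d1 > 0" using d0 d1 by auto
      fix h :: real assume "h \<noteq> 0 \<and> norm (h - 0) < min d0 d1"
      then have "p0 \<le> slope f x h" "slope f x h \<le> q" using d0 d1 by auto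
      then show "norm (slope f x h - l) < e" using p0 q by (auto simp: abs_less_iff)
    qed
  qed
  then have "(f has_real_derivative l) (at x)"
    by (simp add: DERIV_def slope_def[abs_def])
  then show ?thesis
    using real_differentiable_def by blast
qed

lemma not_differentiable_if_oscillates:
  assumes "p < q" "oscillates f p q x"
  shows "\<not> f differentiable (at x)"
proof
  assume "f differentiable (at x)"
  then obtain l where "(f has_real_derivative l) (at x)"
    using real_differentiableE by blast
  then have lim: "slope f x \<midarrow>0\<rightarrow> l"
    by (simp add: DERIV_def slope_def[abs_def])
  obtain d where d: "d > 0" "\<And>h. h \<noteq> 0 \<Longrightarrow> \<bar>h\<bar> < d \<Longrightarrow> \<bar>slope f x h - l\<bar> < (q - p) / 2"
    using LIM_D[OF lim, of "(q - p) / 2"] assms(1) by auto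
  obtain h k where "h \<noteq> 0" "\<bar>h\<bar> < d" "slope f x h < p" "k \<noteq> 0" "\<bar>k\<bar> < d" "q < slope f x k"
    using oscillatesE[OF assms(2) d(1)] by metis
  with d(2)[of h] d(2)[of k] show False
    by argo
qed

text \<open>Adding \<open>L * x\<close> makes the function nondecreasing and keeps its points of
  differentiability. Its slopes are nonnegative, so no pair with \<open>p < 0\<close> oscillates,
  and the other countably many rational pairs give null sets.\<close>

lemma lipschitz_not_differentiable_null_real:
  fixes f :: "real \<Rightarrow> real"
  assumes L: "L-lipschitz_on UNIV f"
  shows "{x. \<not> f differentiable (at x)} \<in> null_sets lborel"
proof -
  have L0: "L \<ge> 0" and Ld: "\<bar>f y - f x\<bar> \<le> L * \<bar>y - x\<bar>" for x y
    using lipschitz_onD[OF L, of x y] lipschitz_on_nonneg[OF L] by (auto simp: dist_real_def abs_minus_commute)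
  define g where "g x = f x + L * x" for x
  have contf: "continuous_on UNIV f" by (rule lipschitz_on_continuous_on[OF L])
  then have contg: "continuous_on UNIV g" unfolding g_def by (intro continuous_intros)
  have mono: "mono g"
  proof (rule monoI)
    fix x y :: real assume "x \<le> y"
    then show "g x \<le> g y" using Ld[of y x] by (simp add: g_def algebra_simps abs_if split: if_splits)
  qed
  have slg: "slope g x h = slope f x h + L" if "h \<noteq> 0" for x h
    using that by (simp add: slope_def g_def field_simps)
  have slf: "\<bar>slope f x h\<bar> \<le> L" if "h \<noteq> 0" for x h
    using Ld[of "x + h" x] that by (simp add: slope_def abs_divide field_simps)
  have slb: "\<bar>slope g x h\<bar> \<le> 2 * L" if "h \<noteq> 0" for x h
    using slf[OF that, of x] slg[OF that, of x] by simp
  have fg: "f differentiable (at x) \<longleftrightarrow> g differentiable (at x)" for x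
  proof
    assume "g differentiable (at x)"
    then have "(\<lambda>x. g x - L * x) differentiable (at x)"
      by (intro differentiable_diff) auto
    then show "f differentiable (at x)" by (simp add: g_def)
  next
    assume "f differentiable (at x)"
    then show "g differentiable (at x)"
      unfolding g_def by (intro differentiable_add) auto
  qed
  have osc: "{x. oscillates g p q x} \<in> null_sets lborel" if "p < q" for p q
  proof (cases "0 \<le> p")
    case True
    then show ?thesis using mono_oscillates_null[OF mono contg] that by simp
  next
    case False
    have "\<not> oscillates g p q x" for x
    proof
      assume "oscillates g p q x"
      then obtain h where "h \<noteq> 0" "slope g x h < p"
        unfolding oscillates_def using zero_less_one by blast
      then show False using slg[of h x] slf[of h x] False by linarith
    qed
    then show ?thesis by simp
  qed
  have "{x. \<not> f differentiable (at x)} = (\<Union>(p, q)\<in>{(p, q). p \<in> \<rat> \<and> q \<in> \<rat> \<and> p < q}. {x. oscillates g p q x})"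
    using differentiable_if_not_oscillates[OF slb] not_differentiable_if_oscillates fg by fast
  also have "\<dots> \<in> null_sets lborel"
  proof (rule null_sets_UN')
    have "countable (\<rat> \<times> \<rat> :: (real \<times> real) set)" using countable_rat by blast
    then show "countable {(p, q :: real). p \<in> \<rat> \<and> q \<in> \<rat> \<and> p < q}"
      by (rule countable_subset[rotated]) auto
  qed (use osc in auto)
  finally show ?thesis .
qed

lemma differentiable_componentwise_at:
  fixes f :: "real \<Rightarrow> 'a::euclidean_space"
  shows "f differentiable (at x) \<longleftrightarrow> (\<forall>b\<in>Basis. (\<lambda>x. f x \<bullet> b) differentiable (at x))"
  using differentiable_componentwise_within[of f x UNIV] by simp

lemma lipschitz_not_differentiable_null:
  fixes f :: "real \<Rightarrow> 'a::euclidean_space"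
  assumes L: "L-lipschitz_on UNIV f"
  shows "{x. \<not> f differentiable (at x)} \<in> null_sets lborel"
proof -
  have "L-lipschitz_on UNIV (\<lambda>x. f x \<bullet> b)" if "b \<in> Basis" for b
  proof (rule lipschitz_onI)
    fix x y
    have "dist (f x \<bullet> b) (f y \<bullet> b) \<le> dist (f x) (f y)"
      using that by (simp add: dist_norm inner_diff_left[symmetric] Basis_le_norm)
    also have "\<dots> \<le> L * dist x y" using lipschitz_onD[OF L] by simp
    finally show "dist (f x \<bullet> b) (f y \<bullet> b) \<le> L * dist x y" .
  qed (rule lipschitz_on_nonneg[OF L])
  then have "(\<Union>b\<in>Basis. {x. \<not> (\<lambda>x. f x \<bullet> b) differentiable (at x)}) \<in> null_sets lborel"
    by (intro null_sets_UN' lipschitz_not_differentiable_null_real) (auto intro: countable_finite)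
  moreover have "{x. \<not> f differentiable (at x)} = (\<Union>b\<in>Basis. {x. \<not> (\<lambda>x. f x \<bullet> b) differentiable (at x)})"
    by (auto simp: differentiable_componentwise_at[of f])
  ultimately show ?thesis by simp
qed

section \<open>The fundamental theorem of calculus for Lipschitz functions\<close>

lemma lipschitz_clamp:
  fixes f :: "real \<Rightarrow> 'a::metric_space"
  assumes L: "L-lipschitz_on {a..b} f" and "a \<le> b"
  shows "L-lipschitz_on UNIV (\<lambda>x. f (max a (min b x)))"
proof (rule lipschitz_onI)
  fix x y :: real
  have "dist (f (max a (min b x))) (f (max a (min b y))) \<le> L * dist (max a (min b x)) (max a (min b y))"
    using assms by (intro lipschitz_onD[OF L]) auto
  also have "\<dots> \<le> L * dist x y"
    by (intro mult_left_mono lipschitz_on_nonneg[OF L]) (auto simp: dist_real_def)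
  finally show "dist (f (max a (min b x))) (f (max a (min b y))) \<le> L * dist x y" .
qed (rule lipschitz_on_nonneg[OF L])

lemma has_vector_derivative_iff_quotient:
  "(f has_vector_derivative D) (at x within S) \<longleftrightarrow> ((\<lambda>y. (f y - f x) /\<^sub>R (y - x)) \<longlongrightarrow> D) (at x within S)"
proof -
  have "(f has_vector_derivative D) (at x within S) \<longleftrightarrow> ((\<lambda>y. norm ((f y - f x - (y - x) *\<^sub>R D) /\<^sub>R norm (y - x))) \<longlongrightarrow> 0) (at x within S)"
    unfolding has_vector_derivative_def has_derivative_at_within tendsto_norm_zero_iff
    by (simp add: bounded_linear_scaleR_left)
  also have "\<dots> \<longleftrightarrow> ((\<lambda>y. norm ((f y - f x) /\<^sub>R (y - x) - D)) \<longlongrightarrow> 0) (at x within S)"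
  proof (rule filterlim_cong[OF refl refl])
    have "norm ((f y - f x - (y - x) *\<^sub>R D) /\<^sub>R norm (y - x)) = norm ((f y - f x) /\<^sub>R (y - x) - D)" if "y \<noteq> x" for y
    proof -
      have "(f y - f x) /\<^sub>R (y - x) - D = (f y - f x - (y - x) *\<^sub>R D) /\<^sub>R (y - x)"
        using that by (simp add: scaleR_diff_right)
      then show ?thesis by (simp add: divide_inverse)
    qed
    then show "\<forall>\<^sub>F y in at x within S. norm ((f y - f x - (y - x) *\<^sub>R D) /\<^sub>R norm (y - x)) = norm ((f y - f x) /\<^sub>R (y - x) - D)"
      by (auto simp: eventually_at_filter)
  qed
  also have "\<dots> \<longleftrightarrow> ((\<lambda>y. (f y - f x) /\<^sub>R (y - x)) \<longlongrightarrow> D) (at x within S)"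
    unfolding tendsto_norm_zero_iff by (rule Lim_null[symmetric])
  finally show ?thesis .
qed

lemma has_vector_derivative_imp_seq_limit:
  assumes "(f has_vector_derivative D) (at x)"
  shows "(\<lambda>n. (real n + 1) *\<^sub>R (f (x + 1 / (real n + 1)) - f x)) \<longlonglongrightarrow> D"
proof -
  have "((\<lambda>y. (f y - f x) /\<^sub>R (y - x)) \<longlongrightarrow> D) (at x)"
    using assms by (simp add: has_vector_derivative_iff_quotient)
  moreover have "filterlim (\<lambda>n. x + 1 / (real n + 1)) (at x) sequentially"
    unfolding filterlim_at
  proof
    have "(\<lambda>n. x + 1 / (real n + 1)) \<longlonglongrightarrow> x + 0"
      using LIMSEQ_inverse_real_of_nat by (intro tendsto_intros) (simp add: inverse_eq_divide add.commute)
    then show "(\<lambda>n. x + 1 / (real n + 1)) \<longlonglongrightarrow> x" by simp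
  qed auto
  ultimately have "(\<lambda>n. (f (x + 1 / (real n + 1)) - f x) /\<^sub>R (x + 1 / (real n + 1) - x)) \<longlonglongrightarrow> D"
    by (rule filterlim_compose)
  then show ?thesis by simp
qed

text \<open>Difference quotients with steps \<open>1 / (n + 1)\<close> are bounded by
  \<open>L\<close>, so dominated convergence applies; their integrals are differences of averages of
  \<open>f\<close> at the two ends, computed from an antiderivative \<open>G\<close>.\<close>

lemma lipschitz_has_integral_derivative:
  fixes f :: "real \<Rightarrow> 'a::euclidean_space"
  assumes L: "L-lipschitz_on {a..b} f" and ab: "a \<le> b" and N: "negligible N"
    and der: "\<And>x. x \<in> {a..b} - N \<Longrightarrow> (f has_vector_derivative f' x) (at x)"
  shows "(f' has_integral f b - f a) {a..b}"
proof -
  define g where "g x = f (max a (min b x))" for x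
  have Lg: "L-lipschitz_on UNIV g" unfolding g_def by (rule lipschitz_clamp[OF L ab])
  have L0: "L \<ge> 0" by (rule lipschitz_on_nonneg[OF L])
  define h where "h n = 1 / (real n + 1)" for n
  have h: "0 < h n" "h n \<le> 1" for n by (auto simp: h_def field_simps)
  define N' where "N' = N \<union> {a, b}"
  have N': "negligible N'" unfolding N'_def using N by auto
  define F where "F n x = (real n + 1) *\<^sub>R (g (x + h n) - g x)" for n x
  have cont: "continuous_on UNIV g" by (rule lipschitz_on_continuous_on[OF Lg])
  \<comment> \<open>The interval is enlarged so that \<open>x + h n\<close> stays where
    \<open>G\<close> has a two-sided derivative.\<close>
  obtain G where G: "\<And>x. x \<in> {a-1..b+2} \<Longrightarrow> (G has_vector_derivative g x) (at x within {a-1..b+2})"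
    using antiderivative_continuous[of "a-1" "b+2" g] continuous_on_subset[OF cont] by blast
  have Gat: "(G has_vector_derivative g x) (at x)" if "x \<in> {a..b+1}" for x
    using G[of x] at_within_Icc_at[of "a-1" x "b+2"] that by auto
  define y where "y n = (real n + 1) *\<^sub>R ((G (b + h n) - G b) - (G (a + h n) - G a))" for n
  have Fy: "(F n has_integral y n) {a..b}" for n
  proof -
    have "((\<lambda>x. G (x + h n)) has_vector_derivative g (x + h n)) (at x within {a..b})" if "x \<in> {a..b}" for x
    proof -
      have "((\<lambda>x. x + h n) has_vector_derivative 1) (at x within {a..b})"
        by (auto intro!: derivative_eq_intros)
      moreover have "(G has_vector_derivative g (x + h n)) (at (x + h n) within (\<lambda>x. x + h n) ` {a..b})"
        using that h[of n] by (intro has_vector_derivative_at_within[OF Gat]) auto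
      ultimately show ?thesis
        using vector_diff_chain_within[of "\<lambda>x. x + h n" 1 x "{a..b}" G "g (x + h n)"] by (simp add: o_def)
    qed
    then have "((\<lambda>x. g (x + h n) - g x) has_integral (G (b + h n) - G b) - (G (a + h n) - G a)) {a..b}"
      by (intro fundamental_theorem_of_calculus[OF ab] has_vector_derivative_diff has_vector_derivative_at_within[OF Gat]) auto
    then show ?thesis
      unfolding F_def[abs_def] y_def by (rule has_integral_cmul)
  qed
  have ylim: "y \<longlonglongrightarrow> f b - f a"
  proof -
    have "(\<lambda>n. (real n + 1) *\<^sub>R (G (b + h n) - G b) - (real n + 1) *\<^sub>R (G (a + h n) - G a)) \<longlonglongrightarrow> g b - g a"
      unfolding h_def using ab by (intro tendsto_diff has_vector_derivative_imp_seq_limit Gat) auto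
    then show ?thesis
      using ab by (simp add: y_def[abs_def] g_def scaleR_diff_right)
  qed
  have Fb: "norm (F n x) \<le> L" for n x
  proof -
    have "norm (g (x + h n) - g x) \<le> L * h n"
      using lipschitz_onD[OF Lg, of "x + h n" x] h[of n] by (simp add: dist_norm)
    then have "(real n + 1) * norm (g (x + h n) - g x) \<le> (real n + 1) * (L * h n)"
      by (intro mult_left_mono) auto
    also have "\<dots> = L" by (simp add: h_def)
    finally show ?thesis by (simp add: F_def)
  qed
  have "((\<lambda>x. if x \<in> N' then 0 else f' x) has_integral f b - f a) {a..b}"
  proof (rule has_integral_dominated_convergence)
    show "((\<lambda>x. if x \<in> N' then 0 else F n x) has_integral y n) {a..b}" for n
      by (rule has_integral_spike[OF N' _ Fy]) auto
    show "(\<lambda>x. L) integrable_on {a..b}" by auto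
    show "\<forall>x\<in>{a..b}. norm (if x \<in> N' then 0 else F n x) \<le> L" for n using Fb L0 by auto
    show "\<forall>x\<in>{a..b}. (\<lambda>n. if x \<in> N' then 0 else F n x) \<longlonglongrightarrow> (if x \<in> N' then 0 else f' x)"
    proof
      fix x assume x: "x \<in> {a..b}"
      show "(\<lambda>n. if x \<in> N' then 0 else F n x) \<longlonglongrightarrow> (if x \<in> N' then 0 else f' x)"
      proof (cases "x \<in> N'")
        case False
        then have x': "a < x" "x < b" and "(f has_vector_derivative f' x) (at x)"
          using x der by (auto simp: N'_def)
        then have "(g has_vector_derivative f' x) (at x)"
          by (rule_tac has_vector_derivative_transform_within_open[of f _ _ "{a<..<b}"]) (auto simp: g_def)
        from has_vector_derivative_imp_seq_limit[OF this] False show ?thesis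
          by (simp add: F_def h_def)
      qed auto
    qed
    show "y \<longlonglongrightarrow> f b - f a" by (rule ylim)
  qed
  then show ?thesis
    by (rule has_integral_spike[OF N', rotated]) auto
qed

lemma nonneg_has_integral_0_imp_negligible:
  fixes f :: "real \<Rightarrow> real"
  assumes f: "(f has_integral 0) {a..b}" and N: "negligible N" and nn: "\<And>x. x \<in> {a..b} - N \<Longrightarrow> f x \<ge> 0"
  shows "negligible {x\<in>{a..b}. f x \<noteq> 0}"
proof -
  define g where "g x = (if x \<in> N then 0 else f x)" for x
  have g: "(g has_integral 0) {a..b}"
    by (rule has_integral_spike[OF N _ f]) (auto simp: g_def)
  have gn: "g x \<ge> 0" if "x \<in> {a..b}" for x using nn[of x] that by (auto simp: g_def)
  have ai: "g absolutely_integrable_on {a..b}"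
    using g gn by (intro nonnegative_absolutely_integrable_1) auto
  then have int: "integrable lebesgue (\<lambda>x. indicator {a..b} x *\<^sub>R g x)"
    by (simp add: set_integrable_def)
  have "(LINT x|lebesgue. indicator {a..b} x *\<^sub>R g x) = 0"
    using set_lebesgue_integral_eq_integral(2)[OF ai] g by (simp add: set_lebesgue_integral_def integral_unique)
  then have "AE x in lebesgue. indicator {a..b} x *\<^sub>R g x = 0"
    using int gn by (subst (asm) integral_nonneg_eq_0_iff_AE) (auto simp: indicator_def)
  then have "negligible {x. indicator {a..b} x *\<^sub>R g x \<noteq> 0}"
    unfolding eventually_ae_filter by (auto simp: negligible_iff_null_sets intro: negligible_subset[unfolded negligible_iff_null_sets])
  then have "negligible ({x. indicator {a..b} x *\<^sub>R g x \<noteq> 0} \<union> N)" using N by (rule negligible_Un)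
  then show ?thesis
    by (rule negligible_subset) (auto simp: g_def indicator_def)
qed

section \<open>Points of Lebesgue density 0\<close>

definition thin_at :: "real set \<Rightarrow> real \<Rightarrow> bool" where
  "thin_at V x \<longleftrightarrow> ((\<lambda>h. measure lborel (V \<inter> {x-h..x+h}) / h) \<longlongrightarrow> 0) (at_right 0)"

lemma emeasure_Int_Icc_finite: "emeasure lborel (V \<inter> {a..b::real}) \<noteq> \<infinity>"
proof (cases "V \<inter> {a..b} \<in> sets lborel")
  case True
  have "emeasure lborel (V \<inter> {a..b}) \<le> emeasure lborel {a..b}"
    by (intro emeasure_mono) auto
  also have "\<dots> < \<infinity>" by (cases "a \<le> b") auto
  finally show ?thesis by auto
qed (simp add: emeasure_notin_sets)

lemma measure_Int_Icc_add:
  assumes V: "V \<in> sets borel" and "a \<le> b" "b \<le> (c::real)"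
  shows "measure lborel (V \<inter> {a..c}) = measure lborel (V \<inter> {a..b}) + measure lborel (V \<inter> {b..c})"
proof -
  have "measure lborel (V \<inter> {a..c}) = measure lborel ((V \<inter> {a..b}) \<union> (V \<inter> {b<..c}))"
    using assms by (intro arg_cong[where f = "measure lborel"]) auto
  also have "\<dots> = measure lborel (V \<inter> {a..b}) + measure lborel (V \<inter> {b<..c})"
  proof (rule measure_Union)
    have "emeasure lborel (V \<inter> {b<..c}) \<le> emeasure lborel (V \<inter> {b..c})"
      using V by (intro emeasure_mono) auto
    then show "emeasure lborel (V \<inter> {b<..c}) \<noteq> \<infinity>"
      using emeasure_Int_Icc_finite[of V b c] by (metis infinity_ennreal_def neq_top_trans)
  qed (use V emeasure_Int_Icc_finite[of V a b] in auto)
  also have "measure lborel (V \<inter> {b<..c}) = measure lborel (V \<inter> {b..c})"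
  proof (rule measure_eq_AE)
    show "AE x in lborel. x \<in> V \<inter> {b<..c} \<longleftrightarrow> x \<in> V \<inter> {b..c}"
      using AE_lborel_singleton[of b] by eventually_elim auto
  qed (use V in auto)
  finally show ?thesis .
qed

lemma measure_Int_Icc_le:
  assumes "a \<le> (b::real)" shows "measure lborel (V \<inter> {a..b}) \<le> b - a"
proof (cases "V \<inter> {a..b} \<in> sets lborel")
  case True
  then have "measure lborel (V \<inter> {a..b}) \<le> measure lborel {a..b}"
    by (intro measure_mono_fmeasurable) (use assms in \<open>auto simp: fmeasurable_def less_top[symmetric]\<close>)
  then show ?thesis using assms by simp
qed (use assms in \<open>simp add: measure_notin_sets\<close>)

lemma has_integral_indicator_Icc:
  fixes a b :: real
  assumes Vb: "V \<in> sets borel"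
  shows "(indicator V has_integral measure lborel (V \<inter> {a..b})) {a..b}"
proof -
  have "((\<lambda>x. 1::real) has_integral measure lborel (V \<inter> {a..b})) (V \<inter> {a..b})"
    using Vb emeasure_Int_Icc_finite[of V a b]
    by (intro has_integral_measure_lborel) (auto simp: less_top)
  then show ?thesis
    using Vb has_integral_restrict_Int[of V "\<lambda>x. 1::real" _ "{a..b}"]
    by (simp add: indicator_def[abs_def] of_bool_def Int_commute measure_completion)
qed

text \<open>The density theorem for closed sets. The measure \<open>F x\<close> of \<open>V\<close>
  between \<open>a\<close> and \<open>x\<close> is Lipschitz, with derivative at least 1 on the open
  set \<open>V\<close> and at least 0 elsewhere. The integrals of the derivative and of the
  indicator of \<open>V\<close> agree, so the derivative is 0 almost everywhere off
  \<open>V\<close>.\<close>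

lemma open_complement_thin_AE:
  assumes V: "open V"
  shows "negligible {x. x \<notin> V \<and> \<not> thin_at V x}"
proof -
  have Vb: "V \<in> sets borel" using V by simp
  have part: "negligible {x\<in>{-real n<..<real n}. x \<notin> V \<and> \<not> thin_at V x}" for n
  proof -
    define a where "a = - real n"
    define b where "b = real n"
    have ab: "a \<le> b" by (simp add: a_def b_def)
    define F where "F x = measure lborel (V \<inter> {a..x})" for x
    have Fd: "F y - F x = measure lborel (V \<inter> {x..y})" if "a \<le> x" "x \<le> y" for x y
      using measure_Int_Icc_add[OF Vb that] by (simp add: F_def)
    have FL: "1-lipschitz_on {a..b} F"
    proof (rule lipschitz_onI)
      fix x y assume xy: "x \<in> {a..b}" "y \<in> {a..b}"
      have *: "\<bar>F y - F x\<bar> \<le> \<bar>y - x\<bar>" if "x \<le> y" "a \<le> x" for x y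
        using Fd[OF that(2,1)] measure_Int_Icc_le[OF that(1), of V] by simp
      show "dist (F x) (F y) \<le> 1 * dist x y"
        using *[of x y] *[of y x] xy by (cases "x \<le> y") (auto simp: dist_real_def abs_minus_commute)
    qed simp
    define g where "g x = F (max a (min b x))" for x
    have gL: "1-lipschitz_on UNIV g" unfolding g_def by (rule lipschitz_clamp[OF FL ab])
    define N where "N = {x. \<not> g differentiable (at x)} \<union> {a, b}"
    have N: "negligible N"
      using lipschitz_not_differentiable_null_real[OF gL] unfolding N_def
      by (auto simp: negligible_iff_null_sets null_sets_completionI)
    define D where "D x = vector_derivative F (at x)" for x
    have FD: "(F has_vector_derivative D x) (at x)" if "x \<in> {a..b} - N" for x
    proof -
      have "(g has_vector_derivative vector_derivative g (at x)) (at x)"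
        using that by (simp add: N_def vector_derivative_works)
      then have "(F has_vector_derivative vector_derivative g (at x)) (at x)"
        using that by (rule_tac has_vector_derivative_transform_within_open[of g _ _ "{a<..<b}"]) (auto simp: g_def N_def)
      then show ?thesis unfolding D_def by (simp add: vector_derivative_at)
    qed
    have int: "(D has_integral F b - F a) {a..b}"
      by (rule lipschitz_has_integral_derivative[OF FL ab N FD])
    have "(indicator V has_integral measure lborel (V \<inter> {a..b})) {a..b}"
      by (rule has_integral_indicator_Icc[OF Vb])
    moreover have "F a = 0" unfolding F_def
      using measure_Int_Icc_le[of a a V] by (simp add: measure_nonneg order_antisym)
    ultimately have int0: "((\<lambda>x. D x - indicator V x) has_integral 0) {a..b}"
      using has_integral_diff[OF int] by (fastforce simp: F_def)
    have lim: "((\<lambda>y. (F y - F x) / (y - x)) \<longlongrightarrow> D x) (at x)" if "x \<in> {a..b} - N" for x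
      using FD[OF that] by (simp add: has_vector_derivative_iff_quotient divide_inverse mult.commute)
    have ge: "D x - indicator V x \<ge> 0" if x: "x \<in> {a..b} - N" for x
    proof (cases "x \<in> V")
      case False
      have "0 \<le> D x"
      proof (rule tendsto_lowerbound[OF lim[OF x]])
        have "eventually (\<lambda>y. y \<in> {a<..<b}) (at x)"
          using x by (intro eventually_at_in_open') (auto simp: N_def)
        then show "\<forall>\<^sub>F y in at x. 0 \<le> (F y - F x) / (y - x)"
        proof eventually_elim
          case (elim y)
          have "0 \<le> F y - F x" if "x \<le> y" using Fd[of x y] that x by auto
          moreover have "F y - F x \<le> 0" if "y \<le> x"
          proof -
            have "F x - F y = measure lborel (V \<inter> {y..x})" using Fd[of y x] that elim by auto
            then show ?thesis using measure_nonneg[of lborel "V \<inter> {y..x}"] by linarith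
          qed
          ultimately show ?case by (cases "x \<le> y") (auto simp: zero_le_divide_iff)
        qed
      qed simp
      with False show ?thesis by simp
    next
      case True
      have "1 \<le> D x"
      proof (rule tendsto_lowerbound[OF lim[OF x]])
        obtain e where e: "e > 0" "ball x e \<subseteq> V" using True V by (meson open_contains_ball)
        have "eventually (\<lambda>y. y \<in> {a<..<b} \<inter> ball x e) (at x)"
          using x e by (intro eventually_at_in_open') (auto simp: N_def)
        moreover have "eventually (\<lambda>y. y \<noteq> x) (at x)" by (simp add: eventually_at_filter)
        ultimately show "\<forall>\<^sub>F y in at x. 1 \<le> (F y - F x) / (y - x)"
        proof eventually_elim
          case (elim y)
          have *: "V \<inter> {x..y} = {x..y}" "V \<inter> {y..x} = {y..x}" using elim e by (auto simp: dist_real_def subset_eq)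
          show ?case
          proof (cases "x \<le> y")
            case True
            then show ?thesis using Fd[of x y] * x elim by auto
          next
            case False
            then show ?thesis using Fd[of y x] * x elim by (auto simp: field_simps)
          qed
        qed
      qed simp
      with True show ?thesis by simp
    qed
    have neg: "negligible ({x\<in>{a..b}. D x - indicator V x \<noteq> 0} \<union> N)"
      using nonneg_has_integral_0_imp_negligible[OF int0 N ge] N by (rule negligible_Un)
    show ?thesis
    proof (rule negligible_subset[OF neg], rule subsetI)
      fix x assume x: "x \<in> {x\<in>{-real n<..<real n}. x \<notin> V \<and> \<not> thin_at V x}"
      show "x \<in> {x\<in>{a..b}. D x - indicator V x \<noteq> 0} \<union> N"
      proof (rule ccontr)
        assume c: "x \<notin> {x\<in>{a..b}. D x - indicator V x \<noteq> 0} \<union> N"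
        have x': "x \<in> {a..b} - N" "D x = 0" "a < x" "x < b" using x c by (auto simp: a_def b_def)
        have l0: "((\<lambda>y. (F y - F x) / (y - x)) \<longlongrightarrow> 0) (at x)" using lim[OF x'(1)] x'(2) by simp
        have "((\<lambda>h. (F (x + h) - F x) / h) \<longlongrightarrow> 0) (at 0)"
          using l0 by (subst (asm) LIM_offset_zero_iff) (auto simp: add.commute)
        then have r: "((\<lambda>h. (F (x + h) - F x) / h) \<longlongrightarrow> 0) (at_right 0)" and "((\<lambda>h. (F (x + h) - F x) / h) \<longlongrightarrow> 0) (at_left 0)"
          by (auto intro: tendsto_mono[OF at_le])
        then have l: "((\<lambda>h. (F (x - h) - F x) / - h) \<longlongrightarrow> 0) (at_right 0)"
          by (simp add: filterlim_at_left_to_right)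
        \<comment> \<open>The two one-sided quotients add up to the measure of the part of
          \<open>V\<close> in the symmetric interval, divided by \<open>h\<close>.\<close>
        have "((\<lambda>h. (F (x + h) - F x) / h + (F (x - h) - F x) / - h) \<longlongrightarrow> 0) (at_right 0)"
          using tendsto_add[OF r l] by simp
        moreover have "\<forall>\<^sub>F h in at_right 0. (F (x + h) - F x) / h + (F (x - h) - F x) / - h = measure lborel (V \<inter> {x-h..x+h}) / h"
        proof -
          have "eventually (\<lambda>h. h \<in> {0<..<x-a}) (at_right 0)"
            using x' by (intro eventually_at_right_real) auto
          then show ?thesis
          proof eventually_elim
            case (elim h)
            then have "F (x + h) - F (x - h) = measure lborel (V \<inter> {x-h..x+h})" by (intro Fd) auto
            then show ?case using elim by (simp add: field_simps)
          qed
        qed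
        ultimately have "thin_at V x" unfolding thin_at_def by (rule Lim_transform_eventually)
        with x show False by simp
      qed
    qed
  qed
  have "{x. x \<notin> V \<and> \<not> thin_at V x} = (\<Union>n::nat. {x\<in>{-real n<..<real n}. x \<notin> V \<and> \<not> thin_at V x})"
  proof -
    have "\<exists>n::nat. - real n < x \<and> x < real n" for x
      using reals_Archimedean2[of "\<bar>x\<bar>"] by (metis abs_less_iff minus_less_iff)
    then show ?thesis by auto
  qed
  then show ?thesis by (simp only: negligible_Union_nat part)
qed

section \<open>Flattening a null set by a change of parameter\<close>

lemma thin_atI:
  assumes "\<And>e. e > 0 \<Longrightarrow> \<exists>d>0. \<forall>h. 0 < h \<and> h < d \<longrightarrow> measure lborel (V \<inter> {x-h..x+h}) \<le> e * h"
  shows "thin_at V x"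
  unfolding thin_at_def
proof (rule tendstoI)
  fix e :: real assume "e > 0"
  then obtain d where d: "d > 0" "\<And>h. 0 < h \<Longrightarrow> h < d \<Longrightarrow> measure lborel (V \<inter> {x-h..x+h}) \<le> e / 2 * h"
    using assms[of "e / 2"] by auto
  have "eventually (\<lambda>h. h \<in> {0<..<d}) (at_right 0)"
    using d by (intro eventually_at_right_real) auto
  then show "\<forall>\<^sub>F h in at_right 0. dist (measure lborel (V \<inter> {x-h..x+h}) / h) 0 < e"
  proof eventually_elim
    case (elim h)
    then have "measure lborel (V \<inter> {x-h..x+h}) / h \<le> e / 2" using d(2)[of h] by (simp add: field_simps)
    moreover have "0 \<le> measure lborel (V \<inter> {x-h..x+h}) / h" using elim by simp
    ultimately show ?case using \<open>e > 0\<close> unfolding dist_real_def by linarith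
  qed
qed

lemma thin_atD:
  assumes "thin_at V x" "e > 0"
  shows "\<exists>d>0. \<forall>h. 0 < h \<and> h < d \<longrightarrow> measure lborel (V \<inter> {x-h..x+h}) \<le> e * h"
proof -
  have "\<forall>\<^sub>F h in at_right 0. dist (measure lborel (V \<inter> {x-h..x+h}) / h) 0 < e"
    using assms unfolding thin_at_def by (intro tendstoD)
  then obtain d where d: "d > 0" "\<And>h. 0 < h \<Longrightarrow> h < d \<Longrightarrow> dist (measure lborel (V \<inter> {x-h..x+h}) / h) 0 < e"
    unfolding eventually_at_right_field by auto
  have "measure lborel (V \<inter> {x-h..x+h}) \<le> e * h" if "0 < h" "h < d" for h
    using d(2)[OF that] that by (simp add: dist_real_def field_simps abs_less_iff)
  with d(1) show ?thesis by blast
qed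

text \<open>In the applications \<open>B n\<close> matters only at distances above
  \<open>1 / (n + 1)\<close> from a closed set, so within \<open>h\<close> of a point of that set
  only indices with \<open>1 / (n + 1) < h\<close> occur. The weights \<open>1 / (n + 1)^2\<close>
  then become \<open>h^2\<close>, and the powers of 1/2 sum to 1.\<close>

lemma emeasure_annuli_le:
  fixes B :: "nat \<Rightarrow> real set"
  assumes h: "h > 0" and \<delta>: "\<delta> \<ge> 0" and B: "\<And>n. B n \<in> sets lebesgue"
    and Bm: "\<And>n. emeasure lebesgue (B n) \<le> ennreal (\<delta> * (1/2)^(Suc n) / (real n + 1)\<^sup>2)"
  shows "emeasure lebesgue (\<Union>n\<in>{n. 1 / (real n + 1) < h}. B n) \<le> ennreal (\<delta> * h\<^sup>2)"
proof -
  define B' where "B' n = (if 1 / (real n + 1) < h then B n else {})" for n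
  have B's: "range B' \<subseteq> sets lebesgue" using B by (auto simp: B'_def)
  have "(\<Union>n\<in>{n. 1 / (real n + 1) < h}. B n) = (\<Union>n. B' n)" by (auto simp: B'_def split: if_splits)
  then have "emeasure lebesgue (\<Union>n\<in>{n. 1 / (real n + 1) < h}. B n) \<le> (\<Sum>n. emeasure lebesgue (B' n))"
    using emeasure_subadditive_countably[OF B's] by simp
  also have "\<dots> \<le> (\<Sum>n. ennreal (\<delta> * h\<^sup>2 * (1/2)^(Suc n)))"
  proof (rule suminf_le)
    fix n
    show "emeasure lebesgue (B' n) \<le> ennreal (\<delta> * h\<^sup>2 * (1/2)^(Suc n))"
    proof (cases "1 / (real n + 1) < h")
      case True
      have "(1 / (real n + 1))\<^sup>2 \<le> h\<^sup>2" using True by (intro power_mono) auto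
      then have "\<delta> * (1/2)^(Suc n) * (1 / (real n + 1))\<^sup>2 \<le> \<delta> * (1/2)^(Suc n) * h\<^sup>2"
        using \<delta> by (intro mult_left_mono) auto
      then have "\<delta> * (1/2)^(Suc n) / (real n + 1)\<^sup>2 \<le> \<delta> * h\<^sup>2 * (1/2)^(Suc n)"
        by (simp add: power_divide mult_ac)
      with Bm[of n] have "emeasure lebesgue (B n) \<le> ennreal (\<delta> * h\<^sup>2 * (1/2)^(Suc n))"
        by (meson order_trans ennreal_leI)
      then show ?thesis using True by (simp add: B'_def)
    qed (simp add: B'_def)
  qed auto
  also have "\<dots> = ennreal (\<delta> * h\<^sup>2 * 1)"
    using \<delta> by (intro suminf_ennreal_eq sums_mult power_half_series) auto
  finally show ?thesis by simp
qed

text \<open>Positive distances are sorted into shells, above \<open>1 / (n + 1)\<close> and at most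
  \<open>1 / n\<close>. Shell 0 is unbounded and needs its own case, because
  \<open>1 / real 0\<close> is 0.\<close>

lemma annulus_index:
  assumes "0 < d"
  obtains n :: nat where "1 / (real n + 1) < d" "n = 0 \<or> d \<le> 1 / real n"
proof -
  define n where "n = (LEAST n. 1 / (real n + 1) < d)"
  have "\<exists>n. 1 / (real n + 1) < d"
    using nat_approx_posE[OF assms] by (metis of_nat_Suc add.commute)
  then have 1: "1 / (real n + 1) < d" unfolding n_def by (rule LeastI_ex)
  have "d \<le> 1 / real n" if "n \<noteq> 0"
  proof -
    have "n - 1 < n" using that by simp
    then have "\<not> 1 / (real (n - 1) + 1) < d" unfolding n_def by (rule not_less_Least)
    then show ?thesis using that by (simp add: of_nat_diff)
  qed
  then have 2: "n = 0 \<or> d \<le> 1 / real n" by blast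
  show thesis by (rule that[OF 1 2])
qed

lemma infdist_le_if_mem:
  fixes x y :: real
  assumes "x \<in> F" "y \<in> {x-h..x+h}" shows "infdist y F \<le> h"
  using infdist_le[OF assms(1), of y] assms(2) by (auto simp: dist_real_def abs_le_iff)

text \<open>The closer to the complement of \<open>U\<close>, the smaller the neighbourhood
  \<open>T n\<close> of \<open>N\<close> from which points may be taken. A point of \<open>V\<close>
  within \<open>h\<close> of some \<open>x\<close> outside \<open>U\<close> lies in a
  \<open>T n\<close> with \<open>1 / (n + 1) < h\<close>, and these are quadratically small
  together.\<close>

lemma open_nbhd_of_null_thin:
  fixes N U :: "real set"
  assumes N: "negligible N" "N \<subseteq> U" and U: "open U" and \<delta>: "\<delta> > 0"
  obtains V where "open V" "N \<subseteq> V" "V \<subseteq> U" "emeasure lborel V \<le> ennreal \<delta>"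
    "\<And>x h. x \<notin> U \<Longrightarrow> h > 0 \<Longrightarrow> measure lborel (V \<inter> {x-h..x+h}) \<le> \<delta> * h\<^sup>2"
proof -
  have nbhd: "\<exists>T. open T \<and> N \<subseteq> T \<and> emeasure lebesgue T \<le> ennreal e" if "e > 0" for e
  proof -
    have Ns: "N \<in> sets lebesgue" using N(1) by (rule negligible_imp_sets)
    obtain T where T: "open T" "N \<subseteq> T" "emeasure lebesgue (T - N) < ennreal e"
      using sets_lebesgue_outer_open[OF Ns \<open>e > 0\<close>] by blast
    have "emeasure lebesgue T = emeasure lebesgue (T - N)"
      using N(1) T(1) by (intro emeasure_Diff_null_set[symmetric]) (auto simp: negligible_iff_null_sets)
    then have "emeasure lebesgue T \<le> ennreal e" using T(3) by (simp only: less_imp_le)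
    with T(1,2) show ?thesis by blast
  qed
  define \<epsilon> where "\<epsilon> n = \<delta> * (1/2)^(Suc n) / (real n + 1)\<^sup>2" for n
  have "\<epsilon> n > 0" for n using \<delta> by (simp add: \<epsilon>_def)
  then obtain T where T: "\<And>n. open (T n)" "\<And>n. N \<subseteq> T n" "\<And>n. emeasure lebesgue (T n) \<le> ennreal (\<epsilon> n)"
    using nbhd[of "\<epsilon> n" for n] by metis
  obtain T0 where T0: "open T0" "N \<subseteq> T0" "emeasure lebesgue T0 \<le> ennreal \<delta>"
    using nbhd[OF \<delta>] by metis
  define F where "F = - U"
  have F: "closed F" using U unfolding F_def by (rule closed_Compl)
  \<comment> \<open>\<open>infdist\<close> to the empty set is 0, which would make the union empty;
    hence the separate case.\<close>
  define V where "V = (if F = {} then T0 else T0 \<inter> (\<Union>n. T n \<inter> {y. 1 / (real n + 1) < infdist y F}))"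
  have op: "open {y. 1 / (real n + 1) < infdist y F}" for n
    by (intro open_Collect_less continuous_intros)
  show thesis
  proof
    show Vo: "open V" unfolding V_def using T T0 op by (auto intro!: open_Int open_UN)
    show "N \<subseteq> V"
    proof
      fix y assume y: "y \<in> N"
      have "\<exists>n. 1 / (real n + 1) < infdist y F" if "F \<noteq> {}"
      proof -
        have "y \<notin> F" using y N(2) by (auto simp: F_def)
        then have "0 < infdist y F" using F that by (meson infdist_pos_not_in_closed)
        then show ?thesis using annulus_index by metis
      qed
      then show "y \<in> V" using y T(2) T0(2) by (auto simp: V_def)
    qed
    show "V \<subseteq> U"
    proof
      fix y assume y: "y \<in> V"
      show "y \<in> U"
      proof (cases "F = {}")
        case False
        then obtain n where "1 / (real n + 1) < infdist y F" using y by (auto simp: V_def)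
        then have "infdist y F \<noteq> 0" using order.strict_trans[of 0 "1 / (real n + 1)"] by fastforce
        then have "y \<notin> F" using infdist_zero[of y F] by blast
        then show ?thesis by (simp add: F_def)
      qed (auto simp: F_def)
    qed
    have "V \<subseteq> T0" by (auto simp: V_def)
    then have "emeasure lebesgue V \<le> ennreal \<delta>"
      using T0 by (intro order_trans[OF emeasure_mono T0(3)]) auto
    then show "emeasure lborel V \<le> ennreal \<delta>" using Vo by simp
    fix x h :: real assume x: "x \<notin> U" and h: "h > 0"
    have xF: "x \<in> F" using x by (simp add: F_def)
    have "V \<inter> {x-h..x+h} \<subseteq> (\<Union>n\<in>{n. 1 / (real n + 1) < h}. T n)"
    proof
      fix y assume y: "y \<in> V \<inter> {x-h..x+h}"
      then obtain n where "y \<in> T n" "1 / (real n + 1) < infdist y F" using xF by (auto simp: V_def split: if_splits)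
      moreover have "infdist y F \<le> h" using infdist_le_if_mem[OF xF] y by auto
      ultimately show "y \<in> (\<Union>n\<in>{n. 1 / (real n + 1) < h}. T n)" by force
    qed
    then have "emeasure lebesgue (V \<inter> {x-h..x+h}) \<le> emeasure lebesgue (\<Union>n\<in>{n. 1 / (real n + 1) < h}. T n)"
      using T(1) by (intro emeasure_mono) auto
    also have "\<dots> \<le> ennreal (\<delta> * h\<^sup>2)"
      using h \<delta> T by (intro emeasure_annuli_le) (auto simp: \<epsilon>_def)
    finally have "emeasure lborel (V \<inter> {x-h..x+h}) \<le> ennreal (\<delta> * h\<^sup>2)" using Vo by simp
    then show "measure lborel (V \<inter> {x-h..x+h}) \<le> \<delta> * h\<^sup>2"
      using \<delta> by (simp add: measure_def enn2real_leI)
  qed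
qed

text \<open>Strict inclusion for the density topology; interpolating it (Lusin and Menchoff) allows the
  construction of Urysohn functions that are approximately continuous at every point.\<close>

definition thin_in :: "real set \<Rightarrow> real set \<Rightarrow> bool" where
  "thin_in U V \<longleftrightarrow> open U \<and> open V \<and> V \<subseteq> U \<and> (\<forall>x. x \<notin> U \<longrightarrow> thin_at V x)"

lemma thin_in_trans: "thin_in A B \<Longrightarrow> thin_in B C \<Longrightarrow> thin_in A C"
  unfolding thin_in_def by blast

text \<open>\<open>W\<close> is \<open>U\<close> with closed sets \<open>P n\<close> removed. They
  fill almost all of the points outside \<open>V\<close> where \<open>V\<close> is thin, shell by
  shell towards the boundary of \<open>U\<close>. At removed points \<open>V\<close> is thin by
  choice; near a point outside \<open>U\<close> all that is left in \<open>W\<close> is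
  \<open>V\<close>, a null set and remainders of quadratically small measure.\<close>

lemma thin_in_interpolate:
  assumes UV: "thin_in U V"
  shows "\<exists>W. thin_in U W \<and> thin_in W V"
proof (cases "U = UNIV")
  case True
  then show ?thesis using UV by (intro exI[of _ UNIV]) (auto simp: thin_in_def)
next
  case False
  define F where "F = - U"
  have U: "open U" and V: "open V" and VU: "V \<subseteq> U" and thin: "\<And>x. x \<notin> U \<Longrightarrow> thin_at V x"
    using UV by (auto simp: thin_in_def)
  have F: "closed F" "F \<noteq> {}" using U False unfolding F_def by (auto intro: closed_Compl)
  have infpos: "0 < infdist y F" if "y \<in> U" for y
    using that F by (auto simp: F_def intro: infdist_pos_not_in_closed)
  define Z where "Z = {x. x \<notin> V \<and> \<not> thin_at V x}"
  have Z: "negligible Z" unfolding Z_def by (rule open_complement_thin_AE[OF V])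
  define E where "E = - V - Z"
  have E: "E \<in> sets lebesgue"
    unfolding E_def using V negligible_imp_sets[OF Z] by (intro sets.Diff) auto
  define A where "A n = {y. 1 / (real n + 1) < infdist y F \<and> (n = 0 \<or> infdist y F \<le> 1 / real n)}" for n
  have A: "A n \<in> sets lebesgue" for n
  proof -
    have "A n = {y. 1 / (real n + 1) < infdist y F} \<inter> (if n = 0 then UNIV else {y. infdist y F \<le> 1 / real n})"
      by (auto simp: A_def)
    moreover have "open {y. 1 / (real n + 1) < infdist y F}" "closed {y. infdist y F \<le> 1 / real n}"
      by (intro open_Collect_less closed_Collect_le continuous_intros)+
    ultimately show ?thesis by (auto intro!: sets.Int)
  qed
  define \<epsilon> where "\<epsilon> n = 1 * (1/2)^(Suc n) / (real n + 1)\<^sup>2" for n :: nat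
  have "\<exists>P. closed P \<and> P \<subseteq> E \<inter> A n \<and> emeasure lebesgue (E \<inter> A n - P) \<le> ennreal (\<epsilon> n)" for n
  proof -
    have "E \<inter> A n \<in> sets lebesgue" "\<epsilon> n > 0" using E A by (auto simp: \<epsilon>_def)
    from sets_lebesgue_inner_closed[OF this] show ?thesis by (metis less_imp_le)
  qed
  then obtain P where P: "\<And>n. closed (P n)" "\<And>n. P n \<subseteq> E \<inter> A n" "\<And>n. emeasure lebesgue (E \<inter> A n - P n) \<le> ennreal (\<epsilon> n)"
    by metis
  define X where "X m = {y. 1 / (real m + 1) < infdist y F}" for m :: nat
  have X: "open (X m)" for m unfolding X_def by (intro open_Collect_less continuous_intros)
  \<comment> \<open>Only finitely many closed sets are removed from each \<open>X m\<close>, which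
    makes openness immediate even if the \<open>P n\<close> accumulate at the boundary of
    \<open>U\<close>; the others do not meet \<open>X m\<close>.\<close>
  define W where "W = (\<Union>m. X m - (\<Union>n\<le>m. P n))"
  have Wo: "open W" unfolding W_def using X P(1) by (auto intro!: open_UN open_Diff closed_UN)
  have XP: "P n \<inter> X m = {}" if "m < n" for m n
  proof -
    have "1 / real n \<le> 1 / (real m + 1)" using that by (intro divide_left_mono) auto
    then show ?thesis using P(2)[of n] that by (fastforce simp: X_def A_def)
  qed
  have WP: "y \<notin> P n" if yW: "y \<in> W" for y n
  proof -
    obtain m where m: "y \<in> X m" "\<And>n. n \<le> m \<Longrightarrow> y \<notin> P n" using yW unfolding W_def by blast
    then show ?thesis using XP[of m n] by (cases "n \<le> m") auto
  qed
  have WU: "W \<subseteq> U"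
  proof
    fix y assume "y \<in> W"
    then obtain n :: nat where "1 / (real n + 1) < infdist y F" unfolding W_def X_def by blast
    then have "infdist y F \<noteq> 0" using order.strict_trans[of 0 "1 / (real n + 1)"] by fastforce
    then have "y \<notin> F" using infdist_zero[of y F] by blast
    then show "y \<in> U" by (simp add: F_def)
  qed
  have XU: "\<exists>m. y \<in> X m" if "y \<in> U" for y
    using infpos[OF that] annulus_index[of "infdist y F"] unfolding X_def by blast
  have "V \<subseteq> W"
  proof
    fix y assume y: "y \<in> V"
    then obtain m where "y \<in> X m" using XU VU by blast
    moreover have "y \<notin> P n" for n using P(2)[of n] y by (auto simp: E_def)
    ultimately show "y \<in> W" by (auto simp: W_def)
  qed
  moreover have "thin_at V x" if xW: "x \<notin> W" for x
  proof (cases "x \<in> U")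
    case True
    then obtain m where "x \<in> X m" using XU by blast
    then obtain n where "x \<in> P n" using xW unfolding W_def by blast
    then have "x \<in> E" using P(2) by blast
    then show ?thesis by (auto simp: E_def Z_def)
  qed (rule thin)
  ultimately have "thin_in W V" using Wo V by (auto simp: thin_in_def)
  moreover have "thin_at W x" if x: "x \<notin> U" for x
  proof (rule thin_atI)
    fix e :: real assume e: "e > 0"
    have xF: "x \<in> F" using x by (simp add: F_def)
    obtain d where d: "d > 0" "\<And>h. 0 < h \<Longrightarrow> h < d \<Longrightarrow> measure lborel (V \<inter> {x-h..x+h}) \<le> e / 2 * h"
      using thin_atD[OF thin[OF x], of "e / 2"] e by auto
    have "measure lborel (W \<inter> {x-h..x+h}) \<le> e * h" if h: "0 < h" "h < min d (e / 2)" for h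
    proof -
      let ?I = "{x-h..x+h}"
      let ?B = "\<Union>n\<in>{n. 1 / (real n + 1) < h}. E \<inter> A n - P n"
      have Bs: "?B \<in> sets lebesgue" using E A P(1) by (intro sets.countable_UN' sets.Diff sets.Int) auto
      have "W \<inter> ?I \<subseteq> ((V \<inter> ?I) \<union> ?B) \<union> Z"
      proof
        fix y assume y: "y \<in> W \<inter> ?I"
        then obtain n where n: "1 / (real n + 1) < infdist y F" "n = 0 \<or> infdist y F \<le> 1 / real n"
          using annulus_index[OF infpos[of y]] WU by blast
        then have "y \<in> A n" by (auto simp: A_def)
        moreover have "1 / (real n + 1) < h" using n infdist_le_if_mem[OF xF, of y h] y by auto
        moreover have "y \<notin> P n" using WP y by blast
        ultimately show "y \<in> ((V \<inter> ?I) \<union> ?B) \<union> Z" using y by (auto simp: E_def)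
      qed
      then have "emeasure lebesgue (W \<inter> ?I) \<le> emeasure lebesgue (((V \<inter> ?I) \<union> ?B) \<union> Z)"
        using V Bs negligible_imp_sets[OF Z] by (intro emeasure_mono sets.Un) auto
      also have "\<dots> = emeasure lebesgue ((V \<inter> ?I) \<union> ?B)"
        using V Bs Z by (intro emeasure_Un_null_set) (auto simp: negligible_iff_null_sets)
      also have "\<dots> \<le> emeasure lebesgue (V \<inter> ?I) + emeasure lebesgue ?B"
        using V Bs by (intro emeasure_subadditive) auto
      also have "\<dots> \<le> ennreal (e / 2 * h) + ennreal (1 * h\<^sup>2)"
      proof (rule add_mono)
        have "emeasure lebesgue (V \<inter> ?I) = ennreal (measure lborel (V \<inter> ?I))"
          using V emeasure_Int_Icc_finite[of V "x-h" "x+h"] by (simp add: emeasure_eq_ennreal_measure)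
        then show "emeasure lebesgue (V \<inter> ?I) \<le> ennreal (e / 2 * h)"
          using d(2)[of h] h by (simp add: ennreal_leI)
        show "emeasure lebesgue ?B \<le> ennreal (1 * h\<^sup>2)"
          using h E A P by (intro emeasure_annuli_le) (auto simp: \<epsilon>_def)
      qed
      also have "\<dots> = ennreal (e / 2 * h + h\<^sup>2)" using e h by simp
      finally have "emeasure lborel (W \<inter> ?I) \<le> ennreal (e / 2 * h + h\<^sup>2)" using Wo by simp
      then have "measure lborel (W \<inter> ?I) \<le> e / 2 * h + h\<^sup>2"
        using e h by (simp add: measure_def enn2real_leI)
      also have "h\<^sup>2 \<le> e / 2 * h" using h by (simp add: power2_eq_square mult_right_mono)
      finally show ?thesis by simp
    qed
    then show "\<exists>d>0. \<forall>h. 0 < h \<and> h < d \<longrightarrow> measure lborel (W \<inter> {x-h..x+h}) \<le> e * h"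
      using d(1) e by (intro exI[of _ "min d (e / 2)"]) auto
  qed
  ultimately show ?thesis using WU Wo U by (auto simp: thin_in_def)
qed

text \<open>As in Urysohn's lemma, sets \<open>S r\<close> are interpolated at dyadic levels and
  \<open>g x\<close> is the supremum of the levels that contain \<open>x\<close>. Openness of
  \<open>S r\<close> makes \<open>g\<close> lower semicontinuous; thinness makes it upper
  semicontinuous up to a set of density 0. As \<open>g\<close> is bounded, its averages over
  intervals shrinking to \<open>x\<close> converge to \<open>g x\<close> at every
  \<open>x\<close>.\<close>

lemma thin_in_Urysohn:
  assumes "thin_in U V"
  obtains g :: "real \<Rightarrow> real" where "g \<in> borel_measurable borel" "\<And>x. 0 \<le> g x" "\<And>x. g x \<le> 1"
    "\<And>x. x \<in> V \<Longrightarrow> g x = 1" "\<And>x. x \<notin> U \<Longrightarrow> g x = 0"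
    "\<And>x e. e > 0 \<Longrightarrow> \<exists>d>0. \<forall>s t. s \<le> t \<and> t - s < d \<and> x \<in> {s..t} \<longrightarrow>
        (g x - e) * (t - s) \<le> integral {s..t} g \<and> integral {s..t} g \<le> (g x + e) * (t - s)"
proof -
  let ?D = "dyadics \<inter> {0..1} :: real set"
  obtain S :: "real \<Rightarrow> real set" where S0: "S 0 = U" and S1: "S 1 = V"
    and S: "\<And>r s. r \<in> ?D \<Longrightarrow> s \<in> ?D \<Longrightarrow> r < s \<Longrightarrow> thin_in (S r) (S s)"
  proof -
    have "\<exists>S :: real \<Rightarrow> real set. S 0 = U \<and> S 1 = V \<and> (\<forall>r\<in>?D. \<forall>s\<in>?D. r < s \<longrightarrow> thin_in (S r) (S s))"
      by (rule recursion_on_dyadic_fractions) (use assms thin_in_interpolate thin_in_trans in blast)+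
    then show ?thesis using that by blast
  qed
  have D0: "0 \<in> ?D" and D1: "1 \<in> ?D" by (force simp: dyadics_def)+
  have dense: "\<exists>r\<in>?D. a < r \<and> r < b" if ab: "0 \<le> a" "a < b" "b \<le> 1" for a b :: real
  proof -
    obtain n where n: "(1/2::real) ^ n < b - a"
      using real_arch_pow_inv[of "b - a" "1/2"] ab by auto
    define k where "k = nat \<lfloor>a * 2 ^ n\<rfloor> + 1"
    have k: "real k = of_int \<lfloor>a * 2 ^ n\<rfloor> + 1" using ab by (simp add: k_def)
    have "a * 2 ^ n < real k" "real k \<le> a * 2 ^ n + 1" unfolding k by linarith+
    then have "a < real k / 2 ^ n" "real k / 2 ^ n \<le> a + (1/2) ^ n" by (simp_all add: field_simps)
    moreover have "real k / 2 ^ n \<in> dyadics" by (auto simp: dyadics_def)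
    moreover have "real k / 2 ^ n < b" using calculation(2) n by simp
    moreover have "0 \<le> real k / 2 ^ n" by simp
    moreover have "real k / 2 ^ n \<le> 1" using calculation(4) ab by linarith
    ultimately show ?thesis by (metis IntI atLeastAtMost_iff)
  qed
  have So: "open (S r)" if "r \<in> ?D" for r
    using that S[OF D0 that] S[OF that D1] S[OF D0 D1] S0 S1 by (cases "r = 0") (auto simp: thin_in_def)
  have Smono: "S s \<subseteq> S r" if "r \<in> ?D" "s \<in> ?D" "r \<le> s" for r s
    using S[OF that(1,2)] that(3) by (cases "r = s") (auto simp: thin_in_def)
  \<comment> \<open>The inserted 0 keeps the supremum meaningful where \<open>x\<close> lies in no
    \<open>S r\<close>.\<close>
  define g where "g x = Sup (insert 0 {r\<in>?D. x \<in> S r})" for x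
  have bdd: "bdd_above (insert 0 {r\<in>?D. x \<in> S r})" for x by (auto simp: bdd_above_def intro!: exI[of _ 1])
  have g_ge: "r \<le> g x" if "r \<in> ?D" "x \<in> S r" for r x
    unfolding g_def using that by (intro cSup_upper bdd) auto
  have g0: "0 \<le> g x" for x unfolding g_def by (intro cSup_upper bdd) auto
  have g_le: "g x \<le> c" if "0 \<le> c" "\<And>r. r \<in> ?D \<Longrightarrow> x \<in> S r \<Longrightarrow> r \<le> c" for x c
    unfolding g_def by (intro cSup_least) (use that in auto)
  have g1: "g x \<le> 1" for x by (rule g_le) auto
  have g_le_notin: "g x \<le> r" if "r \<in> ?D" "x \<notin> S r" for x r
  proof (rule g_le)
    show "0 \<le> r" using that by auto
    fix s assume "s \<in> ?D" "x \<in> S s"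
    then show "s \<le> r" using Smono[of r s] that by (cases "s \<le> r") auto
  qed
  have less_g: "\<exists>r\<in>?D. c < r \<and> x \<in> S r" if "c < g x" "0 \<le> c" for c x
    using g_le[of c x] that by (meson not_le)
  have gb: "g \<in> borel_measurable borel"
  proof (subst borel_measurable_iff_greater, intro allI)
    fix c :: real
    have "open {x. c < g x}"
    proof (cases "0 \<le> c")
      case True
      have "{x. c < g x} = (\<Union>r\<in>{r\<in>?D. c < r}. S r)"
        using less_g[OF _ True] g_ge by (fastforce intro: less_le_trans)
      then show ?thesis using So by (auto intro!: open_UN)
    next
      case False
      then have "c < g x" for x using g0[of x] by linarith
      then have "{x. c < g x} = UNIV" by simp
      then show ?thesis by simp
    qed
    then show "{w \<in> space borel. c < g w} \<in> sets borel" by simp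
  qed
  have gint: "g integrable_on {s..t}" for s t
  proof (rule measurable_bounded_by_integrable_imp_integrable_real[where g = "\<lambda>x. 1"])
    show "g \<in> borel_measurable (lebesgue_on {s..t})"
      using gb by (intro measurable_restrict_space1) (auto intro: measurable_completion)
  qed (use g0 g1 in auto)
  show thesis
  proof (rule that[of g])
    show "g x = 1" if "x \<in> V" for x using g_ge[OF D1, of x] g1[of x] that S1 by auto
    show "g x = 0" if "x \<notin> U" for x using g_le_notin[OF D0, of x] g0[of x] that S0 by auto
    fix x e :: real assume e: "e > 0"
    have "\<exists>d1>0. \<forall>s t. s \<le> t \<and> t - s < d1 \<and> x \<in> {s..t} \<longrightarrow> (g x - e) * (t - s) \<le> integral {s..t} g"
    proof -
      obtain d1 where d1: "d1 > 0" "\<And>y. \<bar>y - x\<bar> < d1 \<Longrightarrow> g x - e \<le> g y"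
      proof (cases "g x - e < 0")
        case True
        then show ?thesis using that[of 1] g0 by (meson less_le_trans less_imp_le zero_less_one)
      next
        case False
        then obtain r where r: "r \<in> ?D" "g x - e < r" "x \<in> S r" using less_g[of "g x - e" x] e by auto
        obtain d1 where "d1 > 0" "ball x d1 \<subseteq> S r" using So[OF r(1)] r(3) by (meson open_contains_ball)
        moreover have "g x - e \<le> g y" if "\<bar>y - x\<bar> < d1" for y
        proof -
          have "y \<in> S r" using calculation that by (auto simp: dist_real_def abs_minus_commute subset_eq)
          then show ?thesis using g_ge[OF r(1), of y] r(2) by linarith
        qed
        ultimately show ?thesis using that by blast
      qed
      have "(g x - e) * (t - s) \<le> integral {s..t} g" if "s \<le> t" "t - s < d1" "x \<in> {s..t}" for s t
      proof -
        have "integral {s..t} (\<lambda>_. g x - e) \<le> integral {s..t} g"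
          using that by (intro integral_le gint d1(2)) auto
        then show ?thesis using that by (simp add: mult.commute)
      qed
      then show ?thesis using d1(1) by blast
    qed
    then obtain d1 where d1: "d1 > 0" "\<And>s t. s \<le> t \<Longrightarrow> t - s < d1 \<Longrightarrow> x \<in> {s..t} \<Longrightarrow> (g x - e) * (t - s) \<le> integral {s..t} g"
      by blast
    have "\<exists>d2>0. \<forall>s t. s \<le> t \<and> t - s < d2 \<and> x \<in> {s..t} \<longrightarrow> integral {s..t} g \<le> (g x + e) * (t - s)"
    proof (cases "g x + e / 2 < 1")
      case False
      have "integral {s..t} g \<le> (g x + e) * (t - s)" if "s \<le> t" for s t
      proof -
        have "integral {s..t} g \<le> integral {s..t} (\<lambda>_. g x + e)"
        proof (intro integral_le gint)
          fix y show "g y \<le> g x + e" using g1[of y] False e by simp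
        qed auto
        then show ?thesis using that by (simp add: mult.commute)
      qed
      then show ?thesis by (intro exI[of _ 1]) auto
    next
      case True
      \<comment> \<open>Two levels are chosen: \<open>x\<close> lies outside \<open>S r\<close>,
        hence \<open>S r'\<close> has density 0 at \<open>x\<close>. Off \<open>S r'\<close> the
        function is at most \<open>r'\<close>, and on it at most \<open>r' + 1\<close>.\<close>
      obtain r' where r': "r' \<in> ?D" "g x < r'" "r' < g x + e / 2"
        using dense[of "g x" "g x + e / 2"] g0 True e by auto
      obtain r where r: "r \<in> ?D" "g x < r" "r < r'"
        using dense[of "g x" r'] g0 r' by auto
      have "x \<notin> S r" using g_ge[OF r(1), of x] r(2) by auto
      then have "thin_at (S r') x" using S[OF r(1) r'(1) r(3)] by (simp add: thin_in_def)
      then obtain d where d: "d > 0" "\<And>h. 0 < h \<Longrightarrow> h < d \<Longrightarrow> measure lborel (S r' \<inter> {x-h..x+h}) \<le> e / 2 * h"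
        using thin_atD[of "S r'" x "e / 2"] e by auto
      have Sb: "S r' \<in> sets borel" using So[OF r'(1)] by simp
      have "integral {s..t} g \<le> (g x + e) * (t - s)" if st: "s \<le> t" "t - s < d" "x \<in> {s..t}" for s t
      proof (cases "s = t")
        case False
        then have st': "s < t" using st by simp
        have *: "((\<lambda>y. r' + indicator (S r') y) has_integral r' * (t - s) + measure lborel (S r' \<inter> {s..t})) {s..t}"
          using has_integral_add[OF has_integral_const_real[of r' s t] has_integral_indicator_Icc[OF Sb]] st
          by (simp add: mult.commute)
        have "integral {s..t} g \<le> r' * (t - s) + measure lborel (S r' \<inter> {s..t})"
        proof (rule has_integral_le[OF integrable_integral[OF gint] *])
          fix y show "g y \<le> r' + indicator (S r') y"
            using g_le_notin[OF r'(1), of y] g1[of y] r' g0[of x] by (cases "y \<in> S r'") auto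
        qed
        also have "measure lborel (S r' \<inter> {s..t}) \<le> measure lborel (S r' \<inter> {x-(t-s)..x+(t-s)})"
          using st Sb emeasure_Int_Icc_finite[of "S r'" "x-(t-s)" "x+(t-s)"]
          by (intro measure_mono_fmeasurable) (auto simp: fmeasurable_def less_top)
        also have "\<dots> \<le> e / 2 * (t - s)" using d(2)[of "t - s"] st st' by auto
        finally have "integral {s..t} g \<le> (r' + e / 2) * (t - s)" by (simp add: algebra_simps)
        also have "\<dots> \<le> (g x + e) * (t - s)" using r' st by (intro mult_right_mono) auto
        finally show ?thesis .
      qed simp
      then show ?thesis using d(1) by blast
    qed
    then obtain d2 where d2: "d2 > 0" "\<And>s t. s \<le> t \<Longrightarrow> t - s < d2 \<Longrightarrow> x \<in> {s..t} \<Longrightarrow> integral {s..t} g \<le> (g x + e) * (t - s)"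
      by blast
    show "\<exists>d>0. \<forall>s t. s \<le> t \<and> t - s < d \<and> x \<in> {s..t} \<longrightarrow>
        (g x - e) * (t - s) \<le> integral {s..t} g \<and> integral {s..t} g \<le> (g x + e) * (t - s)"
      using d1 d2 by (intro exI[of _ "min d1 d2"]) auto
  qed (use gb g0 g1 in auto)
qed

text \<open>A function whose interval averages converge to its value at every point is the
  derivative of its integral everywhere, not just almost everywhere.\<close>

lemma thin_in_antiderivative:
  fixes a :: real
  assumes "thin_in U V"
  obtains G g :: "real \<Rightarrow> real" where "\<And>x. a < x \<Longrightarrow> (G has_real_derivative g x) (at x)"
    "\<And>x. x \<in> V \<Longrightarrow> g x = 1" "\<And>x. x \<notin> U \<Longrightarrow> g x = 0" "\<And>x. 0 \<le> g x" "G a = 0"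
    "\<And>x y. a \<le> x \<Longrightarrow> x \<le> y \<Longrightarrow> 0 \<le> G y - G x \<and> G y - G x \<le> measure lborel (U \<inter> {x..y})"
proof -
  obtain g :: "real \<Rightarrow> real" where g: "g \<in> borel_measurable borel" "\<And>x. 0 \<le> g x" "\<And>x. g x \<le> 1"
    "\<And>x. x \<in> V \<Longrightarrow> g x = 1" "\<And>x. x \<notin> U \<Longrightarrow> g x = 0"
    and avg: "\<And>x e. e > 0 \<Longrightarrow> \<exists>d>0. \<forall>s t. s \<le> t \<and> t - s < d \<and> x \<in> {s..t} \<longrightarrow>
        (g x - e) * (t - s) \<le> integral {s..t} g \<and> integral {s..t} g \<le> (g x + e) * (t - s)"
    using thin_in_Urysohn[OF assms] by blast
  have U: "U \<in> sets borel" using assms by (simp add: thin_in_def)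
  have gint: "g integrable_on {s..t}" for s t
  proof (rule measurable_bounded_by_integrable_imp_integrable_real[where g = "\<lambda>x. 1"])
    show "g \<in> borel_measurable (lebesgue_on {s..t})"
      using g(1) by (intro measurable_restrict_space1) (auto intro: measurable_completion)
  qed (use g in auto)
  define G where "G y = integral {a..y} g" for y
  have Gd: "G y - G x = integral {x..y} g" if "a \<le> x" "x \<le> y" for x y
    using Henstock_Kurzweil_Integration.integral_combine[OF that gint] by (simp add: G_def)
  show thesis
  proof (rule that[of G g])
    fix x assume ax: "a < x"
    have "(\<lambda>h. (G (x + h) - G x) / h) \<midarrow>0\<rightarrow> g x"
    proof (rule LIM_I)
      fix e :: real assume e: "e > 0"
      obtain d where d: "d > 0" "\<And>s t. s \<le> t \<Longrightarrow> t - s < d \<Longrightarrow> x \<in> {s..t} \<Longrightarrow>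
        (g x - e / 2) * (t - s) \<le> integral {s..t} g \<and> integral {s..t} g \<le> (g x + e / 2) * (t - s)"
        using avg[of "e / 2" x] e by auto
      show "\<exists>s>0. \<forall>h. h \<noteq> 0 \<and> norm (h - 0) < s \<longrightarrow> norm ((G (x + h) - G x) / h - g x) < e"
      proof (intro exI[of _ "min d (x - a)"] conjI allI impI)
        show "0 < min d (x - a)" using d ax by auto
        fix h :: real assume h: "h \<noteq> 0 \<and> norm (h - 0) < min d (x - a)"
        have "(g x - e / 2) \<le> (G (x + h) - G x) / h \<and> (G (x + h) - G x) / h \<le> g x + e / 2"
        proof (cases "h > 0")
          case True
          then show ?thesis using d(2)[of x "x + h"] h Gd[of x "x + h"] ax by (auto simp: field_simps)
        next
          case False
          then show ?thesis using d(2)[of "x + h" x] h Gd[of "x + h" x] ax by (auto simp: field_simps)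
        qed
        then show "norm ((G (x + h) - G x) / h - g x) < e" using e by (auto simp: abs_less_iff)
      qed
    qed
    then show "(G has_real_derivative g x) (at x)" by (simp add: DERIV_def)
  next
    fix x y :: real assume xy: "a \<le> x" "x \<le> y"
    have "integral {x..y} g \<le> measure lborel (U \<inter> {x..y})"
    proof (rule has_integral_le[OF integrable_integral[OF gint] has_integral_indicator_Icc[OF U]])
      fix z show "g z \<le> indicator U z" using g by (cases "z \<in> U") auto
    qed
    moreover have "0 \<le> integral {x..y} g" using g by (intro Henstock_Kurzweil_Integration.integral_nonneg gint) auto
    ultimately show "0 \<le> G y - G x \<and> G y - G x \<le> measure lborel (U \<inter> {x..y})" using Gd[OF xy] by simp
  qed (use g in \<open>auto simp: G_def\<close>)
qed

text \<open>The powers of 1/2 make a series of antiderivatives and its tails summable; the bound by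
  \<open>h^2\<close> makes a tail flat to first order at points off \<open>U k\<close>. Measure
  bounds begin at \<open>U (Suc 0)\<close>, because the starting set is an arbitrary open superset
  of \<open>N\<close>.\<close>

lemma nested_thin_open_sets:
  fixes N :: "real set"
  assumes N: "negligible N"
  obtains U :: "nat \<Rightarrow> real set" where "\<And>k. N \<subseteq> U k" "\<And>k. thin_in (U k) (U (Suc k))"
    "\<And>k. emeasure lborel (U (Suc k)) \<le> ennreal ((1/2)^k)"
    "\<And>k x h. x \<notin> U k \<Longrightarrow> h > 0 \<Longrightarrow> measure lborel (U (Suc k) \<inter> {x-h..x+h}) \<le> (1/2)^k * h\<^sup>2"
proof -
  let ?P = "\<lambda>A. open A \<and> N \<subseteq> A"
  let ?Q = "\<lambda>k A B. B \<subseteq> A \<and> emeasure lborel B \<le> ennreal ((1/2)^k) \<and>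
    (\<forall>x h. x \<notin> A \<longrightarrow> h > 0 \<longrightarrow> measure lborel (B \<inter> {x-h..x+h}) \<le> (1/2)^k * h\<^sup>2)"
  obtain U where UP: "\<And>n. ?P (U n)" and UQ: "\<And>n. ?Q n (U n) (U (Suc n))"
  proof -
    have "\<exists>U. \<forall>n. ?P (U n) \<and> ?Q n (U n) (U (Suc n))"
    proof (rule dependent_nat_choice)
      show "\<exists>A. ?P A" by (intro exI[of _ UNIV]) auto
      fix A and k :: nat assume A: "?P A"
      obtain B where "open B" "N \<subseteq> B" "B \<subseteq> A" "emeasure lborel B \<le> ennreal ((1/2)^k)"
        "\<And>x h. x \<notin> A \<Longrightarrow> h > 0 \<Longrightarrow> measure lborel (B \<inter> {x-h..x+h}) \<le> (1/2)^k * h\<^sup>2"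
        using open_nbhd_of_null_thin[OF N, of A "(1/2)^k"] A by auto
      then show "\<exists>B. ?P B \<and> ?Q k A B" by blast
    qed
    then show ?thesis using that by blast
  qed
  show thesis
  proof (rule that[of U])
    fix k
    have "thin_at (U (Suc k)) x" if "x \<notin> U k" for x
    proof (rule thin_atI)
      fix e :: real assume e: "e > 0"
      have "measure lborel (U (Suc k) \<inter> {x-h..x+h}) \<le> e * h" if h: "0 < h" "h < e" for h
      proof -
        have "measure lborel (U (Suc k) \<inter> {x-h..x+h}) \<le> (1/2)^k * h\<^sup>2" using UQ[of k] \<open>x \<notin> U k\<close> h by blast
        also have "\<dots> \<le> 1 * h\<^sup>2" by (intro mult_right_mono power_le_one) auto
        also have "\<dots> \<le> e * h" using h by (simp add: power2_eq_square mult_right_mono)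
        finally show ?thesis .
      qed
      then show "\<exists>d>0. \<forall>h. 0 < h \<and> h < d \<longrightarrow> measure lborel (U (Suc k) \<inter> {x-h..x+h}) \<le> e * h" using e by blast
    qed
    then show "thin_in (U k) (U (Suc k))" using UP UQ by (auto simp: thin_in_def)
  qed (use UP UQ in auto)
qed

text \<open>The inverse of \<open>p\<close> is \<open>q = id + (\<Sum>k. G k)\<close>, where \<open>G k\<close> is everywhere differentiable with derivative
  1 on \<open>U (k + 1)\<close> and 0 off \<open>U k\<close>, for open sets \<open>U k\<close> shrinking rapidly to a null set that contains
  \<open>N\<close>; the derivative of \<open>q\<close> exists everywhere, and is infinite exactly on the intersection of the \<open>U k\<close>.\<close>

lemma null_set_flattening:
  fixes N :: "real set"
  assumes N: "negligible N" and S: "S > 0"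
  obtains T :: real and p p' :: "real \<Rightarrow> real" where "T > 0" "p 0 = 0" "p T = S" "1-lipschitz_on {0..T} p"
    "\<And>y. y \<in> {0..T} \<Longrightarrow> p y \<in> {0..S}"
    "\<And>y. y \<in> {0<..<T} \<Longrightarrow> (p has_real_derivative p' y) (at y)"
    "\<And>y. 0 \<le> p' y" "\<And>y. y \<in> {0<..<T} \<Longrightarrow> p y \<in> N \<Longrightarrow> p' y = 0" "negligible {y\<in>{0<..<T}. p' y = 0}"
proof -
  obtain U :: "nat \<Rightarrow> real set" where NU: "\<And>k. N \<subseteq> U k" and thin: "\<And>k. thin_in (U k) (U (Suc k))"
    and Um: "\<And>k. emeasure lborel (U (Suc k)) \<le> ennreal ((1/2)^k)"
    and Uh: "\<And>k x h. x \<notin> U k \<Longrightarrow> h > 0 \<Longrightarrow> measure lborel (U (Suc k) \<inter> {x-h..x+h}) \<le> (1/2)^k * h\<^sup>2"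
    using nested_thin_open_sets[OF N] by blast
  have Uo: "open (U k)" for k using thin[of k] by (simp add: thin_in_def)
  have Usub: "U k \<subseteq> U m" if "m \<le> k" for m k
    by (rule lift_Suc_antimono_le[OF _ that]) (use thin in \<open>simp add: thin_in_def\<close>)
  \<comment> \<open>The base point -1 keeps all of \<open>{0..S}\<close> in the region of two-sided
    differentiability.\<close>
  have "\<exists>G g. (\<forall>x>-1. (G has_real_derivative g x) (at x)) \<and> (\<forall>x\<in>U (Suc k). g x = 1) \<and> (\<forall>x. x \<notin> U k \<longrightarrow> g x = 0)
     \<and> (\<forall>x. 0 \<le> g x) \<and> G (-1) = 0
     \<and> (\<forall>x y. -1 \<le> x \<longrightarrow> x \<le> y \<longrightarrow> 0 \<le> G y - G x \<and> G y - G x \<le> measure lborel (U k \<inter> {x..y}))" for k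
    by (rule thin_in_antiderivative[OF thin[of k], of "-1"]) blast
  then obtain G g :: "nat \<Rightarrow> real \<Rightarrow> real" where
    G: "\<And>k. \<forall>x>-1. (G k has_real_derivative g k x) (at x)" and g1: "\<And>k. \<forall>x\<in>U (Suc k). g k x = 1"
    and g0: "\<And>k. \<forall>x. x \<notin> U k \<longrightarrow> g k x = 0" and gn: "\<And>k. \<forall>x. 0 \<le> g k x" and Ga: "\<And>k. G k (-1) = 0"
    and Gm: "\<And>k. \<forall>x y. -1 \<le> x \<longrightarrow> x \<le> y \<longrightarrow> 0 \<le> G k y - G k x \<and> G k y - G k x \<le> measure lborel (U k \<inter> {x..y})"
    by metis
  have mU: "measure lborel (U (Suc k) \<inter> {x..y}) \<le> (1/2)^k" for k x y
  proof -
    have "emeasure lborel (U (Suc k) \<inter> {x..y}) \<le> emeasure lborel (U (Suc k))"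
      using Uo by (intro emeasure_mono) auto
    then have "emeasure lborel (U (Suc k) \<inter> {x..y}) \<le> ennreal ((1/2)^k)" using Um[of k] by (rule order_trans)
    then show ?thesis by (simp add: measure_def enn2real_leI)
  qed
  have Gnn: "0 \<le> G k y" if "-1 \<le> y" for k y using Gm[of k] Ga[of k] that by force
  have Gle: "G (Suc k) y \<le> (1/2)^k" if "-1 \<le> y" for k y
    using Gm[of "Suc k"] Ga[of "Suc k"] that mU[of k "-1" y] by force
  have geo: "summable (\<lambda>k. (1/2::real)^k)" by (rule summable_geometric) simp
  have geos: "(\<Sum>k. (1/2::real)^k) = 2" using suminf_geometric[of "1/2::real"] by simp
  have sumG: "summable (\<lambda>k. G k y)" if "-1 \<le> y" for y
  proof -
    have "summable (\<lambda>k. G (Suc k) y)"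
      by (rule summable_comparison_test'[OF geo, of 0]) (use Gnn[OF that] Gle[OF that] in auto)
    then show ?thesis using summable_Suc_iff[of "\<lambda>k. G k y"] by blast
  qed
  have sumG': "summable (\<lambda>k. G (k + m) y)" if "-1 \<le> y" for m y
    using sumG[OF that] summable_iff_shift[of "\<lambda>k. G k y" m] by blast
  define H where "H m y = y + (\<Sum>k<m. G k y)" for m y
  define R where "R m y = (\<Sum>k. G (k + m) y)" for m y
  define q where "q y = y + (\<Sum>k. G k y)" for y
  have qHR: "q y = H m y + R m y" if "-1 \<le> y" for m y
    using suminf_split_initial_segment[OF sumG[OF that], of m] by (simp add: q_def H_def R_def)
  have Rmono: "R m x \<le> R m y" if "-1 \<le> x" "x \<le> y" for m x y
    unfolding R_def
  proof (rule suminf_le)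
    show "G (k + m) x \<le> G (k + m) y" for k using Gm[of "k + m"] that by force
  qed (use sumG' that in auto)
  have Rnn: "0 \<le> R m y" if "-1 \<le> y" for m y
    unfolding R_def by (intro suminf_nonneg sumG' Gnn that)
  have Rle: "R (Suc m) y \<le> 2 * (1/2)^m" if "-1 \<le> y" for m y
  proof -
    have "R (Suc m) y \<le> (\<Sum>k. (1/2)^m * (1/2)^k)"
      unfolding R_def
    proof (rule suminf_le)
      show "G (k + Suc m) y \<le> (1/2)^m * (1/2)^k" for k
        using Gle[OF that, of "k + m"] by (simp add: power_add mult.commute)
    qed (use sumG'[OF that, of "Suc m"] geo in \<open>auto intro: summable_mult\<close>)
    also have "\<dots> = 2 * (1/2)^m" using suminf_mult[OF geo, of "(1/2)^m"] geos by simp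
    finally show ?thesis .
  qed
  \<comment> \<open>At a point off \<open>U m\<close> the later sets have measure quadratic in the
    distance. So the tail has derivative 0 there, and only finitely many terms enter
    \<open>qder\<close>.\<close>
  have Rquad: "\<bar>R (Suc m) y - R (Suc m) x\<bar> \<le> 2 * (y - x)\<^sup>2" if x: "x \<notin> U m" "-1 \<le> x" "-1 \<le> y" for m x y
  proof (cases "y = x")
    case False
    define h where "h = \<bar>y - x\<bar>"
    have h: "h > 0" using False by (simp add: h_def)
    have each: "\<bar>G (k + Suc m) y - G (k + Suc m) x\<bar> \<le> h\<^sup>2 * (1/2)^k" for k
    proof -
      let ?I = "{min x y..max x y}"
      have "\<bar>G (k + Suc m) y - G (k + Suc m) x\<bar> \<le> measure lborel (U (k + Suc m) \<inter> ?I)"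
      proof (cases "x \<le> y")
        case True
        then have "0 \<le> G (k + Suc m) y - G (k + Suc m) x \<and> G (k + Suc m) y - G (k + Suc m) x \<le> measure lborel (U (k + Suc m) \<inter> {x..y})"
          using Gm[of "k + Suc m"] x by blast
        then show ?thesis using True by (simp only: min_def max_def if_True abs_of_nonneg)
      next
        case False
        then have "0 \<le> G (k + Suc m) x - G (k + Suc m) y \<and> G (k + Suc m) x - G (k + Suc m) y \<le> measure lborel (U (k + Suc m) \<inter> {y..x})"
          using Gm[of "k + Suc m"] x by (meson nle_le)
        then show ?thesis using False by (simp only: min_def max_def if_False abs_minus_commute[of "G (k + Suc m) y"] abs_of_nonneg)
      qed
      also have "\<dots> \<le> measure lborel (U (k + Suc m) \<inter> {x-h..x+h})"
        using Uo emeasure_Int_Icc_finite[of "U (k + Suc m)" "x-h" "x+h"]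
        by (intro measure_mono_fmeasurable) (auto simp: fmeasurable_def less_top h_def)
      also have "\<dots> \<le> (1/2)^(k + m) * h\<^sup>2"
        using Uh[of x "k + m" h] Usub[of m "k + m"] x(1) h by auto
      also have "\<dots> \<le> (1/2)^k * h\<^sup>2"
        by (intro mult_right_mono power_decreasing) auto
      finally show ?thesis by (simp add: mult.commute)
    qed
    have "\<bar>R (Suc m) y - R (Suc m) x\<bar> = \<bar>\<Sum>k. G (k + Suc m) y - G (k + Suc m) x\<bar>"
      unfolding R_def by (subst suminf_diff[OF sumG'[OF x(3), of "Suc m"] sumG'[OF x(2), of "Suc m"]]) (rule refl)
    also have "\<dots> \<le> (\<Sum>k. h\<^sup>2 * (1/2)^k)"
      using norm_suminf_le[of "\<lambda>k. G (k + Suc m) y - G (k + Suc m) x" "\<lambda>k. h\<^sup>2 * (1/2)^k"] each summable_mult[OF geo, of "h\<^sup>2"]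
      unfolding real_norm_def by blast
    also have "\<dots> = h\<^sup>2 * 2" using suminf_mult[OF geo, of "h\<^sup>2"] geos by simp
    finally show ?thesis by (simp add: h_def mult.commute)
  qed simp
  have Hder: "(H m has_real_derivative (1 + (\<Sum>k<m. g k x))) (at x)" if "-1 < x" for m x
    unfolding H_def[abs_def] using G that by (auto intro!: derivative_eq_intros)
  have qder: "(q has_real_derivative (1 + (\<Sum>k<Suc m. g k x))) (at x)" if x: "x \<notin> U m" "-1 < x" for m x
  proof -
    have "(\<lambda>h. (R (Suc m) (x + h) - R (Suc m) x) / h) \<midarrow>0\<rightarrow> 0"
    proof (rule LIM_I)
      fix e :: real assume e: "e > 0"
      show "\<exists>s>0. \<forall>h. h \<noteq> 0 \<and> norm (h - 0) < s \<longrightarrow> norm ((R (Suc m) (x + h) - R (Suc m) x) / h - 0) < e"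
      proof (intro exI[of _ "min (e / 2) (x + 1)"] conjI allI impI)
        show "0 < min (e / 2) (x + 1)" using e x by auto
        fix h :: real assume h: "h \<noteq> 0 \<and> norm (h - 0) < min (e / 2) (x + 1)"
        have "\<bar>R (Suc m) (x + h) - R (Suc m) x\<bar> \<le> 2 * h\<^sup>2" using Rquad[OF x(1), of "x + h"] x h by auto
        then have "\<bar>R (Suc m) (x + h) - R (Suc m) x\<bar> / \<bar>h\<bar> \<le> 2 * \<bar>h\<bar>"
          using h by (simp add: divide_le_eq power2_eq_square abs_mult_self_eq mult.assoc)
        then show "norm ((R (Suc m) (x + h) - R (Suc m) x) / h - 0) < e" using h by (simp add: abs_divide)
      qed
    qed
    then have "(R (Suc m) has_real_derivative 0) (at x)" by (simp add: DERIV_def)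
    from DERIV_add[OF Hder[OF x(2), of "Suc m"] this]
    have "((\<lambda>y. H (Suc m) y + R (Suc m) y) has_real_derivative (1 + (\<Sum>k<Suc m. g k x))) (at x)" by simp
    then show ?thesis
      by (rule has_field_derivative_transform_within_open[of _ _ _ "{-1<..}"]) (use x qHR in auto)
  qed
  have Hmono: "y - x \<le> H m y - H m x" if "-1 \<le> x" "x \<le> y" for m x y
  proof -
    have "(\<Sum>k<m. G k x) \<le> (\<Sum>k<m. G k y)" using Gm that by (intro sum_mono) force
    then show ?thesis by (simp add: H_def)
  qed
  \<comment> \<open>\<open>q\<close> expands distances, which makes its inverse \<open>p\<close>
    1-Lipschitz.\<close>
  have qexp: "y - x \<le> q y - q x" if "-1 \<le> x" "x \<le> y" for x y
    using Hmono[OF that, of 0] Rmono[OF that, of 0] qHR[of x 0] qHR[of y 0] that by auto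
  have qcont: "continuous_on {0..S} q"
  proof (rule uniform_limit_theorem[where F = sequentially])
    show "\<forall>\<^sub>F m in sequentially. continuous_on {0..S} (H (Suc m))"
    proof (rule always_eventually, intro allI continuous_at_imp_continuous_on ballI)
      fix m x assume "x \<in> {0..S}"
      then show "isCont (H (Suc m)) x" using Hder[of x "Suc m"] DERIV_isCont by auto
    qed
    show "uniform_limit {0..S} (\<lambda>m. H (Suc m)) q sequentially"
    proof (rule uniform_limitI)
      fix e :: real assume e: "e > 0"
      have "(\<lambda>m. 2 * (1/2::real)^m) \<longlonglongrightarrow> 2 * 0" by (intro tendsto_intros LIMSEQ_power_zero) auto
      then have "\<forall>\<^sub>F m in sequentially. 2 * (1/2::real)^m < e" using e by (intro order_tendstoD(2)) auto
      then show "\<forall>\<^sub>F m in sequentially. \<forall>x\<in>{0..S}. dist (H (Suc m) x) (q x) < e"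
      proof eventually_elim
        case (elim m)
        show ?case
        proof
          fix x assume "x \<in> {0..S}"
          then have "-1 \<le> x" by simp
          from qHR[OF this, of "Suc m"] Rnn[OF this, of "Suc m"] Rle[OF this, of m] elim
          show "dist (H (Suc m) x) (q x) < e" by (simp add: dist_real_def)
        qed
      qed
    qed
  qed simp
  define T where "T = q S - q 0"
  have T: "T > 0" using qexp[of 0 S] S by (simp add: T_def)
  define p where "p y = (SOME x. x \<in> {0..S} \<and> q x = q 0 + y)" for y
  have p: "p y \<in> {0..S} \<and> q (p y) = q 0 + y" if "y \<in> {0..T}" for y
  proof -
    have "\<exists>x\<ge>0. x \<le> S \<and> q x = q 0 + y"
    proof (rule IVT')
      show "q 0 \<le> q 0 + y" "q 0 + y \<le> q S" "0 \<le> S" using that S by (auto simp: T_def)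
    qed (rule qcont)
    then have "\<exists>x. x \<in> {0..S} \<and> q x = q 0 + y" by auto
    then show ?thesis unfolding p_def by (rule someI_ex)
  qed
  have pexp: "p y \<le> p z \<and> p z - p y \<le> z - y" if "y \<in> {0..T}" "z \<in> {0..T}" "y \<le> z" for y z
  proof -
    have "p y \<le> p z"
    proof (rule ccontr)
      assume "\<not> p y \<le> p z"
      then show False using qexp[of "p z" "p y"] p[OF that(1)] p[OF that(2)] that(3) by auto
    qed
    then show ?thesis using qexp[of "p y" "p z"] p[OF that(1)] p[OF that(2)] by auto
  qed
  have qinj: "x = y" if "q x = q y" "0 \<le> x" "0 \<le> y" for x y
  proof (cases "x \<le> y")
    case True
    then show ?thesis using qexp[of x y] that by linarith
  next
    case False
    then show ?thesis using qexp[of y x] that by linarith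
  qed
  have p0: "p 0 = 0" by (rule qinj) (use p[of 0] T in auto)
  have pT: "p T = S" by (rule qinj) (use p[of T] T S in \<open>auto simp: T_def\<close>)
  have pL: "1-lipschitz_on {0..T} p"
  proof (rule lipschitz_onI)
    fix y z assume yz: "y \<in> {0..T}" "z \<in> {0..T}"
    show "dist (p y) (p z) \<le> 1 * dist y z"
      using pexp[OF yz] pexp[OF yz(2,1)] by (cases "y \<le> z") (auto simp: dist_real_def)
  qed simp
  have pcont: "continuous_on {0..T} p" by (rule lipschitz_on_continuous_on[OF pL])
  have piscont: "isCont p y" if "y \<in> {0<..<T}" for y
    using continuous_on_interior[OF pcont] that by (simp add: interior_atLeastAtMost_real)
  have pin: "0 < p y \<and> p y < S" if y: "y \<in> {0<..<T}" for y
  proof -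
    have py: "p y \<in> {0..S}" "q (p y) = q 0 + y" using p[of y] y by auto
    then have "p y \<noteq> 0" "p y \<noteq> S" using y by (auto simp: T_def)
    then show ?thesis using py by auto
  qed
  \<comment> \<open>Where \<open>p y\<close> lies in every \<open>U m\<close>, all
    \<open>g k\<close> equal 1 and the derivative of \<open>q\<close> is infinite. Elsewhere only
    finitely many \<open>g k\<close> are nonzero and the series is a finite sum.\<close>
  define p' where "p' y = (if \<forall>m. p y \<in> U m then 0 else inverse (1 + (\<Sum>k. g k (p y))))" for y
  have gsum: "(\<Sum>k. g k x) = (\<Sum>k<m. g k x)" "summable (\<lambda>k. g k x)" if "x \<notin> U m" for x m
  proof -
    have "g k x = 0" if "k \<notin> {..<m}" for k
      using g0[of k] Usub[of m k] that \<open>x \<notin> U m\<close> by auto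
    then show "(\<Sum>k. g k x) = (\<Sum>k<m. g k x)" "summable (\<lambda>k. g k x)"
      using suminf_finite[of "{..<m}" "\<lambda>k. g k x"] summable_finite[of "{..<m}" "\<lambda>k. g k x"] by auto
  qed
  have pder: "(p has_real_derivative p' y) (at y)" if y: "y \<in> {0<..<T}" for y
  proof (cases "\<forall>m. p y \<in> U m")
    case False
    then obtain m where m: "p y \<notin> U m" by blast
    let ?D = "1 + (\<Sum>k<Suc m. g k (p y))"
    have "p y \<notin> U (Suc m)" using m Usub[of m "Suc m"] by auto
    then have D: "?D = 1 + (\<Sum>k. g k (p y))" using gsum(1) by simp
    have Dp: "?D \<ge> 1" using gn by (simp add: sum_nonneg)
    have der: "((\<lambda>x. q x - q 0) has_real_derivative ?D) (at (p y))"
      using DERIV_diff[OF qder[OF m] DERIV_const] pin[OF y] by simp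
    have "(p has_real_derivative inverse ?D) (at y)"
      by (rule DERIV_inverse_function[where f = "\<lambda>x. q x - q 0" and a = 0 and b = T])
        (use der Dp y p piscont in auto)
    moreover have "p' y = inverse ?D" unfolding p'_def D using False by (rule if_not_P)
    ultimately show ?thesis by simp
  next
    case True
    have "(\<lambda>h. (p (y + h) - p y) / h) \<midarrow>0\<rightarrow> 0"
    proof (rule LIM_I)
      fix e :: real assume e: "e > 0"
      \<comment> \<open>Increments of \<open>q\<close> dominate those of \<open>H m\<close>, whose
        slope at \<open>p y\<close> is \<open>1 + m\<close>; inverting gives quotients of
        \<open>p\<close> below \<open>1 / m\<close>, which is below \<open>e\<close>.\<close>
      obtain m :: nat where m: "1 / e < real m" using reals_Archimedean2 by blast
      then have m0: "real m > 0" using e by (meson less_trans divide_pos_pos zero_less_one)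
      have "(\<Sum>k<m. g k (p y)) = (\<Sum>k<m. 1)" using g1 True by (intro sum.cong) auto
      then have "(H m has_real_derivative (1 + real m)) (at (p y))" using Hder[of "p y" m] pin[OF y] by simp
      then have "(\<lambda>k. (H m (p y + k) - H m (p y)) / k) \<midarrow>0\<rightarrow> 1 + real m" by (simp add: DERIV_def)
      from LIM_D[OF this, of 1] obtain d where d: "d > 0"
        "\<And>k. k \<noteq> 0 \<Longrightarrow> \<bar>k\<bar> < d \<Longrightarrow> \<bar>(H m (p y + k) - H m (p y)) / k - (1 + real m)\<bar> < 1"
        by auto
      show "\<exists>s>0. \<forall>h. h \<noteq> 0 \<and> norm (h - 0) < s \<longrightarrow> norm ((p (y + h) - p y) / h - 0) < e"
      proof (intro exI[of _ "min d (min y (T - y))"] conjI allI impI)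
        show "0 < min d (min y (T - y))" using d y by auto
        fix h :: real assume h: "h \<noteq> 0 \<and> norm (h - 0) < min d (min y (T - y))"
        then have yh: "y + h \<in> {0..T}" "y \<in> {0..T}" using y by auto
        define k where "k = p (y + h) - p y"
        have kh: "\<bar>k\<bar> \<le> \<bar>h\<bar>" using lipschitz_onD[OF pL yh] by (simp add: k_def dist_real_def)
        have pk: "p (y + h) = p y + k" by (simp add: k_def)
        have qk: "q (p y + k) - q (p y) = h" using p[OF yh(1)] p[OF yh(2)] by (simp add: pk)
        have k0: "k \<noteq> 0" using qk h by auto
        have ge: "-1 \<le> p y" "-1 \<le> p y + k" using p[OF yh(1)] p[OF yh(2)] by (auto simp: pk)
        have "(H m (p y + k) - H m (p y)) / k \<le> (q (p y + k) - q (p y)) / k"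
        proof (cases "k > 0")
          case True
          then show ?thesis using Rmono[of "p y" "p y + k" m] ge qHR[OF ge(1), of m] qHR[OF ge(2), of m]
            by (intro divide_right_mono) auto
        next
          case False
          then show ?thesis using Rmono[of "p y + k" "p y" m] ge qHR[OF ge(1), of m] qHR[OF ge(2), of m]
            by (intro divide_right_mono_neg) auto
        qed
        moreover have "\<bar>k\<bar> < d" using kh h by auto
        ultimately have "real m < h / k" using d(2)[OF k0] unfolding qk by linarith
        then have hk: "1 / e < h / k" using m by simp
        then have "0 < h / k" using e by (meson less_trans divide_pos_pos zero_less_one)
        then have "k / h < e" "0 < k / h" using hk e by (auto simp: field_simps zero_less_divide_iff)
        then show "norm ((p (y + h) - p y) / h - 0) < e" by (simp add: k_def[symmetric])
      qed
    qed
    then show ?thesis using True by (simp add: DERIV_def p'_def)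
  qed
  define Z where "Z = {y\<in>{0<..<T}. p' y = 0}"
  have p'01: "(p' y = 0 \<longleftrightarrow> (\<forall>m. p y \<in> U m)) \<and> 0 \<le> p' y" for y
  proof (cases "\<forall>m. p y \<in> U m")
    case False
    then obtain m where "p y \<notin> U m" by blast
    then have "0 \<le> (\<Sum>k. g k (p y))" using gsum gn by (intro suminf_nonneg) auto
    then show ?thesis using False by (auto simp: p'_def)
  qed (simp add: p'_def)
  have p'0: "p' y = 0 \<longleftrightarrow> (\<forall>m. p y \<in> U m)" and p'nn: "0 \<le> p' y" for y using p'01[of y] by auto
  have Zb: "Z \<in> sets borel"
  proof -
    have op: "open ({0<..<T} \<inter> p -` U m)" for m
      using Uo by (intro continuous_open_preimage continuous_on_subset[OF pcont]) auto
    have "Z = (\<Inter>m. {0<..<T} \<inter> p -` U m)" by (auto simp: Z_def p'0)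
    moreover have "(\<Inter>m. {0<..<T} \<inter> p -` U m) \<in> sets borel"
      by (rule sets.countable_INT) (use borel_open[OF op] in blast)+
    ultimately show ?thesis by simp
  qed
  have Zm: "measure lborel (Z \<inter> {0..T}) \<le> 2 * (1/2)^m" for m
  proof -
    \<comment> \<open>\<open>K\<close> is the tail \<open>R (Suc m)\<close> along \<open>p\<close>,
      up to a constant. Its derivative \<open>D\<close> is nonnegative and equals 1 on
      \<open>Z\<close>, so the measure of \<open>Z\<close> is at most the total increase of a tail,
      which is small.\<close>
    define K where "K y = y - H (Suc m) (p y)" for y
    define D where "D y = 1 - (1 + (\<Sum>k<Suc m. g k (p y))) * p' y" for y
    have KR: "K y = R (Suc m) (p y) - q 0" if "y \<in> {0..T}" for y
      using p[OF that] qHR[of "p y" "Suc m"] by (auto simp: K_def)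
    have Kder: "(K has_vector_derivative D y) (at y)" if y: "y \<in> {0<..<T}" for y
      using DERIV_diff[OF DERIV_ident DERIV_chain2[OF Hder[of "p y" "Suc m"] pder[OF y]]] pin[OF y]
      unfolding K_def[abs_def] D_def has_real_derivative_iff_has_vector_derivative[symmetric] by auto
    have Hc: "continuous_on {0..S} (H (Suc m))"
    proof (intro continuous_at_imp_continuous_on ballI)
      fix x assume "x \<in> {0..S}"
      then show "isCont (H (Suc m)) x" using Hder[of x "Suc m"] DERIV_isCont by auto
    qed
    have Kc: "continuous_on {0..T} K"
      unfolding K_def using p by (intro continuous_intros continuous_on_compose2[OF Hc pcont]) auto
    have "(D has_integral K T - K 0) {0..T}"
      using T by (intro fundamental_theorem_of_calculus_interior Kc Kder) auto
    then have Di: "((\<lambda>y. if y \<in> {0<..<T} then D y else 0) has_integral K T - K 0) {0..T}"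
      by (rule has_integral_spike_finite[of "{0, T}", rotated 2]) auto
    have "measure lborel (Z \<inter> {0..T}) \<le> K T - K 0"
    proof (rule has_integral_le[OF has_integral_indicator_Icc[OF Zb] Di])
      fix y assume y: "y \<in> {0..T}"
      show "indicator Z y \<le> (if y \<in> {0<..<T} then D y else 0)"
      proof (cases "p' y = 0")
        case False
        then obtain m' where m': "p y \<notin> U m'" using p'0 by auto
        have "(\<Sum>k<Suc m. g k (p y)) \<le> (\<Sum>k. g k (p y))"
          using gsum(2)[OF m'] gn by (intro sum_le_suminf) auto
        moreover have "0 \<le> (\<Sum>k<Suc m. g k (p y))" using gn by (intro sum_nonneg) auto
        moreover have "p' y = inverse (1 + (\<Sum>k. g k (p y)))" using False by (auto simp: p'_def)
        ultimately have "0 \<le> D y" by (simp add: D_def divide_inverse[symmetric] divide_le_eq_1)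
        then show ?thesis using False by (auto simp: Z_def)
      qed (auto simp: Z_def D_def)
    qed
    also have "\<dots> \<le> 2 * (1/2)^m"
      using KR[of T] KR[of 0] T p0 pT Rle[of S m] Rnn[of 0 "Suc m"] S by auto
    finally show ?thesis .
  qed
  have "negligible Z"
  proof -
    have "(\<lambda>m. 2 * (1/2::real)^m) \<longlonglongrightarrow> 2 * 0" by (intro tendsto_intros LIMSEQ_power_zero) auto
    then have "measure lborel (Z \<inter> {0..T}) \<le> 0"
      using Zm by (intro LIMSEQ_le_const[of "\<lambda>m. 2 * (1/2::real)^m"]) (simp only: mult_zero_right, blast)
    then have "measure lborel (Z \<inter> {0..T}) = 0" using measure_nonneg[of lborel "Z \<inter> {0..T}"] by linarith
    moreover have "Z \<inter> {0..T} = Z" by (auto simp: Z_def)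
    ultimately have "emeasure lborel Z = 0"
      using emeasure_Int_Icc_finite[of Z 0 T] by (simp add: emeasure_eq_ennreal_measure)
    then have "Z \<in> null_sets lborel" using Zb by auto
    then show ?thesis unfolding negligible_iff_null_sets by (rule null_sets_completionI)
  qed
  moreover have "p' y = 0" if "p y \<in> N" for y using NU that p'0 by blast
  ultimately show thesis using that[OF T p0 pT pL _ pder p'nn] p unfolding Z_def by blast
qed

section \<open>The Lie algebra and a time function on the group\<close>

lemma mat22_eqI:
  fixes A B :: "real^2^2"
  assumes "A$1$1 = B$1$1" "A$1$2 = B$1$2" "A$2$1 = B$2$1" "A$2$2 = B$2$2"
  shows "A = B"
  using assms by (simp add: vec_eq_iff forall_2)

lemma mat22_mult:
  fixes A B :: "real^2^2"
  shows "(A ** B)$i$j = A$i$1 * B$1$j + A$i$2 * B$2$j"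
  by (simp add: matrix_matrix_mult_def sum_2)

lemma norm_mat22: "(norm (A :: real^2^2))\<^sup>2 = (A$1$1)\<^sup>2 + (A$1$2)\<^sup>2 + (A$2$1)\<^sup>2 + (A$2$2)\<^sup>2"
  unfolding power2_norm_eq_inner by (simp add: inner_vec_def sum_2 power2_eq_square)

lemma norm_mat22_mult: "norm (A ** B) \<le> norm (A :: real^2^2) * norm (B :: real^2^2)"
proof -
  have cs: "(a * x + b * y)\<^sup>2 \<le> (a\<^sup>2 + b\<^sup>2) * (x\<^sup>2 + y\<^sup>2)" for a b x y :: real
    using zero_le_power2[of "a * y - b * x"] by (simp add: power2_eq_square algebra_simps)
  have "(norm (A ** B))\<^sup>2 \<le> (norm A)\<^sup>2 * (norm B)\<^sup>2"
    using cs[of "A$1$1" "B$1$1" "A$1$2" "B$2$1"] cs[of "A$1$1" "B$1$2" "A$1$2" "B$2$2"]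
      cs[of "A$2$1" "B$1$1" "A$2$2" "B$2$1"] cs[of "A$2$1" "B$1$2" "A$2$2" "B$2$2"]
    unfolding norm_mat22 mat22_mult by (simp add: algebra_simps)
  then show ?thesis
    by (metis norm_ge_zero mult_nonneg_nonneg power2_le_imp_le power_mult_distrib)
qed

lemma bounded_bilinear_mat22_mult: "bounded_bilinear ((**) :: real^2^2 \<Rightarrow> real^2^2 \<Rightarrow> real^2^2)"
proof
  show "\<exists>K. \<forall>(a :: real^2^2) (b :: real^2^2). norm (a ** b) \<le> norm a * norm b * K"
    by (rule exI[of _ 1]) (simp add: norm_mat22_mult)
qed (auto intro!: mat22_eqI simp: mat22_mult algebra_simps)

lemma norm_mat22_component_le: "\<bar>(A :: real^2^2)$i$j\<bar> \<le> norm A"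
  using order_trans[OF component_le_norm_cart[of "A$i" j] Finite_Cartesian_Product.norm_nth_le[of A i]] .

lemma matrix_inv_mult_cancel:
  fixes A :: "real^2^2"
  assumes "det A = 1"
  shows "matrix_inv A ** (A ** B) = B" "A ** (matrix_inv A ** B) = B"
proof -
  have "invertible A" using assms by (simp add: invertible_det_nz)
  then have "A ** matrix_inv A = mat 1" "matrix_inv A ** A = mat 1"
    unfolding invertible_def matrix_inv_def by (metis (mono_tags, lifting) someI_ex)+
  then show "matrix_inv A ** (A ** B) = B" "A ** (matrix_inv A ** B) = B"
    by (simp_all add: matrix_mul_assoc matrix_mul_lid)
qed

text \<open>For determinant 1 this is the inverse, in a form that is visibly continuous in the
  entries; measurability and integrability of velocities are derived through it. In the index type
  \<open>2\<close>, \<open>3 - i\<close> exchanges 1 and 2.\<close>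

definition adjugate :: "real^2^2 \<Rightarrow> real^2^2" where
  "adjugate A = (\<chi> i j. if i = j then A$(3 - i)$(3 - i) else - A$i$j)"

lemma adjugate_entries [simp]:
  "adjugate A$1$1 = A$2$2" "adjugate A$1$2 = - A$1$2" "adjugate A$2$1 = - A$2$1" "adjugate A$2$2 = A$1$1"
  by (simp_all add: adjugate_def)

lemma matrix_inv_eq_adjugate:
  fixes A :: "real^2^2"
  assumes "det A = 1"
  shows "matrix_inv A = adjugate A"
proof -
  have "A ** adjugate A = mat 1"
    using assms by (intro mat22_eqI) (simp_all add: mat22_mult mat_def det_2 algebra_simps)
  then have "matrix_inv A ** (A ** adjugate A) = matrix_inv A" by (simp add: matrix_mul_rid)
  then show ?thesis using matrix_inv_mult_cancel(1)[OF assms, of "adjugate A"] by simp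
qed

lemma continuous_on_adjugate [continuous_intros]:
  assumes "continuous_on S f"
  shows "continuous_on S (\<lambda>x. adjugate (f x))"
  unfolding adjugate_def
proof (intro continuous_on_vec_lambda)
  fix i j :: 2
  show "continuous_on S (\<lambda>x. if i = j then f x $ (3 - i) $ (3 - i) else - f x $ i $ j)"
    by (cases "i = j") (auto intro!: continuous_intros assms)
qed

text \<open>For \<open>w \<in> R\<^sup>2\<close>, the number \<open>rot_form v x y\<close> is \<open>det (w, v w)\<close>, \<open>w = (x, y)\<close>: the speed of rotation
  of \<open>w\<close> under the linear flow of \<open>v\<close>, times \<open>|w|\<^sup>2\<close>.\<close>

definition rot_form :: "real^2^2 \<Rightarrow> real \<Rightarrow> real \<Rightarrow> real" where
  "rot_form v x y = v$2$1 * x\<^sup>2 - 2 * v$1$1 * x * y - v$1$2 * y\<^sup>2"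

lemma sl2_iff: "v \<in> sl2 \<longleftrightarrow> v$2$2 = - v$1$1"
  by (auto simp: sl2_def trace_def sum_2)

lemma killing_eq:
  assumes "v \<in> sl2"
  shows "killing v v = - 8 * det v"
proof -
  have "v$2$2 = - v$1$1" using assms by (simp add: sl2_iff)
  then show ?thesis
    unfolding killing_def ad_def sl2_coord_def sl2_basis_def
    by (simp add: lessThan_Suc eval_nat_numeral mat22_mult det_2 algebra_simps power2_eq_square)
qed

text \<open>On \<open>sl2\<close> the Killing form is \<open>- 8 * det v\<close>. Adding
  \<open>t\<close> times the diagonal matrix \<open>sl2_basis 0\<close>, with \<open>t\<close> of
  the sign of \<open>v$1$1\<close>, lowers the determinant by at least \<open>t^2\<close>, so a
  vector of determinant at most 0 has neighbours with positive Killing form.\<close>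

lemma det_pos_if_interior:
  assumes v: "v \<in> sl2_interior {v \<in> sl2. killing v v \<le> 0}"
  shows "det v > 0"
proof (rule ccontr)
  assume neg: "\<not> det v > 0"
  obtain e where e: "e > 0" "\<And>w. w \<in> sl2 \<Longrightarrow> dist w v < e \<Longrightarrow> killing w w \<le> 0" and vs: "v \<in> sl2"
    using v by (auto simp: sl2_interior_def)
  have v22: "v$2$2 = - v$1$1" using vs by (simp add: sl2_iff)
  \<comment> \<open>\<open>sl2_basis 0\<close> has norm below 2, so half the radius keeps
    \<open>w\<close> inside the ball.\<close>
  define t where "t = (if v$1$1 \<ge> 0 then e / 2 else - (e / 2))"
  define w where "w = v + t *\<^sub>R sl2_basis 0"
  have w: "w$1$1 = v$1$1 + t" "w$1$2 = v$1$2" "w$2$1 = v$2$1" "w$2$2 = - (v$1$1 + t)"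
    by (simp_all add: w_def sl2_basis_def v22)
  have "w - v = t *\<^sub>R sl2_basis 0" by (simp add: w_def)
  moreover have "norm (sl2_basis 0) < 2"
    by (rule power2_less_imp_less) (simp_all add: norm_mat22 sl2_basis_def)
  ultimately have "dist w v < e"
    using e(1) by (auto simp: dist_norm t_def)
  moreover have ws: "w \<in> sl2" by (simp add: sl2_iff w)
  ultimately have "killing w w \<le> 0" using e(2) by blast
  then have "0 \<le> det w" using killing_eq[OF ws] by simp
  moreover have "det w = det v - 2 * v$1$1 * t - t\<^sup>2"
    by (simp add: det_2 w v22 power2_eq_square algebra_simps)
  moreover have "0 \<le> v$1$1 * t" "0 < t\<^sup>2" using e(1) by (auto simp: t_def zero_le_mult_iff mult_le_0_iff)
  ultimately show False using neg by linarith
qed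

text \<open>As a quadratic form in \<open>(x, y)\<close> it has determinant \<open>det v\<close>;
  completing the square shows that it is definite with the sign of \<open>v$2$1\<close>.\<close>

lemma rot_form_pos:
  assumes "v \<in> sl2" "det v > 0" "e * v$2$1 > 0" "x \<noteq> 0 \<or> y \<noteq> 0"
  shows "e * rot_form v x y > 0"
proof -
  have v22: "v$2$2 = - v$1$1" using assms(1) by (simp add: sl2_iff)
  have "v$2$1 * rot_form v x y = (v$2$1 * x - v$1$1 * y)\<^sup>2 + det v * y\<^sup>2"
    by (simp add: rot_form_def det_2 v22 power2_eq_square algebra_simps)
  moreover have "\<dots> > 0"
  proof (cases "y = 0")
    case True
    then show ?thesis using assms by auto
  next
    case False
    then show ?thesis using assms(2) by (intro add_nonneg_pos) auto
  qed
  ultimately have "v$2$1 * rot_form v x y > 0" by simp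
  then show ?thesis using assms(3) by (auto simp: zero_less_mult_iff)
qed

text \<open>A linear functional that dominates the norm on the cone: its square exceeds the squared
  norm by \<open>2 * det v\<close>. Being linear, it commutes with integration, so integrals of
  velocities cannot become small by cancellation.\<close>

lemma norm_le_tau:
  assumes "v \<in> sl2" "det v > 0" "e * v$2$1 > 0" "e = 1 \<or> e = -1"
  shows "norm v \<le> e * (v$2$1 - v$1$2)"
proof -
  have v22: "v$2$2 = - v$1$1" using assms(1) by (simp add: sl2_iff)
  have "e * rot_form v 0 1 > 0" by (rule rot_form_pos) (use assms in auto)
  then have p: "0 \<le> e * (v$2$1 - v$1$2)" using assms(3) by (simp add: rot_form_def right_diff_distrib)
  have "(norm v)\<^sup>2 \<le> (v$2$1 - v$1$2)\<^sup>2"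
    using assms(2) unfolding norm_mat22 v22 det_2 by (simp add: power2_eq_square algebra_simps)
  also have "\<dots> = (e * (v$2$1 - v$1$2))\<^sup>2" using assms(4) by (auto simp: power_mult_distrib)
  finally show ?thesis using p by (rule power2_le_imp_le)
qed

text \<open>Positive determinant forces \<open>v$2$1\<close> to be nonzero. If both signs occurred,
  a positive combination with that entry 0 would have to vanish, and \<open>C\<close> would contain
  a line.\<close>

lemma timelike_cone_sign:
  assumes "C \<subseteq> sl2" "convex C" "cone C" "acute C" and det: "\<And>v. v \<in> C - {0} \<Longrightarrow> det v > 0"
  obtains e :: real where "e = 1 \<or> e = -1" "\<And>v. v \<in> C - {0} \<Longrightarrow> e * v$2$1 > 0"
proof -
  have nz: "v$2$1 \<noteq> 0" if "v \<in> C - {0}" for v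
  proof
    assume "v$2$1 = 0"
    moreover have "v$2$2 = - v$1$1" using that assms(1) by (auto simp: sl2_iff)
    ultimately have "det v \<le> 0" by (simp add: det_2)
    with det[OF that] show False by simp
  qed
  have same: False if u: "u \<in> C - {0}" "u$2$1 > 0" and v: "v \<in> C - {0}" "v$2$1 < 0" for u v
  proof -
    define a where "a = - v$2$1"
    define b where "b = u$2$1"
    have ab: "a > 0" "b > 0" using u v by (auto simp: a_def b_def)
    have "a *\<^sub>R u + b *\<^sub>R v \<in> C"
      using u v ab assms(2,3) by (meson Diff_iff convex_cone less_imp_le mem_cone)
    moreover have "(a *\<^sub>R u + b *\<^sub>R v)$2$1 = 0" by (simp add: a_def b_def)
    ultimately have z: "a *\<^sub>R u + b *\<^sub>R v = 0" using nz by blast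
    have mC: "c *\<^sub>R u \<in> C" for c
    proof (cases "c \<ge> 0")
      case True
      then show ?thesis using u(1) mem_cone[OF assms(3)] by auto
    next
      case False
      have "(c / a) *\<^sub>R (a *\<^sub>R u + b *\<^sub>R v) = 0" using z by simp
      then have "c *\<^sub>R u = (- c * (b / a)) *\<^sub>R v"
        using ab by (simp add: scaleR_add_right eq_neg_iff_add_eq_0)
      moreover have "0 \<le> - c * (b / a)" using False ab by (intro mult_nonneg_nonneg) auto
      ultimately show ?thesis using v(1) mem_cone[OF assms(3), of v "- c * (b / a)"] by simp
    qed
    have "span {u} \<subseteq> C" using mC by (auto simp: span_singleton)
    then have "span {u} \<subseteq> {0}" using assms(4) unfolding acute_def by blast
    then show False using u(1) span_base[of u "{u}"] by auto
  qed
  show thesis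
  proof (cases "\<exists>u\<in>C - {0}. u$2$1 > 0")
    case True
    then have "1 * v$2$1 > 0" if "v \<in> C - {0}" for v using same nz[OF that] that by force
    then show ?thesis using that[of 1] by blast
  next
    case False
    then have "-1 * v$2$1 > 0" if "v \<in> C - {0}" for v using nz[OF that] that by force
    then show ?thesis using that[of "-1"] by blast
  qed
qed

lemma rot_form_scale: "rot_form (c *\<^sub>R v) (d * x) (d * y) = c * d\<^sup>2 * rot_form v x y"
  by (simp add: rot_form_def power2_eq_square algebra_simps)

text \<open>Homogeneity, of degree 1 in \<open>v\<close> and 2 in \<open>(x, y)\<close>, reduces the
  claim to unit vectors of \<open>C\<close> and of the plane, a compact set. Vectors of the plane
  are represented by complex numbers.\<close>

lemma rot_form_lower_bound:
  assumes C: "closed C" "cone C"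
    and pos: "\<And>v x y. v \<in> C - {0} \<Longrightarrow> x \<noteq> 0 \<or> y \<noteq> 0 \<Longrightarrow> e * rot_form v x y > 0"
  obtains k where "k > 0" "\<And>v x y. v \<in> C \<Longrightarrow> k * norm v * (x\<^sup>2 + y\<^sup>2) \<le> e * rot_form v x y"
proof -
  define K where "K = (C \<inter> sphere 0 1) \<times> (sphere 0 1 :: complex set)"
  have K: "compact K" unfolding K_def using C(1) by (intro compact_Times closed_Int_compact) auto
  define f where "f = (\<lambda>(v, z). e * rot_form v (Re z) (Im z))"
  have fc: "continuous_on K f"
    unfolding f_def case_prod_beta' rot_form_def by (intro continuous_intros)
  have fp: "f p > 0" if pK: "p \<in> K" for p
  proof -
    obtain v z where p: "p = (v, z)" "v \<in> C" "norm v = 1" "cmod z = 1" using pK by (cases p) (auto simp: K_def)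
    then have "z \<noteq> 0" by auto
    then have "v \<in> C - {0}" "Re z \<noteq> 0 \<or> Im z \<noteq> 0" using p by (auto simp: complex_eq_iff)
    then show ?thesis using pos p(1) by (simp add: f_def)
  qed
  obtain k where k: "k > 0" "\<And>p. p \<in> K \<Longrightarrow> k \<le> f p"
  proof (cases "K = {}")
    case False
    then obtain p where "p \<in> K" "\<And>q. q \<in> K \<Longrightarrow> f p \<le> f q"
      using continuous_attains_inf[OF K _ fc] by blast
    then show ?thesis using that[of "f p"] fp by blast
  qed (use that[of 1] in auto)
  show thesis
  proof (rule that[OF k(1)])
    fix v x y assume v: "v \<in> C"
    show "k * norm v * (x\<^sup>2 + y\<^sup>2) \<le> e * rot_form v x y"
    proof (cases "v = 0 \<or> (x = 0 \<and> y = 0)")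
      case True
      then show ?thesis by (auto simp: rot_form_def)
    next
      case False
      define z where "z = Complex x y"
      have z0: "z \<noteq> 0" using False by (auto simp: z_def complex_eq_iff)
      let ?v = "(1 / norm v) *\<^sub>R v" and ?z = "(1 / norm z) *\<^sub>R z"
      have "(?v, ?z) \<in> K"
        using False z0 v mem_cone[OF C(2) v, of "1 / norm v"] by (auto simp: K_def)
      then have "k \<le> e * rot_form ?v ((1 / norm z) * x) ((1 / norm z) * y)"
        using k(2)[of "(?v, ?z)"] by (simp add: f_def z_def)
      also have "\<dots> = e * ((1 / norm v) * (1 / norm z)\<^sup>2 * rot_form v x y)" by (simp only: rot_form_scale)
      finally have "k * (norm v * (norm z)\<^sup>2) \<le> e * rot_form v x y"
        using False z0 by (simp add: field_simps power2_eq_square)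
      then show ?thesis by (simp add: z_def cmod_power2 mult.assoc)
    qed
  qed
qed

text \<open>Cauchy-Schwarz in three variables. The factors \<open>sqrt 2\<close> split the mixed
  term so that the first sum of squares is the squared Frobenius norm, in which \<open>v$1$1\<close>
  counts twice.\<close>

lemma rot_form_upper_bound: 
  assumes "v \<in> sl2"
  shows "\<bar>rot_form v x y\<bar> \<le> norm v * (x\<^sup>2 + y\<^sup>2)"
proof -
  have v22: "v$2$2 = - v$1$1" using assms(1) by (simp add: sl2_iff)
  have "(rot_form v x y)\<^sup>2 \<le> ((norm v)\<^sup>2) * (x\<^sup>2 + y\<^sup>2)\<^sup>2"
  proof -
    have cs: "(a * x + b * y + c * z)\<^sup>2 \<le> (a\<^sup>2 + b\<^sup>2 + c\<^sup>2) * (x\<^sup>2 + y\<^sup>2 + z\<^sup>2)" for a b c x y z :: real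
      using zero_le_power2[of "a * y - b * x"] zero_le_power2[of "a * z - c * x"] zero_le_power2[of "b * z - c * y"]
      by (simp add: power2_eq_square algebra_simps)
    have "rot_form v x y = v$2$1 * x\<^sup>2 + (- v$1$2) * y\<^sup>2 + (sqrt 2 * v$1$1) * (- sqrt 2 * (x * y))"
      by (simp add: rot_form_def)
    then have "(rot_form v x y)\<^sup>2 \<le> ((v$2$1)\<^sup>2 + (- v$1$2)\<^sup>2 + (sqrt 2 * v$1$1)\<^sup>2) * ((x\<^sup>2)\<^sup>2 + (y\<^sup>2)\<^sup>2 + (- sqrt 2 * (x * y))\<^sup>2)"
      using cs by metis
    also have "\<dots> = ((norm v)\<^sup>2) * (x\<^sup>2 + y\<^sup>2)\<^sup>2"
      unfolding norm_mat22 v22 by (simp add: power_mult_distrib) (simp add: power2_eq_square power4_eq_xxxx algebra_simps)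
    finally show ?thesis .
  qed
  then have "\<bar>rot_form v x y\<bar>\<^sup>2 \<le> (norm v * (x\<^sup>2 + y\<^sup>2))\<^sup>2" by (simp add: power_mult_distrib)
  then show ?thesis by (rule power2_le_imp_le) simp
qed

section \<open>Angles of columns and the clock on the universal cover\<close>

lemma Gt_column:
  assumes "(A, \<theta>) \<in> Gt"
  shows "Complex (A$1$1) (A$2$1) = cmod (Complex (A$1$1) (A$2$1)) * cis \<theta>" "Complex (A$1$1) (A$2$1) \<noteq> 0"
proof -
  obtain r where r: "r > 0" "A$1$1 = r * cos \<theta>" "A$2$1 = r * sin \<theta>"
    using assms by (auto simp: Gt_def)
  have *: "Complex (A$1$1) (A$2$1) = r * cis \<theta>" by (simp add: r complex_eq_iff)
  then have "cmod (Complex (A$1$1) (A$2$1)) = r" using r(1) by (simp add: norm_mult)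
  with * show "Complex (A$1$1) (A$2$1) = cmod (Complex (A$1$1) (A$2$1)) * cis \<theta>" by simp
  show "Complex (A$1$1) (A$2$1) \<noteq> 0" using * r(1) by (metis cis_neq_zero mult_eq_0_iff of_real_eq_0_iff less_irrefl)
qed

text \<open>The existential positive radius becomes an equation, which is a closed condition;
  positivity is recovered because determinant 1 excludes a zero column.\<close>

lemma Gt_iff: "(A, \<theta>) \<in> Gt \<longleftrightarrow> det A = 1 \<and> Complex (A$1$1) (A$2$1) = cmod (Complex (A$1$1) (A$2$1)) * cis \<theta>"
proof
  assume R: "det A = 1 \<and> Complex (A$1$1) (A$2$1) = cmod (Complex (A$1$1) (A$2$1)) * cis \<theta>"
  define r where "r = cmod (Complex (A$1$1) (A$2$1))"
  have R2: "Complex (A$1$1) (A$2$1) = r * cis \<theta>" using R unfolding r_def by simp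
  have "A$1$1 = r * cos \<theta>" "A$2$1 = r * sin \<theta>"
    using arg_cong[OF R2, of Re] arg_cong[OF R2, of Im] by simp_all
  moreover have "r > 0"
  proof (rule ccontr)
    assume "\<not> r > 0"
    then have "A$1$1 = 0" "A$2$1 = 0" by (simp_all add: r_def complex_eq_iff)
    then show False using R by (simp add: det_2)
  qed
  ultimately show "(A, \<theta>) \<in> Gt" using R by (auto simp: Gt_def)
qed (use Gt_column in \<open>auto simp: Gt_def\<close>)

text \<open>The vector \<open>A\<^sup>-\<^sup>1 e\<^sub>1\<close>, read as a complex number.\<close>

definition inv_col :: "real^2^2 \<Rightarrow> complex" where
  "inv_col A = Complex (A$2$2) (- A$2$1)"

text \<open>A time function on the universal cover: minus a continuous choice of the argument of \<open>A\<^sup>-\<^sup>1 e\<^sub>1\<close>.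
  It is continuous because \<open>A\<^sup>-\<^sup>1 e\<^sub>1\<close> is never a negative multiple of \<open>cis (- \<theta>)\<close>, as
  \<open>cis \<theta>\<close> is the direction of \<open>A e\<^sub>1\<close>.\<close>

definition clock :: "(real^2^2) \<times> real \<Rightarrow> real" where
  "clock g = snd g - Arg (inv_col (fst g) * cis (snd g))"

lemma inv_col_nonzero: "det A = 1 \<Longrightarrow> inv_col A \<noteq> 0"
  by (auto simp: inv_col_def complex_eq_iff det_2)

text \<open>Up to a positive factor, \<open>cis \<theta>\<close> is the first column of
  \<open>A\<close>. Its product with \<open>inv_col A\<close> has real part
  \<open>A$1$1 * A$2$2 + (A$2$1)^2\<close> and imaginary part
  \<open>A$2$1 * (A$2$2 - A$1$1)\<close>, which under \<open>det A = 1\<close> never give a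
  nonpositive real number.\<close>

lemma inv_col_cis_slit:
  assumes "(A, \<theta>) \<in> Gt"
  shows "inv_col A * cis \<theta> \<notin> \<real>\<^sub>\<le>\<^sub>0"
proof
  assume neg: "inv_col A * cis \<theta> \<in> \<real>\<^sub>\<le>\<^sub>0"
  obtain r where r: "r > 0" "A$1$1 = r * cos \<theta>" "A$2$1 = r * sin \<theta>" and det: "det A = 1"
    using assms by (auto simp: Gt_def)
  define z where "z = inv_col A * Complex (A$1$1) (A$2$1)"
  have "Complex (A$1$1) (A$2$1) = r * cis \<theta>" by (simp add: r complex_eq_iff)
  then have z: "z = r * (inv_col A * cis \<theta>)" by (simp add: z_def mult_ac)
  have "Re (inv_col A * cis \<theta>) \<le> 0" "Im (inv_col A * cis \<theta>) = 0"
    using neg by (auto simp: complex_nonpos_Reals_iff)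
  then have "Re z \<le> 0" "Im z = 0" using r(1) unfolding z by (auto simp: mult_nonneg_nonpos)
  then have 1: "A$1$1 * A$2$2 + (A$2$1)\<^sup>2 \<le> 0" and 2: "A$2$1 * (A$2$2 - A$1$1) = 0"
    by (auto simp: z_def inv_col_def power2_eq_square algebra_simps)
  show False
  proof (cases "A$2$1 = 0")
    case True
    then show False using 1 det by (simp add: det_2)
  next
    case False
    then have "A$2$2 = A$1$1" using 2 by simp
    then have "(A$1$1)\<^sup>2 + (A$2$1)\<^sup>2 \<le> 0" using 1 by (simp add: power2_eq_square)
    then show False using False by (simp add: sum_power2_le_zero_iff)
  qed
qed

lemma inv_col_polar:
  assumes "(A, \<theta>) \<in> Gt"
  shows "inv_col A = cmod (inv_col A) * cis (- clock (A, \<theta>))"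
proof -
  let ?z = "inv_col A * cis \<theta>"
  have "?z \<noteq> 0" using assms inv_col_nonzero by (auto simp: Gt_def)
  then have "?z = cmod ?z * cis (Arg ?z)" by (metis rcis_cmod_Arg rcis_def)
  then have "inv_col A * cis \<theta> * cis (- \<theta>) = cmod (inv_col A) * cis (Arg ?z) * cis (- \<theta>)"
    by (simp add: norm_mult)
  then show ?thesis by (simp add: clock_def mult.assoc cis_mult)
qed

lemma continuous_on_clock:
  assumes "continuous_on S \<gamma>" "\<And>t. t \<in> S \<Longrightarrow> \<gamma> t \<in> Gt"
  shows "continuous_on S (\<lambda>t. clock (\<gamma> t))"
proof -
  have c: "continuous_on S (\<lambda>t. inv_col (fst (\<gamma> t)) * cis (snd (\<gamma> t)))"
    unfolding inv_col_def Complex_eq cis_conv_exp by (intro continuous_intros assms)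
  have "continuous_on S (\<lambda>t. Arg (inv_col (fst (\<gamma> t)) * cis (snd (\<gamma> t))))"
  proof (rule continuous_on_compose2[OF _ c])
    show "continuous_on (- \<real>\<^sub>\<le>\<^sub>0) Arg"
      by (intro continuous_at_imp_continuous_on ballI continuous_at_Arg) auto
    show "(\<lambda>t. inv_col (fst (\<gamma> t)) * cis (snd (\<gamma> t))) ` S \<subseteq> - \<real>\<^sub>\<le>\<^sub>0"
    proof (intro image_subsetI ComplI)
      fix t assume "t \<in> S" "inv_col (fst (\<gamma> t)) * cis (snd (\<gamma> t)) \<in> \<real>\<^sub>\<le>\<^sub>0"
      then show False using inv_col_cis_slit[of "fst (\<gamma> t)" "snd (\<gamma> t)"] assms(2)[of t] by simp
    qed
  qed
  then show ?thesis unfolding clock_def by (intro continuous_on_diff continuous_on_snd assms(1))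
qed

text \<open>On a compact interval \<open>z\<close> stays away from 0. For close parameters the angle
  difference is bounded by its tangent, a ratio of the parts of \<open>z s / z t\<close>; for
  distant ones boundedness of \<open>f\<close> is enough. The Lipschitz property lets the angle be
  recovered from its derivative.\<close>

lemma lipschitz_angle:
  fixes z :: "real \<Rightarrow> complex"
  assumes z: "L-lipschitz_on {0..T} z" and nz: "\<And>t. t \<in> {0..T} \<Longrightarrow> z t \<noteq> 0"
    and f: "continuous_on {0..T} f" and zf: "\<And>t. t \<in> {0..T} \<Longrightarrow> z t = cmod (z t) * cis (f t)"
  shows "\<exists>K. K-lipschitz_on {0..T} f"
proof (cases "{0..T} = {}")
  case False
  have cz: "continuous_on {0..T} z" by (rule lipschitz_on_continuous_on[OF z])
  have L0: "L \<ge> 0" by (rule lipschitz_on_nonneg[OF z])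
  obtain t0 where t0: "t0 \<in> {0..T}" "\<And>t. t \<in> {0..T} \<Longrightarrow> cmod (z t0) \<le> cmod (z t)"
    using continuous_attains_inf[OF compact_Icc False continuous_on_norm[OF cz]] by blast
  define m where "m = cmod (z t0)"
  have m: "m > 0" "\<And>t. t \<in> {0..T} \<Longrightarrow> m \<le> cmod (z t)" using t0 nz by (auto simp: m_def)
  obtain B where B: "\<And>t. t \<in> {0..T} \<Longrightarrow> \<bar>f t\<bar> \<le> B"
    using compact_imp_bounded[OF compact_continuous_image[OF f compact_Icc]] unfolding bounded_iff real_norm_def by blast
  have B0: "B \<ge> 0" using B[OF t0(1)] by auto
  obtain d1 where d1: "d1 > 0" "\<And>s t. s \<in> {0..T} \<Longrightarrow> t \<in> {0..T} \<Longrightarrow> \<bar>s - t\<bar> < d1 \<Longrightarrow> \<bar>f s - f t\<bar> < 1"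
    using compact_uniformly_continuous[OF f] unfolding uniformly_continuous_on_def dist_real_def
    by (metis compact_Icc zero_less_one)
  \<comment> \<open>The first bound keeps the angle difference below 1; the second keeps
    \<open>z s / z t\<close> within 1/2 of 1, hence its real part at least 1/2.\<close>
  define d where "d = min d1 (m / (2 * (L + 1)))"
  have d: "d > 0" using d1 m L0 by (simp add: d_def)
  have near: "\<bar>f s - f t\<bar> \<le> 2 * L / m * \<bar>s - t\<bar>" if st: "s \<in> {0..T}" "t \<in> {0..T}" "\<bar>s - t\<bar> < d" for s t
  proof -
    define x where "x = f s - f t"
    define r where "r = cmod (z s) / cmod (z t)"
    have x1: "\<bar>x\<bar> < 1" using d1(2)[OF st(1,2)] st(3) by (simp add: x_def d_def)
    have pi2: "\<bar>x\<bar> < pi / 2" using x1 pi_gt3 by simp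
    have q: "z s / z t = r * cis x"
      using zf[OF st(1)] zf[OF st(2)] by (metis (no_types, lifting) cis_divide of_real_divide r_def times_divide_times_eq x_def)
    have "cmod (z s / z t - 1) = cmod (z s - z t) / cmod (z t)"
      using nz[OF st(2)] by (metis diff_divide_distrib divide_self norm_divide)
    also have "\<dots> \<le> (L * \<bar>s - t\<bar>) / m"
      using lipschitz_onD[OF z st(1,2)] m(1) m(2)[OF st(2)] L0 by (intro frac_le) (auto simp: dist_norm)
    finally have le: "cmod (z s / z t - 1) \<le> L * \<bar>s - t\<bar> / m" .
    have "L * \<bar>s - t\<bar> \<le> (L + 1) * (m / (2 * (L + 1)))"
      using st(3) L0 by (intro mult_mono) (auto simp: d_def)
    also have "(L + 1) * (m / (2 * (L + 1))) = m / 2" using L0 by (simp add: field_simps)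
    finally have "L * \<bar>s - t\<bar> / m \<le> 1 / 2" using m(1) by (simp add: field_simps)
    then have half: "cmod (z s / z t - 1) \<le> 1 / 2" using le by linarith
    have "\<bar>r * cos x - 1\<bar> \<le> 1 / 2" using half abs_Re_le_cmod[of "z s / z t - 1"] by (simp add: q)
    then have re: "r * cos x \<ge> 1 / 2" unfolding abs_le_iff by linarith
    have im: "\<bar>r * sin x\<bar> \<le> L * \<bar>s - t\<bar> / m" using le abs_Im_le_cmod[of "z s / z t - 1"] by (simp add: q)
    have "\<bar>x\<bar> \<le> \<bar>tan x\<bar>" by (rule abs_tan_ge[OF pi2])
    also have "tan x = (r * sin x) / (r * cos x)" using re by (auto simp: tan_def)
    also have "\<bar>(r * sin x) / (r * cos x)\<bar> \<le> (L * \<bar>s - t\<bar> / m) / (1 / 2)"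
      unfolding abs_divide using im re by (intro frac_le) auto
    finally show ?thesis by (simp add: x_def mult_ac)
  qed
  define K where "K = max (2 * L / m) (2 * B / d)"
  have "K-lipschitz_on {0..T} f"
  proof (rule lipschitz_onI)
    show "0 \<le> K" using L0 m by (simp add: K_def le_max_iff_disj)
    fix s t assume st: "s \<in> {0..T}" "t \<in> {0..T}"
    show "dist (f s) (f t) \<le> K * dist s t"
    proof (cases "\<bar>s - t\<bar> < d")
      case True
      have "\<bar>f s - f t\<bar> \<le> 2 * L / m * \<bar>s - t\<bar>" by (rule near[OF st True])
      also have "\<dots> \<le> K * \<bar>s - t\<bar>" by (intro mult_right_mono) (auto simp: K_def)
      finally show ?thesis by (simp add: dist_real_def)
    next
      case False
      have "\<bar>f s - f t\<bar> \<le> 2 * B" using B[OF st(1)] B[OF st(2)] by linarith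
      also have "\<dots> = 2 * B / d * d" using d by simp
      also have "\<dots> \<le> K * \<bar>s - t\<bar>"
        using False B0 d by (intro mult_mono) (auto simp: K_def le_max_iff_disj)
      finally show ?thesis by (simp add: dist_real_def)
    qed
  qed
  then show ?thesis by blast
qed (auto intro: lipschitz_on_empty)

text \<open>Near \<open>t\<close> continuity keeps \<open>f s - f t\<close> between
  \<open>- pi\<close> and \<open>pi\<close>, so it is the principal argument of
  \<open>z s / z t\<close>, the imaginary part of a logarithm that is smooth near 1.\<close>

lemma angle_derivative:
  fixes z :: "real \<Rightarrow> complex"
  assumes z: "(z has_vector_derivative z') (at t)" and nz: "\<And>s. s \<in> S \<Longrightarrow> z s \<noteq> 0" and S: "open S" "t \<in> S"
    and f: "continuous_on S f" and zf: "\<And>s. s \<in> S \<Longrightarrow> z s = cmod (z s) * cis (f s)"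
  shows "(f has_vector_derivative Im (z' / z t)) (at t)"
proof -
  have "((\<lambda>s. z s / z t) has_vector_derivative z' / z t) (at t)"
    using bounded_linear.has_vector_derivative[OF bounded_linear_mult_right z, of "inverse (z t)"]
    by (simp add: divide_inverse mult.commute)
  moreover have "(Ln has_field_derivative 1) (at (z t / z t))"
    using nz[OF S(2)] has_field_derivative_Ln[of 1] by simp
  ultimately have "((\<lambda>s. Ln (z s / z t)) has_vector_derivative z' / z t) (at t)"
    using field_vector_diff_chain_at[of "\<lambda>s. z s / z t" "z' / z t" t Ln 1] by (simp add: o_def)
  then have "((\<lambda>s. f t + Im (Ln (z s / z t))) has_vector_derivative Im (z' / z t)) (at t)"
    using bounded_linear.has_vector_derivative[OF bounded_linear_Im] by (auto intro!: derivative_eq_intros)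
  moreover obtain d where d: "d > 0" "ball t d \<subseteq> S" "\<And>s. s \<in> ball t d \<Longrightarrow> \<bar>f s - f t\<bar> < pi"
  proof -
    obtain d1 where d1: "d1 > 0" "ball t d1 \<subseteq> S" using S by (meson open_contains_ball)
    have "isCont f t" using f S continuous_on_eq_continuous_at by blast
    then obtain d2 where d2: "d2 > 0" "\<And>s. dist s t < d2 \<Longrightarrow> dist (f s) (f t) < pi"
      unfolding continuous_at_eps_delta dist_real_def using pi_gt_zero by blast
    show ?thesis
    proof (rule that[of "min d1 d2"])
      fix s assume "s \<in> ball t (min d1 d2)"
      then show "\<bar>f s - f t\<bar> < pi" using d2(2)[of s] by (simp add: dist_real_def dist_commute abs_minus_commute)
    qed (use d1 d2 in auto)
  qed
  ultimately show ?thesis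
  proof (rule_tac has_vector_derivative_transform_within_open[of _ _ _ "ball t d"])
    fix s assume s: "s \<in> ball t d"
    have sS: "s \<in> S" using s d by blast
    show "f t + Im (Ln (z s / z t)) = f s"
    proof -
      have False: "z s \<noteq> 0" by (rule nz[OF sS])
      have "z s / z t = (cmod (z s) / cmod (z t)) * cis (f s - f t)"
        using zf[OF sS] zf[OF S(2)] by (metis (no_types, lifting) cis_divide of_real_divide times_divide_times_eq)
      then have "Arg (z s / z t) = f s - f t"
        using False nz[OF S(2)] d(3)[OF s]
        by (intro Arg_unique'[of "cmod (z s) / cmod (z t)"]) (auto simp: rcis_def abs_less_iff)
      then show ?thesis using False nz[OF S(2)] by (simp add: Arg_eq_Im_Ln)
    qed
  qed auto
qed

text \<open>Jensen's inequality in geometric form: a functional bounded below on a cone is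
  nonnegative on it, so separation contradicts the sign of its integral. It is applied to
  \<open>C\<close> and to the hypograph of the anti-norm.\<close>

lemma integral_in_closed_convex_cone:
  fixes f :: "real \<Rightarrow> 'a::euclidean_space"
  assumes D: "closed D" "convex D" "cone D" "D \<noteq> {}" and f: "(f has_integral i) {a..b}"
    and N: "negligible N" and fD: "\<And>t. t \<in> {a..b} - N \<Longrightarrow> f t \<in> D"
  shows "i \<in> D"
proof (rule ccontr)
  assume "i \<notin> D"
  then obtain c d where cd: "inner c i < d" "\<And>x. x \<in> D \<Longrightarrow> inner c x > d"
    using separating_hyperplane_closed_point[OF D(2,1)] by blast
  have "0 \<in> D" using cone_contains_0[OF D(3)] D(4) by blast
  then have d: "d < 0" using cd(2)[of 0] by simp
  have nn: "inner c x \<ge> 0" if x: "x \<in> D" for x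
  proof (rule ccontr)
    assume "\<not> inner c x \<ge> 0"
    then have neg: "inner c x < 0" by simp
    have "(d / inner c x) *\<^sub>R x \<in> D" using x neg d by (intro mem_cone[OF D(3)]) (auto simp: divide_nonpos_neg)
    from cd(2)[OF this] neg show False by simp
  qed
  have "((\<lambda>t. inner c (f t)) has_integral inner c i) {a..b}"
    using has_integral_linear[OF f bounded_linear_inner_right[of c]] by (simp add: o_def)
  then have "((\<lambda>t. if t \<in> N then 0 else inner c (f t)) has_integral inner c i) {a..b}"
    by (rule has_integral_spike[OF N, rotated]) auto
  then have "0 \<le> inner c i"
    by (rule has_integral_nonneg) (use nn fD in auto)
  then show False using cd(1) d by simp
qed

lemma has_vector_derivative_entry:
  fixes A :: "real \<Rightarrow> real^2^2"
  assumes "(A has_vector_derivative A') F"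
  shows "((\<lambda>t. A t$i$j) has_vector_derivative A'$i$j) F"
  using bounded_linear.has_vector_derivative[OF bounded_linear_compose[OF bounded_linear_vec_nth[of j] bounded_linear_vec_nth[of i]] assms] .

text \<open>The angular speed of a plane vector is the determinant of the vector and its derivative
  over its squared length; for \<open>A e1\<close> and \<open>A u e1\<close> that determinant is
  \<open>det A * u$2$1\<close>.\<close>

lemma column_derivative:
  fixes A :: "real \<Rightarrow> real^2^2"
  assumes "(A has_vector_derivative (A t ** u)) (at t)" "det (A t) = 1"
  shows "((\<lambda>s. Complex (A s$1$1) (A s$2$1)) has_vector_derivative Complex ((A t ** u)$1$1) ((A t ** u)$2$1)) (at t)"
    "Im (Complex ((A t ** u)$1$1) ((A t ** u)$2$1) / Complex (A t$1$1) (A t$2$1)) = u$2$1 / (cmod (Complex (A t$1$1) (A t$2$1)))\<^sup>2"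
proof -
  show "((\<lambda>s. Complex (A s$1$1) (A s$2$1)) has_vector_derivative Complex ((A t ** u)$1$1) ((A t ** u)$2$1)) (at t)"
    using has_vector_derivative_entry[OF assms(1)]
    by (simp add: has_vector_derivative_complex_iff has_real_derivative_iff_has_vector_derivative)
  have "A t$1$1 * (A t ** u)$2$1 - A t$2$1 * (A t ** u)$1$1 = det (A t) * u$2$1"
    by (simp add: mat22_mult det_2 algebra_simps)
  then show "Im (Complex ((A t ** u)$1$1) ((A t ** u)$2$1) / Complex (A t$1$1) (A t$2$1)) = u$2$1 / (cmod (Complex (A t$1$1) (A t$2$1)))\<^sup>2"
    using assms(2) by (simp add: Im_divide cmod_power2 algebra_simps)
qed

text \<open>A trace-free \<open>u\<close> has adjugate \<open>- u\<close>, so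
  \<open>w = A^-1 e1\<close> moves by \<open>w' = - u w\<close>, and its angular speed is minus
  \<open>rot_form u\<close> at \<open>w\<close> over the squared length of \<open>w\<close>.\<close>

lemma inv_col_derivative:
  fixes A :: "real \<Rightarrow> real^2^2"
  assumes "(A has_vector_derivative (A t ** u)) (at t)" "u \<in> sl2"
  shows "((\<lambda>s. inv_col (A s)) has_vector_derivative inv_col (A t ** u)) (at t)"
    "Im (inv_col (A t ** u) / inv_col (A t)) = - rot_form u (Re (inv_col (A t))) (Im (inv_col (A t))) / (cmod (inv_col (A t)))\<^sup>2"
proof -
  show "((\<lambda>s. inv_col (A s)) has_vector_derivative inv_col (A t ** u)) (at t)"
    unfolding has_vector_derivative_complex_iff inv_col_def
    using has_vector_derivative_entry[OF assms(1)]
    by (auto intro!: has_vector_derivative_minus simp: has_real_derivative_iff_has_vector_derivative)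
  have "u$2$2 = - u$1$1" using assms(2) by (simp add: sl2_iff)
  then show "Im (inv_col (A t ** u) / inv_col (A t)) = - rot_form u (Re (inv_col (A t))) (Im (inv_col (A t))) / (cmod (inv_col (A t)))\<^sup>2"
    unfolding Im_divide cmod_power2
    by (simp add: inv_col_def mat22_mult rot_form_def) (simp add: power2_eq_square algebra_simps)
qed

lemma norm_det1_ge_1:
  fixes A :: "real^2^2"
  assumes "det A = 1" shows "1 \<le> norm A"
proof -
  have "2 * det A \<le> (norm A)\<^sup>2"
    using zero_le_power2[of "A$1$1 - A$2$2"] zero_le_power2[of "A$1$2 + A$2$1"]
    unfolding norm_mat22 det_2 by (simp add: power2_eq_square algebra_simps)
  then have "1\<^sup>2 \<le> (norm A)\<^sup>2" using assms by simp
  then show ?thesis by (rule power2_le_imp_le) simp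
qed

text \<open>Hadamard's inequality: the product of the column lengths is at least 1. It bounds the
  speed of \<open>\<theta>\<close>, which has the squared column length in its denominator.\<close>

lemma column_lower_bound:
  fixes A :: "real^2^2"
  assumes "det A = 1" "norm A \<le> M"
  shows "1 / M\<^sup>2 \<le> (cmod (Complex (A$1$1) (A$2$1)))\<^sup>2"
proof -
  let ?p = "(cmod (Complex (A$1$1) (A$2$1)))\<^sup>2" and ?q = "(A$1$2)\<^sup>2 + (A$2$2)\<^sup>2"
  have M: "M \<ge> 1" using norm_det1_ge_1[OF assms(1)] assms(2) by simp
  have "(det A)\<^sup>2 \<le> ?p * ?q"
    using zero_le_power2[of "A$1$1 * A$1$2 + A$2$1 * A$2$2"]
    unfolding det_2 cmod_power2 by (simp add: power2_eq_square algebra_simps)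
  also have "\<dots> \<le> ?p * M\<^sup>2"
  proof (rule mult_left_mono)
    have "?q \<le> (norm A)\<^sup>2" unfolding norm_mat22 by simp
    also have "\<dots> \<le> M\<^sup>2" using assms(2) by (intro power_mono) auto
    finally show "?q \<le> M\<^sup>2" .
  qed simp
  finally show ?thesis using assms(1) M by (simp add: divide_le_eq)
qed

lemma lipschitz_derivative_norm_le:
  fixes f :: "real \<Rightarrow> 'a::real_normed_vector"
  assumes L: "L-lipschitz_on {a..b} f" and t: "a < t" "t < b" and d: "(f has_vector_derivative D) (at t)"
  shows "norm D \<le> L"
proof (rule tendsto_upperbound)
  show "((\<lambda>s. norm ((f s - f t) /\<^sub>R (s - t))) \<longlongrightarrow> norm D) (at t)"
    using d unfolding has_vector_derivative_iff_quotient by (rule tendsto_norm)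
  have "eventually (\<lambda>s. s \<in> {a<..<b}) (at t)" using t by (intro eventually_at_in_open') auto
  moreover have "eventually (\<lambda>s. s \<noteq> t) (at t)" by (simp add: eventually_at_filter)
  ultimately show "\<forall>\<^sub>F s in at t. norm ((f s - f t) /\<^sub>R (s - t)) \<le> L"
  proof eventually_elim
    case (elim s)
    then have "norm (f s - f t) \<le> L * \<bar>s - t\<bar>"
      using lipschitz_onD[OF L, of s t] t by (auto simp: dist_norm)
    moreover have "norm ((f s - f t) /\<^sub>R (s - t)) = norm (f s - f t) / \<bar>s - t\<bar>"
      by (simp add: divide_inverse mult.commute)
    ultimately show ?case using elim(2) by (simp add: divide_le_eq)
  qed
qed simp

section \<open>Curves parametrized by the clock\<close>

type_synonym arc_point = "((real^2^2) \<times> real) \<times> ((real^2^2) \<times> real)"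

text \<open>What the analysis uses of the Killing form and the anti-norm: \<open>e\<close> is the
  sense of rotation, \<open>k\<close> the least rotation rate per unit speed, and \<open>B\<close>
  bounds the anti-norm on unit vectors. \<open>nu\<close> is real-valued here, since the anti-norm
  is finite on \<open>C\<close>.\<close>

locale timelike_cone =
  fixes C :: "(real^2^2) set" and nu :: "real^2^2 \<Rightarrow> real" and e k B :: real
  assumes C_sl2: "C \<subseteq> sl2" and C_closed: "closed C" and C_convex: "convex C" and C_cone: "cone C"
    and e: "e = 1 \<or> e = -1" and k: "k > 0" and B: "B \<ge> 0"
    and rot_lower: "\<And>v x y. v \<in> C \<Longrightarrow> k * norm v * (x\<^sup>2 + y\<^sup>2) \<le> e * rot_form v x y"
    and norm_tau: "\<And>v. v \<in> C \<Longrightarrow> norm v \<le> e * (v$2$1 - v$1$2)"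
    and nu_nonneg: "\<And>v. v \<in> C \<Longrightarrow> 0 \<le> nu v" and nu_le: "\<And>v. v \<in> C \<Longrightarrow> nu v \<le> B * norm v"
    and nu_add: "\<And>v w. v \<in> C \<Longrightarrow> w \<in> C \<Longrightarrow> nu v + nu w \<le> nu (v + w)"
    and nu_scale: "\<And>v c. v \<in> C \<Longrightarrow> c > 0 \<Longrightarrow> nu (c *\<^sub>R v) = c * nu v"
    and nu_borel: "(\<lambda>v. if v \<in> sl2 then nu v else 0) \<in> borel_measurable borel"
    and hypo_closed: "closed {(v, r). v \<in> C \<and> r \<le> nu v}"
begin

definition len :: "real \<Rightarrow> (real \<Rightarrow> (real^2^2) \<times> real) \<Rightarrow> real" where
  "len T \<gamma> = (LINT t:{0..T}|lborel. nu (matrix_inv (fst (\<gamma> t)) ** vector_derivative (\<lambda>s. fst (\<gamma> s)) (at t)))"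

text \<open>A step of clock time \<open>d\<close> of a curve \<open>(A, \<theta>)\<close>, of the integral \<open>U\<close> of its velocity \<open>A\<^sup>-\<^sup>1 A'\<close> and of its
  length \<open>l\<close>. The conditions are closed under pointwise limits, and at points of differentiability
  they force \<open>A' = A U'\<close>, \<open>U' \<in> C - {0}\<close> and \<open>l' \<le> nu U'\<close>.\<close>

fun controlled :: "real \<Rightarrow> real \<Rightarrow> arc_point \<Rightarrow> arc_point \<Rightarrow> bool" where
  "controlled K d ((A, \<theta>), (U, l)) ((A', \<theta>'), (U', l')) \<longleftrightarrow>
     norm (A' - A) \<le> K * d \<and> \<bar>\<theta>' - \<theta>\<bar> \<le> K * d \<and> norm (U' - U) \<le> K * d \<and> \<bar>l' - l\<bar> \<le> K * d \<and>
     U' - U \<in> C \<and> d \<le> e * ((U' - U)$2$1 - (U' - U)$1$2) \<and>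
     norm (A' - A - A ** (U' - U)) \<le> K * d\<^sup>2 \<and> 0 \<le> l' - l \<and> l' - l \<le> nu (U' - U)"

declare controlled.simps [simp del]

text \<open>\<open>a\<close> is the norm of the initial matrix and \<open>M\<close> the bound that
  Gronwall's inequality gives along the curve, the integral of \<open>|u|\<close> being at most
  \<open>S / k\<close>. The five summands serve, in this order, the increments of \<open>A\<close>,
  \<open>\<theta>\<close>, \<open>U\<close>, \<open>l\<close> and the second-order error.\<close>

definition bound_const :: "real \<Rightarrow> real \<Rightarrow> real" where
  "bound_const a S = (let M = a * exp (S / k) in M / k + M\<^sup>2 / k + 1 / k + B / k + M / k\<^sup>2)"

lemma C_0: "v \<in> C \<Longrightarrow> 0 \<in> C"
  using C_cone cone_contains_0 by blast

lemma nu_0: "v \<in> C \<Longrightarrow> nu 0 = 0"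
  using nu_le[OF C_0] nu_nonneg[OF C_0] by fastforce

lemma C_add: "v \<in> C \<Longrightarrow> w \<in> C \<Longrightarrow> v + w \<in> C"
  using C_convex C_cone convex_cone by blast

lemma hypo_convex_cone:
  "convex {(v, r). v \<in> C \<and> r \<le> nu v}" "cone {(v, r). v \<in> C \<and> r \<le> nu v}"
proof -
  show co: "cone {(v, r). v \<in> C \<and> r \<le> nu v}"
    unfolding cone_def
  proof (intro ballI allI impI)
    fix x :: "(real^2^2) \<times> real" and c :: real assume x: "x \<in> {(v, r). v \<in> C \<and> r \<le> nu v}" and c: "0 \<le> c"
    obtain v r where vr: "x = (v, r)" "v \<in> C" "r \<le> nu v" using x by auto
    show "c *\<^sub>R x \<in> {(v, r). v \<in> C \<and> r \<le> nu v}"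
    proof (cases "c = 0")
      case True
      then show ?thesis using vr C_0 nu_0 by simp
    next
      case False
      then show ?thesis using vr c mem_cone[OF C_cone vr(2) c] nu_scale[OF vr(2)] by (auto simp: mult_left_mono)
    qed
  qed
  show "convex {(v, r). v \<in> C \<and> r \<le> nu v}"
  proof (rule convexI)
    fix x y and a b :: real
    assume xy: "x \<in> {(v, r). v \<in> C \<and> r \<le> nu v}" "y \<in> {(v, r). v \<in> C \<and> r \<le> nu v}" and ab: "0 \<le> a" "0 \<le> b"
    obtain v r w q where ax: "a *\<^sub>R x = (v, r)" and bx: "b *\<^sub>R y = (w, q)" by (metis surj_pair)
    have "v \<in> C" "r \<le> nu v" "w \<in> C" "q \<le> nu w"
      using mem_cone[OF co xy(1) ab(1)] mem_cone[OF co xy(2) ab(2)] unfolding ax bx by auto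
    then show "a *\<^sub>R x + b *\<^sub>R y \<in> {(v, r). v \<in> C \<and> r \<le> nu v}"
      unfolding ax bx using nu_add[of v w] C_add[of v w] by simp
  qed
qed

text \<open>All estimates are made in terms of \<open>J\<close>, the integral of the norm of the
  velocity; the inequalities \<open>k * J \<le> \<sigma> \<le> J\<close> then convert them to clock
  time.\<close>

lemma admissible_controlled:
  assumes adm: "admissible C x0 x1 T \<gamma>"
  defines "S \<equiv> e * (clock x1 - clock x0)"
  shows "S > 0" "\<exists>U l. U 0 = 0 \<and> l 0 = 0 \<and> l T = len T \<gamma> \<and>
     (\<forall>s t. 0 \<le> s \<and> s \<le> t \<and> t \<le> T \<longrightarrow>
        0 \<le> e * (clock (\<gamma> t) - clock (\<gamma> s)) \<and>
        controlled (bound_const (norm (fst x0)) S) (e * (clock (\<gamma> t) - clock (\<gamma> s))) (\<gamma> s, U s, l s) (\<gamma> t, U t, l t))"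
proof -
  define A where "A t = fst (\<gamma> t)" for t
  define \<theta> where "\<theta> t = snd (\<gamma> t)" for t
  have \<gamma>: "\<gamma> t = (A t, \<theta> t)" for t by (simp add: A_def \<theta>_def)
  obtain L where T: "0 < T" and L: "L-lipschitz_on {0..T} \<gamma>" and Gt: "\<And>t. t \<in> {0..T} \<Longrightarrow> (A t, \<theta> t) \<in> Gt"
    and ends: "\<gamma> 0 = x0" "\<gamma> T = x1"
    and ae: "AE t in lborel. t \<in> {0..T} \<longrightarrow> A differentiable (at t) \<and>
        matrix_inv (A t) ** vector_derivative A (at t) \<in> C - {0}"
    using adm unfolding admissible_def A_def[abs_def] \<theta>_def by auto
  have LA: "L-lipschitz_on {0..T} A"
  proof (rule lipschitz_onI)
    fix s t assume "s \<in> {0..T}" "t \<in> {0..T}"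
    then show "dist (A s) (A t) \<le> L * dist s t"
      using lipschitz_onD[OF L] dist_fst_le[of "\<gamma> s" "\<gamma> t"] unfolding A_def by (meson order_trans)
  qed (rule lipschitz_on_nonneg[OF L])
  have L0: "L \<ge> 0" by (rule lipschitz_on_nonneg[OF L])
  have cA: "continuous_on {0..T} A" by (rule lipschitz_on_continuous_on[OF LA])
  have c\<gamma>: "continuous_on {0..T} \<gamma>" by (rule lipschitz_on_continuous_on[OF L])
  have c\<theta>: "continuous_on {0..T} \<theta>" unfolding \<theta>_def by (intro continuous_intros c\<gamma>)
  have det: "det (A t) = 1" if "t \<in> {0..T}" for t using Gt[OF that] by (simp add: Gt_def)
  define u where "u t = matrix_inv (A t) ** vector_derivative A (at t)" for t
  obtain N0 where N0: "N0 \<in> null_sets lborel" "{t. \<not> (t \<in> {0..T} \<longrightarrow> A differentiable (at t) \<and> u t \<in> C - {0})} \<subseteq> N0"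
    using ae unfolding eventually_ae_filter u_def by auto
  define N where "N = N0 \<union> {0, T}"
  have "negligible N0" unfolding negligible_iff_null_sets using N0(1) by (rule null_sets_completionI)
  then have N: "negligible N" by (simp add: N_def)
  have uC: "u t \<in> C - {0}" if "t \<in> {0..T} - N" for t using that N0(2) by (auto simp: N_def)
  have Au: "A t ** u t = vector_derivative A (at t)" if "t \<in> {0..T}" for t
    unfolding u_def by (rule matrix_inv_mult_cancel(2)[OF det[OF that]])
  have Ader: "(A has_vector_derivative A t ** u t) (at t)" if "t \<in> {0..T} - N" for t
  proof -
    have "A differentiable (at t)" using that N0(2) by (auto simp: N_def)
    then show ?thesis using Au[of t] that by (simp add: vector_derivative_works)
  qed
  \<comment> \<open>The velocity is set to 0 on the exceptional null set, so that it lies in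
    \<open>C\<close> at every time of the curve.\<close>
  define v where "v t = (if t \<in> N then 0 else u t)" for t
  obtain v0 where v0: "v0 \<in> C"
  proof -
    have "\<not> negligible {0..T}" using T negligible_interval(1)[of 0 T] by simp
    then have "\<not> {0..T} \<subseteq> N" using N negligible_subset by blast
    then show ?thesis using uC that by blast
  qed
  have vC: "v t \<in> C" if "t \<in> {0..T}" for t using uC[of t] that C_0[OF v0] by (auto simp: v_def)
  have vs: "v t \<in> sl2" if "t \<in> {0..T}" for t using vC[OF that] C_sl2 by blast
  have Adv: "(A has_vector_derivative A t ** v t) (at t)" if "t \<in> {0..T} - N" for t
    using Ader[OF that] that by (simp add: v_def)
  \<comment> \<open>\<open>A'\<close> is bounded by \<open>L\<close> and has an integral, so its
    product with the continuous matrix \<open>adjugate (A t)\<close>, which is \<open>v t\<close>,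
    is absolutely integrable.\<close>
  define A' where "A' t = (if t \<in> N then 0 else vector_derivative A (at t))" for t
  have A'ai: "A' absolutely_integrable_on {0..T}"
  proof (rule absolutely_integrable_integrable_bound[where g = "\<lambda>_. L"])
    have der: "(A has_vector_derivative A' t) (at t)" if "t \<in> {0..T} - N" for t
      using Ader[OF that] Au[of t] that by (simp add: A'_def)
    show "A' integrable_on {0..T}"
      using lipschitz_has_integral_derivative[OF LA _ N der] T by (auto simp: integrable_on_def)
    fix t assume t: "t \<in> {0..T}"
    show "norm (A' t) \<le> L"
    proof (cases "t \<in> N")
      case False
      then show ?thesis using lipschitz_derivative_norm_le[OF LA _ _ der[of t]] t by (auto simp: N_def)
    qed (use L0 in \<open>simp add: A'_def\<close>)
  qed auto
  have bil: "bilinear ((**) :: real^2^2 \<Rightarrow> real^2^2 \<Rightarrow> real^2^2)"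
    using bounded_bilinear_mat22_mult bilinear_conv_bounded_bilinear by blast
  have cadj: "continuous_on {0..T} (\<lambda>t. adjugate (A t))" by (intro continuous_intros cA)
  have "(\<lambda>t. adjugate (A t) ** A' t) absolutely_integrable_on {0..T}"
    using compact_imp_bounded[OF compact_continuous_image[OF cadj compact_Icc]] A'ai
    by (intro absolutely_integrable_bounded_measurable_product[OF bil] continuous_imp_measurable_on_sets_lebesgue cadj) auto
  moreover have "adjugate (A t) ** A' t = v t" if "t \<in> {0..T}" for t
    using matrix_inv_eq_adjugate[OF det[OF that]] bounded_bilinear.zero_right[OF bounded_bilinear_mat22_mult]
    by (auto simp: A'_def v_def u_def)
  ultimately have vai: "v absolutely_integrable_on {0..T}"
    by (metis (no_types, lifting) set_integrable_cong)
  then have vi: "v integrable_on {0..T}" and nvi: "(\<lambda>t. norm (v t)) integrable_on {0..T}"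
    using absolutely_integrable_on_def by blast+
  define U where "U t = integral {0..t} v" for t
  define J where "J s t = integral {s..t} (\<lambda>r. norm (v r))" for s t
  have sub: "{s..t} \<subseteq> {0..T}" if "0 \<le> s" "t \<le> T" for s t using that by auto
  have vU: "(v has_integral U t - U s) {s..t}" if "0 \<le> s" "s \<le> t" "t \<le> T" for s t
  proof -
    have "v integrable_on {0..t}" using that by (intro integrable_on_subinterval[OF vi]) auto
    from Henstock_Kurzweil_Integration.integral_combine[OF that(1,2) this] have "U t - U s = integral {s..t} v"
      by (simp add: U_def algebra_simps)
    moreover have "v integrable_on {s..t}" using that by (intro integrable_on_subinterval[OF vi]) auto
    ultimately show ?thesis by (simp add: has_integral_integral)
  qed
  have vJ: "((\<lambda>r. norm (v r)) has_integral J s t) {s..t}" if "0 \<le> s" "t \<le> T" for s t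
    unfolding J_def using that by (intro integrable_integral integrable_on_subinterval[OF nvi]) auto
  have J0: "0 \<le> J s t" if "0 \<le> s" "t \<le> T" for s t
    by (rule has_integral_nonneg[OF vJ[OF that]]) simp
  have dA: "((\<lambda>r. A r ** v r) has_integral A t - A s) {s..t}" if st: "0 \<le> s" "s \<le> t" "t \<le> T" for s t
    by (rule lipschitz_has_integral_derivative[OF lipschitz_on_subset[OF LA sub[OF st(1,3)]] st(2) N])
      (use Adv st in auto)
  define z where "z t = inv_col (A t)" for t
  have Lz: "(2 * L)-lipschitz_on {0..T} z"
  proof (rule lipschitz_onI)
    fix s t assume st: "s \<in> {0..T}" "t \<in> {0..T}"
    have "cmod (z s - z t) \<le> \<bar>(A s - A t)$2$2\<bar> + \<bar>(A s - A t)$2$1\<bar>"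
      using cmod_le[of "z s - z t"] by (simp add: z_def inv_col_def)
    also have "\<dots> \<le> 2 * norm (A s - A t)"
      using norm_mat22_component_le[of "A s - A t" 2 2] norm_mat22_component_le[of "A s - A t" 2 1] by simp
    also have "\<dots> \<le> 2 * (L * dist s t)" using lipschitz_onD[OF LA st] by (simp add: dist_norm)
    finally show "dist (z s) (z t) \<le> 2 * L * dist s t" by (simp add: dist_norm)
  qed (use L0 in simp)
  have znz: "z t \<noteq> 0" if "t \<in> {0..T}" for t unfolding z_def by (rule inv_col_nonzero[OF det[OF that]])
  define c where "c t = - clock (A t, \<theta> t)" for t
  have cc: "continuous_on {0..T} c" unfolding c_def
    using continuous_on_clock[OF c\<gamma>] Gt by (intro continuous_intros) (simp add: \<gamma>)
  have zc: "z t = cmod (z t) * cis (c t)" if "t \<in> {0..T}" for t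
    unfolding z_def c_def by (rule inv_col_polar[OF Gt[OF that]])
  obtain Kc where Kc: "Kc-lipschitz_on {0..T} c" using lipschitz_angle[OF Lz znz cc zc] by blast
  have cc0: "continuous_on {0<..<T} c" by (rule continuous_on_subset[OF cc]) auto
  have c\<theta>0: "continuous_on {0<..<T} \<theta>" by (rule continuous_on_subset[OF c\<theta>]) auto
  have N0T: "t \<in> {0<..<T}" if "t \<in> {0..T} - N" for t using that by (auto simp: N_def)
  \<comment> \<open>Minus the angular speed of \<open>inv_col (A t)\<close>, hence the rate at which
    \<open>clock\<close> changes.\<close>
  define R where "R t = rot_form (v t) (Re (z t)) (Im (z t)) / (cmod (z t))\<^sup>2" for t
  have cder: "(c has_vector_derivative - R t) (at t)" if t: "t \<in> {0..T} - N" for t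
  proof -
    have "(z has_vector_derivative inv_col (A t ** v t)) (at t)"
      unfolding z_def using inv_col_derivative(1)[OF Adv[OF t] vs] t by auto
    from angle_derivative[OF this, of "{0<..<T}" c]
    have "(c has_vector_derivative Im (inv_col (A t ** v t) / z t)) (at t)"
      using znz zc N0T[OF t] cc0 by auto
    also have "Im (inv_col (A t ** v t) / z t) = - R t"
      unfolding z_def R_def using inv_col_derivative(2)[OF Adv[OF t] vs] t by auto
    finally show ?thesis .
  qed
  define \<sigma> where "\<sigma> s t = e * (clock (\<gamma> t) - clock (\<gamma> s))" for s t
  have R\<sigma>: "((\<lambda>r. e * R r) has_integral \<sigma> s t) {s..t}" if st: "0 \<le> s" "s \<le> t" "t \<le> T" for s t
  proof -
    have "((\<lambda>r. - R r) has_integral c t - c s) {s..t}"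
      by (rule lipschitz_has_integral_derivative[OF lipschitz_on_subset[OF Kc sub[OF st(1,3)]] st(2) N])
        (use cder st in auto)
    from has_integral_mult_right[OF this, of "- e"] show ?thesis
      by (simp add: \<sigma>_def c_def \<gamma> algebra_simps)
  qed
  have Rb: "k * norm (v t) \<le> e * R t" "e * R t \<le> norm (v t)" if t: "t \<in> {0..T}" for t
  proof -
    have p: "(cmod (z t))\<^sup>2 > 0" using znz[OF t] by simp
    have "k * norm (v t) * (cmod (z t))\<^sup>2 \<le> e * rot_form (v t) (Re (z t)) (Im (z t))"
      using rot_lower[OF vC[OF t]] by (simp add: cmod_power2)
    then show "k * norm (v t) \<le> e * R t" using p by (simp add: R_def field_simps)
    have "e * rot_form (v t) (Re (z t)) (Im (z t)) \<le> \<bar>rot_form (v t) (Re (z t)) (Im (z t))\<bar>" using e by auto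
    also have "\<dots> \<le> norm (v t) * (cmod (z t))\<^sup>2" using rot_form_upper_bound[OF vs[OF t]] by (simp add: cmod_power2)
    finally show "e * R t \<le> norm (v t)" using p by (simp add: R_def field_simps)
  qed
  have \<sigma>J: "k * J s t \<le> \<sigma> s t" "\<sigma> s t \<le> J s t" if st: "0 \<le> s" "s \<le> t" "t \<le> T" for s t
  proof -
    show "k * J s t \<le> \<sigma> s t"
      by (rule has_integral_le[OF has_integral_mult_right[OF vJ[OF st(1,3)]] R\<sigma>[OF st]]) (use Rb(1) st in auto)
    show "\<sigma> s t \<le> J s t"
      by (rule has_integral_le[OF R\<sigma>[OF st] vJ[OF st(1,3)]]) (use Rb(2) st in auto)
  qed
  have S\<sigma>: "S = \<sigma> 0 T" by (simp add: S_def \<sigma>_def ends)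
  \<comment> \<open>The velocity is nonzero almost everywhere; this is what makes the total clock
    time positive.\<close>
  have "J 0 T \<noteq> 0"
  proof
    assume "J 0 T = 0"
    then have "((\<lambda>r. norm (v r)) has_integral 0) {0..T}" using vJ[of 0 T] by simp
    then have "negligible {r\<in>{0..T}. norm (v r) \<noteq> 0}"
      by (rule nonneg_has_integral_0_imp_negligible[OF _ negligible_empty]) auto
    then have "negligible ({r\<in>{0..T}. norm (v r) \<noteq> 0} \<union> N)" using N by (rule negligible_Un)
    then have "negligible {0..T}"
      by (rule negligible_subset) (use uC in \<open>auto simp: v_def\<close>)
    then show False using T negligible_interval(1)[of 0 T] by simp
  qed
  then have "J 0 T > 0" using J0[of 0 T] by simp
  then have "k * J 0 T > 0" using k by simp
  then show Spos: "S > 0" using \<sigma>J(1)[of 0 T] T S\<sigma> by simp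
  define M where "M = norm (fst x0) * exp (S / k)"
  have J\<sigma>: "J s t \<le> \<sigma> s t / k" if "0 \<le> s" "s \<le> t" "t \<le> T" for s t
    using \<sigma>J(1)[OF that] k by (simp add: field_simps)
  have M: "norm (A t) \<le> M" if t: "t \<in> {0..T}" for t
  proof -
    \<comment> \<open>Gronwall through the logarithm: its derivative is at most
      \<open>norm (v r)\<close>. Determinant 1 keeps the norm at least 1, which makes the logarithm
      Lipschitz.\<close>
    define h where "h r = ln (norm (A r))" for r
    have n1: "1 \<le> norm (A r)" if "r \<in> {0..T}" for r by (rule norm_det1_ge_1[OF det[OF that]])
    have Lh: "L-lipschitz_on {0..T} h"
    proof (rule lipschitz_onI)
      fix r s assume rs: "r \<in> {0..T}" "s \<in> {0..T}"
      have *: "h r - h s \<le> dist (A r) (A s)" if "r \<in> {0..T}" "s \<in> {0..T}" for r s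
      proof -
        have "h r - h s \<le> (norm (A r) - norm (A s)) / norm (A s)"
          unfolding h_def by (rule ln_diff_le) (use n1[OF that(1)] n1[OF that(2)] in linarith)+
        also have "\<dots> \<le> norm (A r - A s) / norm (A s)"
          using n1[OF that(2)] by (intro divide_right_mono norm_triangle_ineq2) auto
        also have "\<dots> \<le> norm (A r - A s) / 1" using n1[OF that(2)] by (intro divide_left_mono) auto
        finally show ?thesis by (simp add: dist_norm)
      qed
      have "dist (h r) (h s) \<le> dist (A r) (A s)"
        using *[OF rs] *[OF rs(2,1)] by (simp add: dist_real_def dist_commute abs_le_iff)
      also have "\<dots> \<le> L * dist r s" by (rule lipschitz_onD[OF LA rs])
      finally show "dist (h r) (h s) \<le> L * dist r s" .
    qed (rule L0)
    have hder: "(h has_vector_derivative (A r \<bullet> (A r ** v r)) / (A r \<bullet> A r)) (at r)" if r: "r \<in> {0..T} - N" for r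
    proof -
      have nz: "A r \<noteq> 0" using n1[of r] r by auto
      have "((\<lambda>s. A s \<bullet> A s) has_vector_derivative A r \<bullet> (A r ** v r) + (A r ** v r) \<bullet> A r) (at r)"
        by (rule bounded_bilinear.has_vector_derivative[OF bounded_bilinear_inner Adv[OF r] Adv[OF r]])
      then have d: "((\<lambda>s. A s \<bullet> A s) has_real_derivative 2 * (A r \<bullet> (A r ** v r))) (at r)"
        by (simp add: has_real_derivative_iff_has_vector_derivative inner_commute)
      have "((\<lambda>s. ln (A s \<bullet> A s) / 2) has_real_derivative (A r \<bullet> (A r ** v r)) / (A r \<bullet> A r)) (at r)"
        using nz by (auto intro!: derivative_eq_intros d)
      moreover have "h = (\<lambda>s. ln (A s \<bullet> A s) / 2)"
        by (auto simp: h_def norm_eq_sqrt_inner ln_sqrt)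
      ultimately show ?thesis by (simp add: has_real_derivative_iff_has_vector_derivative)
    qed
    have "((\<lambda>r. (A r \<bullet> (A r ** v r)) / (A r \<bullet> A r)) has_integral h t - h 0) {0..t}"
      by (rule lipschitz_has_integral_derivative[OF lipschitz_on_subset[OF Lh] _ N hder]) (use t in auto)
    then have "h t - h 0 \<le> J 0 t"
    proof (rule has_integral_le[OF _ vJ])
      fix r assume r: "r \<in> {0..t}"
      then have r': "r \<in> {0..T}" using t by auto
      have "A r \<bullet> (A r ** v r) \<le> norm (A r) * norm (A r ** v r)" by (rule norm_cauchy_schwarz)
      also have "\<dots> \<le> norm (A r) * (norm (A r) * norm (v r))" by (intro mult_left_mono norm_mat22_mult) auto
      also have "\<dots> = norm (v r) * (A r \<bullet> A r)" by (simp add: power2_norm_eq_inner[symmetric] power2_eq_square)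
      finally show "(A r \<bullet> (A r ** v r)) / (A r \<bullet> A r) \<le> norm (v r)"
        using n1[OF r'] by (simp add: divide_le_eq)
    qed (use t in auto)
    also have "J 0 t \<le> J 0 T"
    proof -
      have "J 0 t + J t T = J 0 T"
        unfolding J_def using t nvi by (intro Henstock_Kurzweil_Integration.integral_combine) auto
      then show ?thesis using J0[of t T] t by simp
    qed
    also have "J 0 T \<le> S / k" using J\<sigma>[of 0 T] T S\<sigma> by simp
    finally have "h t \<le> ln (norm (fst x0)) + S / k" by (simp add: h_def A_def ends)
    then have "exp (h t) \<le> exp (ln (norm (fst x0)) + S / k)" by simp
    moreover have "1 \<le> norm (fst x0)" using n1[of 0] T by (simp add: A_def ends)
    then have "norm (fst x0) > 0" by linarith
    moreover have "exp (h t) = norm (A t)" unfolding h_def using n1[OF t] by (intro exp_ln) linarith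
    ultimately show ?thesis by (simp add: M_def exp_add)
  qed
  have M0: "M \<ge> 0" by (simp add: M_def)
  have bA: "norm (A t - A s) \<le> M * J s t" if st: "0 \<le> s" "s \<le> t" "t \<le> T" for s t
  proof -
    have "norm (integral {s..t} (\<lambda>r. A r ** v r)) \<le> integral {s..t} (\<lambda>r. M * norm (v r))"
    proof (rule integral_norm_bound_integral)
      show "(\<lambda>r. A r ** v r) integrable_on {s..t}" using dA[OF st] by blast
      show "(\<lambda>r. M * norm (v r)) integrable_on {s..t}" using has_integral_mult_right[OF vJ[OF st(1,3)]] by blast
      fix r assume "r \<in> {s..t}"
      then have "norm (A r) \<le> M" using M st by auto
      then show "norm (A r ** v r) \<le> M * norm (v r)"
        by (meson norm_mat22_mult order_trans mult_right_mono norm_ge_zero)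
    qed
    then show ?thesis
      using dA[OF st] has_integral_mult_right[OF vJ[OF st(1,3)], of M] by (simp add: integral_unique J_def)
  qed
  have bU: "norm (U t - U s) \<le> J s t" if st: "0 \<le> s" "s \<le> t" "t \<le> T" for s t
  proof -
    have "norm (integral {s..t} v) \<le> integral {s..t} (\<lambda>r. norm (v r))"
      using vU[OF st] vJ[OF st(1,3)] by (intro integral_norm_bound_integral) auto
    then show ?thesis using vU[OF st] by (simp add: integral_unique J_def)
  qed
  \<comment> \<open>Freezing the factor \<open>A r\<close> at \<open>A s\<close> costs at most
    \<open>M * J s t\<close> by \<open>bA\<close>; integrating this against the norm of the velocity
    gives the square.\<close>
  have bq: "norm (A t - A s - A s ** (U t - U s)) \<le> M * (J s t)\<^sup>2" if st: "0 \<le> s" "s \<le> t" "t \<le> T" for s t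
  proof -
    have lin: "bounded_linear (\<lambda>w :: real^2^2. A s ** w)"
      by (rule bounded_bilinear.bounded_linear_right[OF bounded_bilinear_mat22_mult])
    have d: "((\<lambda>r. A r ** v r - A s ** v r) has_integral A t - A s - A s ** (U t - U s)) {s..t}"
      using has_integral_diff[OF dA[OF st] has_integral_linear[OF vU[OF st] lin]] by (simp add: o_def)
    have i: "((\<lambda>r. M * J s t * norm (v r)) has_integral M * J s t * J s t) {s..t}"
      by (rule has_integral_mult_right[OF vJ[OF st(1,3)]])
    have "norm (integral {s..t} (\<lambda>r. A r ** v r - A s ** v r)) \<le> integral {s..t} (\<lambda>r. M * J s t * norm (v r))"
    proof (rule integral_norm_bound_integral)
      show "(\<lambda>r. A r ** v r - A s ** v r) integrable_on {s..t}" using d by blast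
      show "(\<lambda>r. M * J s t * norm (v r)) integrable_on {s..t}" using i by blast
      fix r assume r: "r \<in> {s..t}"
      have "J s r + J r t = J s t"
        unfolding J_def using r st vJ[OF st(1,3)] by (intro Henstock_Kurzweil_Integration.integral_combine) auto
      then have "J s r \<le> J s t" using J0[of r t] r st by auto
      then have "norm (A r - A s) \<le> M * J s t"
        using bA[of s r] r st M0 by (auto intro: order_trans mult_left_mono)
      then have "norm (A r - A s) * norm (v r) \<le> M * J s t * norm (v r)" by (rule mult_right_mono) simp
      moreover have "A r ** v r - A s ** v r = (A r - A s) ** v r"
        by (simp add: bounded_bilinear.diff_left[OF bounded_bilinear_mat22_mult])
      ultimately show "norm (A r ** v r - A s ** v r) \<le> M * J s t * norm (v r)"
        using norm_mat22_mult[of "A r - A s" "v r"] by simp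
    qed
    then show ?thesis using d i by (simp only: integral_unique power2_eq_square mult.assoc)
  qed
  have b\<theta>: "\<bar>\<theta> t - \<theta> s\<bar> \<le> M\<^sup>2 * J s t" if st: "0 \<le> s" "s \<le> t" "t \<le> T" for s t
  proof -
    define y where "y r = Complex (A r$1$1) (A r$2$1)" for r
    have Ly: "(2 * L)-lipschitz_on {0..T} y"
    proof (rule lipschitz_onI)
      fix s t assume st: "s \<in> {0..T}" "t \<in> {0..T}"
      have "cmod (y s - y t) \<le> \<bar>(A s - A t)$1$1\<bar> + \<bar>(A s - A t)$2$1\<bar>"
        using cmod_le[of "y s - y t"] by (simp add: y_def)
      also have "\<dots> \<le> 2 * norm (A s - A t)"
        using norm_mat22_component_le[of "A s - A t" 1 1] norm_mat22_component_le[of "A s - A t" 2 1] by simp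
      also have "\<dots> \<le> 2 * (L * dist s t)" using lipschitz_onD[OF LA st] by (simp add: dist_norm)
      finally show "dist (y s) (y t) \<le> 2 * L * dist s t" by (simp add: dist_norm)
    qed (use L0 in simp)
    have ynz: "y r \<noteq> 0" "y r = cmod (y r) * cis (\<theta> r)" if "r \<in> {0..T}" for r
      unfolding y_def using Gt_column[OF Gt[OF that]] by auto
    obtain K\<theta> where K\<theta>: "K\<theta>-lipschitz_on {0..T} \<theta>" using lipschitz_angle[OF Ly ynz(1) c\<theta> ynz(2)] by blast
    have der: "(\<theta> has_vector_derivative v r$2$1 / (cmod (y r))\<^sup>2) (at r)" if r: "r \<in> {0..T} - N" for r
    proof -
      have "(y has_vector_derivative Complex ((A r ** v r)$1$1) ((A r ** v r)$2$1)) (at r)"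
        unfolding y_def using column_derivative(1)[OF Adv[OF r] det] r by auto
      from angle_derivative[OF this, of "{0<..<T}" \<theta>]
      have "(\<theta> has_vector_derivative Im (Complex ((A r ** v r)$1$1) ((A r ** v r)$2$1) / y r)) (at r)"
        using ynz N0T[OF r] c\<theta>0 by auto
      also have "Im (Complex ((A r ** v r)$1$1) ((A r ** v r)$2$1) / y r) = v r$2$1 / (cmod (y r))\<^sup>2"
        unfolding y_def using column_derivative(2)[OF Adv[OF r] det] r by auto
      finally show ?thesis .
    qed
    have d: "((\<lambda>r. v r$2$1 / (cmod (y r))\<^sup>2) has_integral \<theta> t - \<theta> s) {s..t}"
      by (rule lipschitz_has_integral_derivative[OF lipschitz_on_subset[OF K\<theta> sub[OF st(1,3)]] st(2) N])
        (use der st in auto)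
    have i: "((\<lambda>r. M\<^sup>2 * norm (v r)) has_integral M\<^sup>2 * J s t) {s..t}"
      by (rule has_integral_mult_right[OF vJ[OF st(1,3)]])
    have "norm (integral {s..t} (\<lambda>r. v r$2$1 / (cmod (y r))\<^sup>2)) \<le> integral {s..t} (\<lambda>r. M\<^sup>2 * norm (v r))"
    proof (rule integral_norm_bound_integral)
      show "(\<lambda>r. v r$2$1 / (cmod (y r))\<^sup>2) integrable_on {s..t}" "(\<lambda>r. M\<^sup>2 * norm (v r)) integrable_on {s..t}"
        using d i by blast+
      fix r assume r: "r \<in> {s..t}"
      then have r': "r \<in> {0..T}" using st by auto
      have "1 / M\<^sup>2 \<le> (cmod (y r))\<^sup>2" unfolding y_def by (rule column_lower_bound[OF det[OF r'] M[OF r']])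
      moreover have "M > 0" using M[OF r'] norm_det1_ge_1[OF det[OF r']] by linarith
      ultimately have "1 / (cmod (y r))\<^sup>2 \<le> M\<^sup>2" using ynz(1)[OF r'] by (simp add: field_simps)
      then have "\<bar>v r$2$1\<bar> * (1 / (cmod (y r))\<^sup>2) \<le> norm (v r) * M\<^sup>2"
        by (intro mult_mono norm_mat22_component_le) auto
      then show "norm (v r$2$1 / (cmod (y r))\<^sup>2) \<le> M\<^sup>2 * norm (v r)" by (simp add: abs_divide mult.commute)
    qed
    then show ?thesis using d i by (simp only: integral_unique real_norm_def)
  qed
  define w where "w t = nu (v t)" for t
  obtain l where l: "l 0 = 0" "l T = len T \<gamma>"
    "\<And>s t. 0 \<le> s \<Longrightarrow> s \<le> t \<Longrightarrow> t \<le> T \<Longrightarrow> U t - U s \<in> C \<and> 0 \<le> l t - l s \<and> l t - l s \<le> nu (U t - U s)"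
  proof (cases "set_integrable lborel {0..T} (\<lambda>t. nu (u t))")
    case True
    have "((\<lambda>t. nu (u t)) has_integral len T \<gamma>) {0..T}"
      using set_borel_integral_eq_integral[OF True] by (simp add: len_def u_def A_def[abs_def] has_integral_integral)
    then have wlen: "(w has_integral len T \<gamma>) {0..T}"
      by (rule has_integral_spike[OF N, rotated]) (auto simp: w_def v_def)
    then have wi: "w integrable_on {0..T}" by blast
    define l where "l t = integral {0..t} w" for t
    have wl: "(w has_integral l t - l s) {s..t}" if "0 \<le> s" "s \<le> t" "t \<le> T" for s t
    proof -
      have "w integrable_on {0..t}" using that by (intro integrable_on_subinterval[OF wi]) auto
      from Henstock_Kurzweil_Integration.integral_combine[OF that(1,2) this] have "l t - l s = integral {s..t} w"
        by (simp add: l_def algebra_simps)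
      moreover have "w integrable_on {s..t}" using that by (intro integrable_on_subinterval[OF wi]) auto
      ultimately show ?thesis by (simp add: has_integral_integral)
    qed
    show ?thesis
    proof (rule that[of l])
      show "l 0 = 0" "l T = len T \<gamma>" using wlen by (auto simp: l_def integral_unique)
      fix s t :: real assume st: "0 \<le> s" "s \<le> t" "t \<le> T"
      have "(U t - U s, l t - l s) \<in> {(v, r). v \<in> C \<and> r \<le> nu v}"
      proof (rule integral_in_closed_convex_cone[OF hypo_closed hypo_convex_cone])
        show "((\<lambda>r. (v r, w r)) has_integral (U t - U s, l t - l s)) {s..t}"
        proof -
          have 1: "bounded_linear (\<lambda>x :: real^2^2. (x, 0 :: real))" and 2: "bounded_linear (\<lambda>x :: real. (0 :: real^2^2, x))"
            by (intro bounded_linear_Pair bounded_linear_ident bounded_linear_zero)+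
          from has_integral_add[OF has_integral_linear[OF vU[OF st] 1] has_integral_linear[OF wl[OF st] 2]]
          show ?thesis by (simp add: o_def)
        qed
        show "{(v, r). v \<in> C \<and> r \<le> nu v} \<noteq> {}" using v0 by auto
      qed (use vC st in \<open>auto simp: w_def\<close>)
      moreover have "0 \<le> l t - l s"
        by (rule has_integral_nonneg[OF wl[OF st]]) (use vC nu_nonneg st in \<open>auto simp: w_def\<close>)
      ultimately show "U t - U s \<in> C \<and> 0 \<le> l t - l s \<and> l t - l s \<le> nu (U t - U s)" by simp
    qed
  next
    case False
    \<comment> \<open>The integral in \<open>len\<close> is 0 by convention here, and the constant
      function 0 satisfies all conditions on \<open>l\<close>.\<close>
    then have "len T \<gamma> = 0"
      unfolding len_def set_lebesgue_integral_def set_integrable_def u_def A_def[abs_def]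
      by (rule not_integrable_integral_eq)
    moreover have "U t - U s \<in> C" if st: "0 \<le> s" "s \<le> t" "t \<le> T" for s t
      by (rule integral_in_closed_convex_cone[OF C_closed C_convex C_cone _ vU[OF st] negligible_empty]) (use vC st v0 in auto)
    ultimately show ?thesis using that[of "\<lambda>_. 0"] nu_nonneg by simp
  qed
  let ?K = "bound_const (norm (fst x0)) S"
  have K: "?K = M / k + M\<^sup>2 / k + 1 / k + B / k + M / k\<^sup>2" by (simp add: bound_const_def M_def Let_def)
  have Ks: "0 \<le> M / k" "0 \<le> M\<^sup>2 / k" "0 \<le> 1 / k" "0 \<le> B / k" "0 \<le> M / k\<^sup>2" using M0 k B by auto
  show "\<exists>U l. U 0 = 0 \<and> l 0 = 0 \<and> l T = len T \<gamma> \<and>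
     (\<forall>s t. 0 \<le> s \<and> s \<le> t \<and> t \<le> T \<longrightarrow>
        0 \<le> e * (clock (\<gamma> t) - clock (\<gamma> s)) \<and>
        controlled ?K (e * (clock (\<gamma> t) - clock (\<gamma> s))) (\<gamma> s, U s, l s) (\<gamma> t, U t, l t))"
  proof (intro exI[of _ U] exI[of _ l] conjI allI impI)
    show "U 0 = 0" by (simp add: U_def)
    show "l 0 = 0" "l T = len T \<gamma>" by fact+
    fix s t :: real assume "0 \<le> s \<and> s \<le> t \<and> t \<le> T"
    then have st: "0 \<le> s" "s \<le> t" "t \<le> T" by auto
    have J0': "0 \<le> J s t" by (rule J0[OF st(1,3)])
    then have \<sigma>0: "0 \<le> \<sigma> s t" using \<sigma>J(1)[OF st] k by (meson mult_nonneg_nonneg less_imp_le order_trans)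
    then show "0 \<le> e * (clock (\<gamma> t) - clock (\<gamma> s))" by (simp add: \<sigma>_def)
    have up: "c * J s t \<le> ?K * \<sigma> s t" if "0 \<le> c" "c / k \<le> ?K" for c
    proof -
      have "c * J s t \<le> c * (\<sigma> s t / k)" using J\<sigma>[OF st] that by (intro mult_left_mono) auto
      also have "\<dots> = (c / k) * \<sigma> s t" by simp
      also have "\<dots> \<le> ?K * \<sigma> s t" using that(2) \<sigma>0 by (rule mult_right_mono)
      finally show ?thesis .
    qed
    have UC: "U t - U s \<in> C" and l0: "0 \<le> l t - l s" and ln: "l t - l s \<le> nu (U t - U s)" using l(3)[OF st] by auto
    have "controlled ?K (\<sigma> s t) ((A s, \<theta> s), (U s, l s)) ((A t, \<theta> t), (U t, l t))"
      unfolding controlled.simps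
    proof (intro conjI)
      show "norm (A t - A s) \<le> ?K * \<sigma> s t" using bA[OF st] up[of M] M0 Ks K by simp
      show "\<bar>\<theta> t - \<theta> s\<bar> \<le> ?K * \<sigma> s t" using b\<theta>[OF st] up[of "M\<^sup>2"] Ks K by simp
      show "norm (U t - U s) \<le> ?K * \<sigma> s t" using bU[OF st] up[of 1] Ks K by simp
      have "\<bar>l t - l s\<bar> \<le> B * norm (U t - U s)" using l0 ln nu_le[OF UC] by simp
      also have "\<dots> \<le> B * J s t" using bU[OF st] B by (rule mult_left_mono)
      finally show "\<bar>l t - l s\<bar> \<le> ?K * \<sigma> s t" using up[of B] B Ks K by simp
      show "U t - U s \<in> C" "0 \<le> l t - l s" "l t - l s \<le> nu (U t - U s)" by fact+
      have "M * (J s t)\<^sup>2 \<le> M * (\<sigma> s t / k)\<^sup>2"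
        using J\<sigma>[OF st] J0' M0 by (intro mult_left_mono power_mono) auto
      also have "\<dots> = (M / k\<^sup>2) * (\<sigma> s t)\<^sup>2" by (simp add: power_divide)
      also have "\<dots> \<le> ?K * (\<sigma> s t)\<^sup>2" using Ks K by (intro mult_right_mono) auto
      finally show "norm (A t - A s - A s ** (U t - U s)) \<le> ?K * (\<sigma> s t)\<^sup>2" using bq[OF st] by simp
      have lin: "bounded_linear (\<lambda>w :: real^2^2. e * (w$2$1 - w$1$2))"
        by (intro bounded_linear_const_mult bounded_linear_sub bounded_linear_compose[OF bounded_linear_vec_nth bounded_linear_vec_nth])
      have "((\<lambda>r. e * (v r$2$1 - v r$1$2)) has_integral e * ((U t - U s)$2$1 - (U t - U s)$1$2)) {s..t}"
        using has_integral_linear[OF vU[OF st] lin] by (simp add: o_def)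
      then have "J s t \<le> e * ((U t - U s)$2$1 - (U t - U s)$1$2)"
        by (rule has_integral_le[OF vJ[OF st(1,3)]]) (use norm_tau vC st in auto)
      then show "\<sigma> s t \<le> e * ((U t - U s)$2$1 - (U t - U s)$1$2)" using \<sigma>J(2)[OF st] by simp
    qed
    then show "controlled ?K (e * (clock (\<gamma> t) - clock (\<gamma> s))) (\<gamma> s, U s, l s) (\<gamma> t, U t, l t)"
      by (simp add: \<gamma>[symmetric] \<sigma>_def)
  qed
qed

end

section \<open>Compactness and existence of longest arcs\<close>

lemma closed_Gt: "closed Gt"
proof -
  have Gt: "Gt = {p. det (fst p) = 1} \<inter>
    {p. Complex (fst p$1$1) (fst p$2$1) = cmod (Complex (fst p$1$1) (fst p$2$1)) * cis (snd p)}"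
    using Gt_iff by auto
  have 1: "closed {p :: (real^2^2) \<times> real. det (fst p) = 1}"
    unfolding det_2 by (intro closed_Collect_eq continuous_intros)
  have 2: "closed {p :: (real^2^2) \<times> real. Complex (fst p$1$1) (fst p$2$1) = cmod (Complex (fst p$1$1) (fst p$2$1)) * cis (snd p)}"
    unfolding Complex_eq cis_conv_exp by (intro closed_Collect_eq continuous_intros)
  show ?thesis unfolding Gt by (rule closed_Int[OF 1 2])
qed

lemma norm_sum4_le: "norm ((a, b), (c, d)) \<le> norm a + norm b + norm c + norm d"
  using norm_Pair_le[of "(a, b)" "(c, d)"] norm_Pair_le[of a b] norm_Pair_le[of c d] by linarith

context timelike_cone
begin

text \<open>\<open>S\<close> is meant as a difference of clock values, so all curves with the same
  endpoints share the interval \<open>{0..S}\<close>. The last component need not be the length: its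
  increments only obey the anti-norm bound, a relaxation that survives limits.\<close>

definition arc :: "(real^2^2) \<times> real \<Rightarrow> (real^2^2) \<times> real \<Rightarrow> real \<Rightarrow> real \<Rightarrow> (real \<Rightarrow> arc_point) \<Rightarrow> bool" where
  "arc x0 x1 K S F \<longleftrightarrow> F 0 = (x0, 0, 0) \<and> fst (F S) = x1 \<and> (\<forall>s\<in>{0..S}. fst (F s) \<in> Gt) \<and>
     (\<forall>s t. 0 \<le> s \<and> s \<le> t \<and> t \<le> S \<longrightarrow>
controlled K (t - s) (F s) (F t))"

lemma admissible_arc:
  assumes adm: "admissible C x0 x1 T \<gamma>"
  defines "S \<equiv> e * (clock x1 - clock x0)"
  shows "\<exists>F. arc x0 x1 (bound_const (norm (fst x0)) S) S F \<and> snd (snd (F S)) = len T \<gamma>"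
proof -
  let ?K = "bound_const (norm (fst x0)) S"
  have S: "S > 0" unfolding S_def by (rule admissible_controlled(1)[OF adm])
  define \<sigma> where "\<sigma> t = e * (clock (\<gamma> t) - clock x0)" for t
  obtain U l where U0: "U 0 = 0" and l: "l 0 = 0" "l T = len T \<gamma>"
    and mono: "\<And>s t. 0 \<le> s \<Longrightarrow> s \<le> t \<Longrightarrow> t \<le> T \<Longrightarrow> \<sigma> s \<le> \<sigma> t"
    and ctrl: "\<And>s t. 0 \<le> s \<Longrightarrow> s \<le> t \<Longrightarrow> t \<le> T \<Longrightarrow>
        controlled ?K (\<sigma> t - \<sigma> s) (\<gamma> s, U s, l s) (\<gamma> t, U t, l t)"
    using admissible_controlled(2)[OF adm, folded S_def] unfolding \<sigma>_def
    by (auto simp: right_diff_distrib)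
  have T: "T > 0" and ends: "\<gamma> 0 = x0" "\<gamma> T = x1" and Gt: "\<And>t. t \<in> {0..T} \<Longrightarrow> \<gamma> t \<in> Gt"
    and c\<gamma>: "continuous_on {0..T} \<gamma>"
    using adm unfolding admissible_def by (auto intro: lipschitz_on_continuous_on)
  have c\<sigma>: "continuous_on {0..T} \<sigma>"
    unfolding \<sigma>_def by (intro continuous_intros continuous_on_clock c\<gamma> Gt)
  have \<sigma>0: "\<sigma> 0 = 0" and \<sigma>T: "\<sigma> T = S" by (simp_all add: \<sigma>_def ends S_def)
  \<comment> \<open>A right inverse of the clock along the curve; the values at 0 and
    \<open>S\<close> are prescribed so that the endpoints come out exactly.\<close>
  define \<rho> where "\<rho> x = (if x = 0 then 0 else if x = S then T else SOME t. t \<in> {0..T} \<and> \<sigma> t = x)" for x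
  have \<rho>: "\<rho> x \<in> {0..T} \<and> \<sigma> (\<rho> x) = x" if x: "x \<in> {0..S}" for x
  proof (cases "x = 0 \<or> x = S")
    case True
    then show ?thesis using \<sigma>0 \<sigma>T T S by (auto simp: \<rho>_def)
  next
    case False
    have "\<exists>t\<ge>0. t \<le> T \<and> \<sigma> t = x"
      by (rule IVT') (use x \<sigma>0 \<sigma>T T c\<sigma> in auto)
    then have "\<exists>t. t \<in> {0..T} \<and> \<sigma> t = x" by auto
    from someI_ex[OF this] show ?thesis using False by (simp add: \<rho>_def)
  qed
  have \<rho>mono: "\<rho> x \<le> \<rho> y" if "x \<in> {0..S}" "y \<in> {0..S}" "x \<le> y" for x y
  proof (rule ccontr)
    assume "\<not> \<rho> x \<le> \<rho> y"
    moreover from this have "y \<le> x" using mono[of "\<rho> y" "\<rho> x"] \<rho>[OF that(1)] \<rho>[OF that(2)] by auto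
    ultimately show False using that(3) by simp
  qed
  define F where "F x = (\<gamma> (\<rho> x), U (\<rho> x), l (\<rho> x))" for x
  have "arc x0 x1 ?K S F"
    unfolding arc_def
  proof (intro conjI allI impI ballI)
    show "F 0 = (x0, 0, 0)" by (simp add: F_def \<rho>_def ends U0 l)
    show "fst (F S) = x1" using S by (simp add: F_def \<rho>_def ends)
    show "fst (F s) \<in> Gt" if "s \<in> {0..S}" for s using \<rho>[OF that] Gt by (simp add: F_def)
    fix s t assume st: "0 \<le> s \<and> s \<le> t \<and> t \<le> S"
    have "controlled ?K (\<sigma> (\<rho> t) - \<sigma> (\<rho> s)) (F s) (F t)" unfolding F_def
      using st \<rho>[of s] \<rho>[of t] \<rho>mono[of s t] by (intro ctrl) auto
    then show "controlled ?K (t - s) (F s) (F t)"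
      using st \<rho>[of s] \<rho>[of t] by simp
  qed
  moreover have "snd (snd (F S)) = len T \<gamma>" using S l by (simp add: F_def \<rho>_def)
  ultimately show ?thesis by blast
qed

text \<open>The conditions \<open>U' - U \<in> C\<close> and \<open>l' - l \<le> nu (U' - U)\<close>
  are taken jointly, as a preimage of the hypograph. By itself the inequality has no reason to be
  closed, as \<open>nu\<close> is arbitrary outside \<open>C\<close>.\<close>

lemma closed_controlled:
  "closed {(X, Y). controlled K d X Y}" (is "closed ?R")
proof -
  let ?dU = "\<lambda>p :: arc_point \<times> arc_point. fst (snd (snd p)) - fst (snd (fst p))"
  let ?dl = "\<lambda>p :: arc_point \<times> arc_point. snd (snd (snd p)) - snd (snd (fst p))"
  let ?dA = "\<lambda>p :: arc_point \<times> arc_point. fst (fst (snd p)) - fst (fst (fst p))"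
  let ?dt = "\<lambda>p :: arc_point \<times> arc_point. snd (fst (snd p)) - snd (fst (fst p))"
  have mult: "continuous_on UNIV (\<lambda>p :: arc_point \<times> arc_point. fst (fst (fst p)) ** ?dU p)"
    by (intro bounded_bilinear.continuous_on[OF bounded_bilinear_mat22_mult] continuous_intros)
  have hyp: "closed ((\<lambda>p. (?dU p, ?dl p)) -` {(v, r). v \<in> C \<and> r \<le> nu v})"
    by (intro continuous_closed_vimage[OF hypo_closed] continuous_intros)
  have "?R = {p. norm (?dA p) \<le> K * d} \<inter> {p. \<bar>?dt p\<bar> \<le> K * d} \<inter> {p. norm (?dU p) \<le> K * d} \<inter> {p. \<bar>?dl p\<bar> \<le> K * d} \<inter>
     {p. d \<le> e * (?dU p$2$1 - ?dU p$1$2)} \<inter> {p. norm (?dA p - fst (fst (fst p)) ** ?dU p) \<le> K * d\<^sup>2} \<inter>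
     {p. 0 \<le> ?dl p} \<inter> ((\<lambda>p. (?dU p, ?dl p)) -` {(v, r). v \<in> C \<and> r \<le> nu v})"
  proof (rule set_eqI)
    fix p :: "arc_point \<times> arc_point"
    obtain A \<theta> U l A' \<theta>' U' l' where p: "p = (((A, \<theta>), (U, l)), ((A', \<theta>'), (U', l')))" by (metis surj_pair)
    show "p \<in> ?R \<longleftrightarrow> p \<in> ({p. norm (?dA p) \<le> K * d} \<inter> {p. \<bar>?dt p\<bar> \<le> K * d} \<inter> {p. norm (?dU p) \<le> K * d} \<inter> {p. \<bar>?dl p\<bar> \<le> K * d} \<inter>
     {p. d \<le> e * (?dU p$2$1 - ?dU p$1$2)} \<inter> {p. norm (?dA p - fst (fst (fst p)) ** ?dU p) \<le> K * d\<^sup>2} \<inter>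
     {p. 0 \<le> ?dl p} \<inter> ((\<lambda>p. (?dU p, ?dl p)) -` {(v, r). v \<in> C \<and> r \<le> nu v}))"
      unfolding p by (simp add: controlled.simps) blast
  qed
  also have "closed \<dots>"
    by (intro closed_Int hyp closed_Collect_le continuous_intros mult)
  finally show ?thesis .
qed

lemma arc_lipschitz:
  assumes F: "arc x0 x1 K S F" and st: "s \<in> {0..S}" "t \<in> {0..S}"
  shows "norm (F s - F t) \<le> 4 * K * \<bar>s - t\<bar>"
proof -
  have *: "norm (F t - F s) \<le> 4 * K * (t - s)" if "0 \<le> s" "s \<le> t" "t \<le> S" for s t
  proof -
    have c: "controlled K (t - s) (F s) (F t)"
      using F that unfolding arc_def by blast
    obtain A \<theta> U l A' \<theta>' U' l' where p: "F s = ((A, \<theta>), (U, l))" "F t = ((A', \<theta>'), (U', l'))" by (metis surj_pair)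
    have "norm (F t - F s) \<le> norm (A' - A) + norm (\<theta>' - \<theta>) + norm (U' - U) + norm (l' - l)"
      unfolding p using norm_sum4_le[of "A' - A" "\<theta>' - \<theta>" "U' - U" "l' - l"] by simp
    also have "\<dots> \<le> K * (t - s) + K * (t - s) + K * (t - s) + K * (t - s)"
      using c unfolding p controlled.simps real_norm_def by linarith
    finally show ?thesis by (simp add: algebra_simps)
  qed
  show ?thesis using *[of s t] *[of t s] st by (cases "s \<le> t") (auto simp: norm_minus_commute)
qed

text \<open>With \<open>K\<close> and \<open>S\<close> fixed, all arcs share a Lipschitz constant
  and the starting point. This gives both a finite supremum and the hypotheses of
  Arzela-Ascoli.\<close>

lemma arc_max_exists:
  assumes ne: "arc x0 x1 K S F0" and S: "S > 0"
  shows "\<exists>F. arc x0 x1 K S F \<and> (\<forall>G. arc x0 x1 K S G \<longrightarrow> snd (snd (G S)) \<le> snd (snd (F S)))"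
proof -
  let ?V = "{snd (snd (F S)) |F. arc x0 x1 K S F}"
  have le: "norm (F s) \<le> norm (x0, 0 :: real^2^2, 0 :: real) + 4 * \<bar>K\<bar> * S" if F: "arc x0 x1 K S F" and s: "s \<in> {0..S}" for F s
  proof -
    have "norm (F s - F 0) \<le> 4 * K * \<bar>s - 0\<bar>" using S s by (intro arc_lipschitz[OF F]) auto
    also have "\<dots> \<le> 4 * \<bar>K\<bar> * S" by (rule mult_mono) (use s in auto)
    finally show ?thesis using norm_triangle_ineq2[of "F s" "F 0"] F by (simp add: arc_def)
  qed
  have bdd: "bdd_above ?V"
  proof (rule bdd_aboveI)
    fix x assume "x \<in> ?V"
    then obtain F where F: "arc x0 x1 K S F" "x = snd (snd (F S))" by blast
    have "x \<le> norm (snd (snd (F S)))" by (simp add: F)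
    also have "\<dots> \<le> norm (F S)" 
      using norm_snd_le[of "snd (snd (F S))" "fst (snd (F S))"] norm_snd_le[of "snd (F S)" "fst (F S)"] by simp
    also have "\<dots> \<le> norm (x0, 0 :: real^2^2, 0 :: real) + 4 * \<bar>K\<bar> * S" using S by (intro le F) auto
    finally show "x \<le> norm (x0, 0 :: real^2^2, 0 :: real) + 4 * \<bar>K\<bar> * S" .
  qed
  define m where "m = Sup ?V"
  have "\<exists>F. arc x0 x1 K S F \<and> m - 1 / (real n + 1) < snd (snd (F S))" for n
  proof -
    have "m - 1 / (real n + 1) < Sup ?V" by (simp add: m_def)
    then obtain x where "x \<in> ?V" "m - 1 / (real n + 1) < x"
      using less_cSup_iff[of ?V] bdd ne by blast
    then show ?thesis by blast
  qed
  then obtain F where F: "\<And>n. arc x0 x1 K S (F n)" and Fm: "\<And>n. m - 1 / (real n + 1) < snd (snd (F n S))"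
    by metis
  obtain g r where r: "strict_mono (r :: nat \<Rightarrow> nat)"
    and conv: "\<And>\<epsilon>. 0 < \<epsilon> \<Longrightarrow> \<exists>N. \<forall>n x. n \<ge> N \<and> x \<in> {0..S} \<longrightarrow> norm (F (r n) x - g x) < \<epsilon>"
  proof (rule Arzela_Ascoli[of "{0..S}" F "norm (x0, 0 :: real^2^2, 0 :: real) + 4 * \<bar>K\<bar> * S"])
    show "\<exists>d>0. \<forall>n y. y \<in> {0..S} \<and> norm (x - y) < d \<longrightarrow> norm (F n x - F n y) < \<epsilon>" if x: "x \<in> {0..S}" and \<epsilon>: "0 < \<epsilon>" for x \<epsilon>
    proof (intro exI[of _ "\<epsilon> / (4 * \<bar>K\<bar> + 1)"] conjI allI impI)
      show "0 < \<epsilon> / (4 * \<bar>K\<bar> + 1)" using \<epsilon> by simp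
      fix n y assume y: "y \<in> {0..S} \<and> norm (x - y) < \<epsilon> / (4 * \<bar>K\<bar> + 1)"
      have "norm (F n x - F n y) \<le> 4 * K * \<bar>x - y\<bar>" using x y by (intro arc_lipschitz[OF F]) auto
      also have "\<dots> \<le> (4 * \<bar>K\<bar> + 1) * \<bar>x - y\<bar>" by (intro mult_right_mono) auto
      also have "\<dots> < \<epsilon>" using y by (simp add: less_divide_eq mult.commute)
      finally show "norm (F n x - F n y) < \<epsilon>" .
    qed
  qed (use le F in auto)
  have lim: "(\<lambda>n. F (r n) s) \<longlonglongrightarrow> g s" if "s \<in> {0..S}" for s
    unfolding LIMSEQ_iff using conv that by blast
  have 0: "0 \<in> {0..S}" and SS: "S \<in> {0..S}" using S by auto
  have "arc x0 x1 K S g"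
    unfolding arc_def
  proof (intro conjI allI impI ballI)
    have "(\<lambda>n. F (r n) 0) = (\<lambda>n. (x0, 0, 0))" using F by (auto simp: arc_def)
    then show "g 0 = (x0, 0, 0)" using lim[OF 0] LIMSEQ_unique[OF _ tendsto_const] by metis
    have "(\<lambda>n. fst (F (r n) S)) = (\<lambda>n. x1)" using F by (auto simp: arc_def)
    then show "fst (g S) = x1" using tendsto_fst[OF lim[OF SS]] LIMSEQ_unique[OF _ tendsto_const] by metis
    show "fst (g s) \<in> Gt" if s: "s \<in> {0..S}" for s
      by (rule closed_sequentially[OF closed_Gt _ tendsto_fst[OF lim[OF s]]]) (use F s in \<open>auto simp: arc_def\<close>)
    fix s t assume st: "0 \<le> s \<and> s \<le> t \<and> t \<le> S"
    have c: "controlled K (t - s) (F n s) (F n t)" for n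
      using F st unfolding arc_def by blast
    have l: "(\<lambda>n. (F (r n) s, F (r n) t)) \<longlonglongrightarrow> (g s, g t)"
      using st by (intro tendsto_Pair lim) auto
    have "(g s, g t) \<in> {(X, Y). controlled K (t - s) X Y}"
      by (rule closed_sequentially[OF closed_controlled _ l]) (use c in simp)
    then show "controlled K (t - s) (g s) (g t)" by simp
  qed
  moreover have "snd (snd (G S)) \<le> snd (snd (g S))" if "arc x0 x1 K S G" for G
  proof -
    have "snd (snd (G S)) \<le> m" unfolding m_def using that bdd by (intro cSup_upper) auto
    also have "m \<le> snd (snd (g S))"
    proof (rule LIMSEQ_le)
      show "(\<lambda>n. snd (snd (F (r n) S))) \<longlonglongrightarrow> snd (snd (g S))" by (intro tendsto_snd lim SS)
      have "(\<lambda>n. m - inverse (real (Suc n))) \<longlonglongrightarrow> m - 0"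
        by (intro tendsto_diff tendsto_const LIMSEQ_inverse_real_of_nat)
      then have "(\<lambda>n. m - 1 / (real n + 1)) \<longlonglongrightarrow> m" by (simp add: inverse_eq_divide add.commute)
      from LIMSEQ_subseq_LIMSEQ[OF this r] show "(\<lambda>n. m - 1 / (real (r n) + 1)) \<longlonglongrightarrow> m" by (simp add: o_def)
      show "\<exists>N. \<forall>n\<ge>N. m - 1 / (real (r n) + 1) \<le> snd (snd (F (r n) S))" using Fm by (meson less_imp_le)
    qed
    finally show ?thesis .
  qed
  ultimately show ?thesis by blast
qed

end

text \<open>The purpose of flattening: the quotient of the composition is at most \<open>K\<close>
  times the quotient of \<open>p\<close>, so the composition is differentiable at \<open>y\<close>
  even if \<open>f\<close> is not differentiable at \<open>p y\<close>.\<close>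

lemma lipschitz_comp_flat:
  fixes f :: "real \<Rightarrow> 'a::real_normed_vector"
  assumes f: "K-lipschitz_on X f" and p: "(p has_real_derivative 0) (at y)"
    and V: "open V" "y \<in> V" "\<And>z. z \<in> V \<Longrightarrow> p z \<in> X"
  shows "((\<lambda>y. f (p y)) has_vector_derivative 0) (at y)"
  unfolding has_vector_derivative_iff_quotient
proof (rule Lim_null_comparison)
  have "((\<lambda>z. (p z - p y) /\<^sub>R (z - y)) \<longlongrightarrow> 0) (at y)"
    using p by (simp only: has_real_derivative_iff_has_vector_derivative has_vector_derivative_iff_quotient)
  then have "((\<lambda>z. K * norm ((p z - p y) /\<^sub>R (z - y))) \<longlongrightarrow> K * 0) (at y)"
    by (intro tendsto_mult tendsto_const tendsto_norm_zero)
  then show "((\<lambda>z. K * norm ((p z - p y) /\<^sub>R (z - y))) \<longlongrightarrow> 0) (at y)" by simp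
  have "eventually (\<lambda>z. z \<in> V) (at y)" using V by (intro eventually_at_in_open')
  then show "\<forall>\<^sub>F z in at y. norm ((f (p z) - f (p y)) /\<^sub>R (z - y)) \<le> K * norm ((p z - p y) /\<^sub>R (z - y))"
  proof eventually_elim
    case (elim z)
    have "norm (f (p z) - f (p y)) \<le> K * \<bar>p z - p y\<bar>"
      using lipschitz_onD[OF f V(3)[OF elim] V(3)[OF V(2)]] by (simp add: dist_norm)
    then have "\<bar>inverse (z - y)\<bar> * norm (f (p z) - f (p y)) \<le> \<bar>inverse (z - y)\<bar> * (K * \<bar>p z - p y\<bar>)"
      by (rule mult_left_mono) simp
    then show ?case by (simp add: abs_mult mult_ac)
  qed
qed

lemma lipschitz_onI_ordered:
  fixes f :: "real \<Rightarrow> 'a::real_normed_vector"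
  assumes "\<And>s t. 0 \<le> s \<Longrightarrow> s \<le> t \<Longrightarrow> t \<le> S \<Longrightarrow> norm (f t - f s) \<le> K * (t - s)" "0 \<le> K"
  shows "K-lipschitz_on {0..S} f"
proof (rule lipschitz_onI)
  fix s t assume st: "s \<in> {0..S}" "t \<in> {0..S}"
  show "dist (f s) (f t) \<le> K * dist s t"
    using assms(1)[of s t] assms(1)[of t s] st
    by (cases "s \<le> t") (auto simp: dist_norm norm_minus_commute)
qed (rule assms(2))

lemma lipschitz_differentiable_interior:
  fixes f :: "real \<Rightarrow> 'a::euclidean_space"
  assumes f: "K-lipschitz_on {0..S} f" and S: "S > 0"
  obtains N D where "negligible N" "\<And>x. x \<in> {0<..<S} - N \<Longrightarrow> (f has_vector_derivative D x) (at x)"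
proof -
  define g where "g x = f (max 0 (min S x))" for x
  have g: "K-lipschitz_on UNIV g" unfolding g_def by (rule lipschitz_clamp[OF f]) (use S in simp)
  show thesis
  proof (rule that)
    show "negligible {x. \<not> g differentiable (at x)}"
      unfolding negligible_iff_null_sets by (rule null_sets_completionI[OF lipschitz_not_differentiable_null[OF g]])
    fix x assume x: "x \<in> {0<..<S} - {x. \<not> g differentiable (at x)}"
    then have "(g has_vector_derivative vector_derivative g (at x)) (at x)" by (simp add: vector_derivative_works)
    then show "(f has_vector_derivative vector_derivative g (at x)) (at x)"
      by (rule has_vector_derivative_transform_within_open[of _ _ _ "{0<..<S}"]) (use x in \<open>auto simp: g_def\<close>)
  qed
qed

context timelike_cone
begin

text \<open>Divide the conditions of \<open>controlled\<close> by \<open>t - x\<close> and let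
  \<open>t\<close> decrease to \<open>x\<close>. The second-order error vanishes, the hypograph is a
  closed cone and keeps the limit \<open>(DU, Dl)\<close>, and the lower bound on the linear
  functional rules out \<open>DU = 0\<close>.\<close>

lemma arc_derivatives:
  assumes ctrl: "\<And>t. x \<le> t \<Longrightarrow> t \<le> S \<Longrightarrow> controlled K (t - x) ((A x, \<theta> x), (U x, l x)) ((A t, \<theta> t), (U t, l t))"
    and x: "x < S"
    and A: "(A has_vector_derivative DA) (at x)" and U: "(U has_vector_derivative DU) (at x)"
    and l: "(l has_vector_derivative Dl) (at x)"
  shows "DA = A x ** DU" "DU \<in> C - {0}" "Dl \<le> nu DU"
proof -
  let ?F = "at_right x"
  have lims: "((\<lambda>t. (A t - A x) /\<^sub>R (t - x)) \<longlongrightarrow> DA) ?F" "((\<lambda>t. (U t - U x) /\<^sub>R (t - x)) \<longlongrightarrow> DU) ?F"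
    "((\<lambda>t. (l t - l x) /\<^sub>R (t - x)) \<longlongrightarrow> Dl) ?F"
    using has_vector_derivative_at_within[OF A] has_vector_derivative_at_within[OF U] has_vector_derivative_at_within[OF l]
    unfolding has_vector_derivative_iff_quotient by blast+
  have ev: "eventually (\<lambda>t. t \<in> {x<..<S}) ?F" using x by (intro eventually_at_right_real)
  have c: "norm (A t - A x - A x ** (U t - U x)) \<le> K * (t - x)\<^sup>2" "U t - U x \<in> C" "l t - l x \<le> nu (U t - U x)"
    "t - x \<le> e * ((U t - U x)$2$1 - (U t - U x)$1$2)" if "t \<in> {x<..<S}" for t
    using ctrl[of t] that by (auto simp: controlled.simps)
  have lin: "bounded_linear (\<lambda>w :: real^2^2. A x ** w)"
    by (rule bounded_bilinear.bounded_linear_right[OF bounded_bilinear_mat22_mult])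
  have "((\<lambda>t. (A t - A x) /\<^sub>R (t - x) - A x ** ((U t - U x) /\<^sub>R (t - x))) \<longlongrightarrow> DA - A x ** DU) ?F"
    by (intro tendsto_diff lims bounded_linear.tendsto[OF lin])
  moreover have "((\<lambda>t. (A t - A x) /\<^sub>R (t - x) - A x ** ((U t - U x) /\<^sub>R (t - x))) \<longlongrightarrow> 0) ?F"
  proof (rule Lim_null_comparison)
    show "((\<lambda>t. K * (t - x)) \<longlongrightarrow> 0) ?F" by (auto intro!: tendsto_eq_intros)
    show "\<forall>\<^sub>F t in ?F. norm ((A t - A x) /\<^sub>R (t - x) - A x ** ((U t - U x) /\<^sub>R (t - x))) \<le> K * (t - x)"
      using ev
    proof eventually_elim
      case (elim t)
      have "(A t - A x) /\<^sub>R (t - x) - A x ** ((U t - U x) /\<^sub>R (t - x)) = (A t - A x - A x ** (U t - U x)) /\<^sub>R (t - x)"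
        by (simp only: linear_scale[OF bounded_linear.linear[OF lin]] scaleR_diff_right[symmetric])
      also have "norm \<dots> = norm (A t - A x - A x ** (U t - U x)) / (t - x)"
        using elim by (simp add: divide_inverse mult.commute)
      also have "\<dots> \<le> K * (t - x)\<^sup>2 / (t - x)" using c(1)[OF elim] elim by (intro divide_right_mono) auto
      also have "\<dots> = K * (t - x)" using elim by (simp add: power2_eq_square)
      finally show ?case .
    qed
  qed
  ultimately have "DA - A x ** DU = 0" by (rule tendsto_unique[OF trivial_limit_at_right_real])
  then show "DA = A x ** DU" by simp
  have "(DU, Dl) \<in> {(v, r). v \<in> C \<and> r \<le> nu v}"
  proof (rule Lim_in_closed_set[OF hypo_closed _ trivial_limit_at_right_real])
    show "((\<lambda>t. ((U t - U x) /\<^sub>R (t - x), (l t - l x) /\<^sub>R (t - x))) \<longlongrightarrow> (DU, Dl)) ?F" by (intro tendsto_Pair lims)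
    show "\<forall>\<^sub>F t in ?F. ((U t - U x) /\<^sub>R (t - x), (l t - l x) /\<^sub>R (t - x)) \<in> {(v, r). v \<in> C \<and> r \<le> nu v}"
      using ev
    proof eventually_elim
      case (elim t)
      have "inverse (t - x) *\<^sub>R (U t - U x, l t - l x) \<in> {(v, r). v \<in> C \<and> r \<le> nu v}"
        by (rule mem_cone[OF hypo_convex_cone(2)]) (use c(2,3)[OF elim] elim in auto)
      then show ?case by simp
    qed
  qed
  then have DU: "DU \<in> C" and "Dl \<le> nu DU" by auto
  then show "Dl \<le> nu DU" by simp
  have "1 \<le> e * (DU$2$1 - DU$1$2)"
  proof (rule tendsto_lowerbound[OF _ _ trivial_limit_at_right_real])
    show "((\<lambda>t. e * (((U t - U x) /\<^sub>R (t - x))$2$1 - ((U t - U x) /\<^sub>R (t - x))$1$2)) \<longlongrightarrow> e * (DU$2$1 - DU$1$2)) ?F"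
      by (intro tendsto_intros lims)
    show "\<forall>\<^sub>F t in ?F. 1 \<le> e * (((U t - U x) /\<^sub>R (t - x))$2$1 - ((U t - U x) /\<^sub>R (t - x))$1$2)"
      using ev
    proof eventually_elim
      case (elim t)
      have "e * (((U t - U x) /\<^sub>R (t - x))$2$1 - ((U t - U x) /\<^sub>R (t - x))$1$2) = inverse (t - x) * (e * ((U t - U x)$2$1 - (U t - U x)$1$2))"
        by (simp add: algebra_simps)
      moreover have "inverse (t - x) * (t - x) \<le> inverse (t - x) * (e * ((U t - U x)$2$1 - (U t - U x)$1$2))"
        using c(4)[OF elim] elim by (intro mult_left_mono) auto
      moreover have "inverse (t - x) * (t - x) = 1" using elim by simp
      ultimately show ?case by linarith
    qed
  qed
  then have "DU \<noteq> 0" by auto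
  with DU show "DU \<in> C - {0}" by simp
qed

text \<open>The curve is \<open>F\<close> composed with the flattening parameter \<open>p\<close>.
  Its velocity \<open>w\<close> is known at every interior time and \<open>nu (w y)\<close>
  dominates the derivative \<open>m y\<close> of \<open>l (p y)\<close>; integration compares the
  length with \<open>l S\<close>.\<close>

lemma arc_realizable:
  assumes F: "arc x0 x1 K S F" and S: "S > 0"
  shows "\<exists>T \<gamma>. admissible C x0 x1 T \<gamma> \<and> snd (snd (F S)) \<le> len T \<gamma>"
proof -
  define A where "A s = fst (fst (F s))" for s
  define \<theta> where "\<theta> s = snd (fst (F s))" for s
  define U where "U s = fst (snd (F s))" for s
  define l where "l s = snd (snd (F s))" for s
  have Fs: "F s = ((A s, \<theta> s), (U s, l s))" for s by (simp add: A_def \<theta>_def U_def l_def)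
  have ctrl: "controlled K (t - s) ((A s, \<theta> s), (U s, l s)) ((A t, \<theta> t), (U t, l t))" if "0 \<le> s" "s \<le> t" "t \<le> S" for s t
    using F that unfolding arc_def Fs by blast
  have l0: "l 0 = 0" and F0: "fst (F 0) = x0" and FS: "fst (F S) = x1" and FGt: "\<And>s. s \<in> {0..S} \<Longrightarrow> (A s, \<theta> s) \<in> Gt"
    using F by (auto simp: arc_def l_def A_def \<theta>_def)
  have det: "det (A s) = 1" if "s \<in> {0..S}" for s using FGt[OF that] by (simp add: Gt_def)
  have "0 \<le> K * (S - 0)" using ctrl[of 0 S] S norm_ge_zero[of "A S - A 0"] unfolding controlled.simps by linarith
  then have K: "0 \<le> K" using S by (simp add: zero_le_mult_iff)
  have LA: "K-lipschitz_on {0..S} A" and LU: "K-lipschitz_on {0..S} U" and Ll: "K-lipschitz_on {0..S} l"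
    by (intro lipschitz_onI_ordered K; use ctrl in \<open>simp only: controlled.simps real_norm_def\<close>)+
  obtain NA DA where NA: "negligible NA" "\<And>x. x \<in> {0<..<S} - NA \<Longrightarrow> (A has_vector_derivative DA x) (at x)"
    using lipschitz_differentiable_interior[OF LA S] by blast
  obtain NU DU where NU: "negligible NU" "\<And>x. x \<in> {0<..<S} - NU \<Longrightarrow> (U has_vector_derivative DU x) (at x)"
    using lipschitz_differentiable_interior[OF LU S] by blast
  obtain Nl Dl where Nl: "negligible Nl" "\<And>x. x \<in> {0<..<S} - Nl \<Longrightarrow> (l has_vector_derivative Dl x) (at x)"
    using lipschitz_differentiable_interior[OF Ll S] by blast
  define N where "N = NA \<union> NU \<union> Nl \<union> {0, S}"
  have N: "negligible N" unfolding N_def using NA(1) NU(1) Nl(1) by (intro negligible_Un) auto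
  have D: "DA x = A x ** DU x" "DU x \<in> C - {0}" "Dl x \<le> nu (DU x)" if x: "x \<in> {0..S} - N" for x
    by (rule arc_derivatives[of x S K A \<theta> U l, OF ctrl _ NA(2) NU(2) Nl(2)]; use x in \<open>auto simp: N_def\<close>)+
  \<comment> \<open>\<open>nu\<close> is arbitrary outside \<open>sl2\<close> and \<open>vector_derivative\<close> is a junk value where \<open>A\<close> is not differentiable, so
    even a null set of such points could spoil the measurability of the integrand. Hence the
    reparametrization \<open>p\<close>, which makes the curve differentiable everywhere.\<close>
  obtain T p p' where T: "T > 0" and p0: "p 0 = 0" and pT: "p T = S" and pL: "1-lipschitz_on {0..T} p"
    and pS: "\<And>y. y \<in> {0..T} \<Longrightarrow> p y \<in> {0..S}"
    and pd: "\<And>y. y \<in> {0<..<T} \<Longrightarrow> (p has_real_derivative p' y) (at y)" and p'n: "\<And>y. 0 \<le> p' y"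
    and p'N: "\<And>y. y \<in> {0<..<T} \<Longrightarrow> p y \<in> N \<Longrightarrow> p' y = 0" and Z: "negligible {y\<in>{0<..<T}. p' y = 0}"
    by (rule null_set_flattening[OF N S]) ((rule that; assumption) | blast)
  define w where "w y = (if p' y = 0 then 0 else p' y *\<^sub>R DU (p y))" for y
  define m where "m y = (if p' y = 0 then 0 else p' y * Dl (p y))" for y
  have pN: "p y \<in> {0..S} - N" "p y \<in> {0<..<S}" if "y \<in> {0<..<T}" "p' y \<noteq> 0" for y
    using that pS[of y] p'N[of y] by (auto simp: N_def less_le)
  have chain: "((\<lambda>y. f (p y)) has_vector_derivative p' y *\<^sub>R E) (at y)"
    if "y \<in> {0<..<T}" "(f has_vector_derivative E) (at (p y))" for f :: "real \<Rightarrow> 'z::real_normed_vector" and E y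
    using vector_diff_chain_at[OF pd[OF that(1), unfolded has_real_derivative_iff_has_vector_derivative] that(2)]
    by (simp add: o_def)
  have op: "open {0<..<T}" "\<And>y. y \<in> {0<..<T} \<Longrightarrow> p y \<in> {0..S}" using pS by auto
  have Aw: "((\<lambda>y. A (p y)) has_vector_derivative A (p y) ** w y) (at y)" if y: "y \<in> {0<..<T}" for y
  proof (cases "p' y = 0")
    case True
    have "((\<lambda>y. A (p y)) has_vector_derivative 0) (at y)"
      by (rule lipschitz_comp_flat[OF LA _ op(1) y op(2)]) (use pd[OF y] True in auto)
    then show ?thesis using True by (simp add: w_def bounded_bilinear.zero_right[OF bounded_bilinear_mat22_mult])
  next
    case False
    have "((\<lambda>y. A (p y)) has_vector_derivative p' y *\<^sub>R DA (p y)) (at y)"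
      using pN[OF y False] by (intro chain y NA(2)) (auto simp: N_def)
    then show ?thesis using False D(1)[OF pN(1)[OF y False]]
      by (simp add: w_def bounded_bilinear.scaleR_right[OF bounded_bilinear_mat22_mult])
  qed
  have lm: "((\<lambda>y. l (p y)) has_vector_derivative m y) (at y)" if y: "y \<in> {0<..<T}" for y
  proof (cases "p' y = 0")
    case True
    have "((\<lambda>y. l (p y)) has_vector_derivative 0) (at y)"
      by (rule lipschitz_comp_flat[OF Ll _ op(1) y op(2)]) (use pd[OF y] True in auto)
    then show ?thesis using True by (simp add: m_def)
  next
    case False
    have "((\<lambda>y. l (p y)) has_vector_derivative p' y *\<^sub>R Dl (p y)) (at y)"
      using pN[OF y False] by (intro chain y Nl(2)) (auto simp: N_def)
    then show ?thesis using False by (simp add: m_def)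
  qed
  have "U S - U 0 \<in> C" using ctrl[of 0 S] S by (simp add: controlled.simps)
  then have C0: "0 \<in> C" "nu 0 = 0" using C_0 nu_0 by blast+
  have wC: "w y \<in> C" "m y \<le> nu (w y)" "p' y \<noteq> 0 \<Longrightarrow> w y \<noteq> 0" "norm (w y) \<le> K" if y: "y \<in> {0<..<T}" for y
  proof -
    have "w y \<in> C \<and> m y \<le> nu (w y) \<and> (p' y \<noteq> 0 \<longrightarrow> w y \<noteq> 0) \<and> norm (w y) \<le> K"
    proof (cases "p' y = 0")
      case True
      then show ?thesis using C0 K by (simp add: w_def m_def)
    next
      case False
      then have pos: "p' y > 0" using p'n[of y] by simp
      note D' = D[OF pN(1)[OF y False]]
      have "norm (p' y) \<le> 1"
        by (rule lipschitz_derivative_norm_le[OF pL]) (use pd[OF y] y in \<open>auto simp: has_real_derivative_iff_has_vector_derivative\<close>)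
      moreover have "norm (DU (p y)) \<le> K"
        by (rule lipschitz_derivative_norm_le[OF LU _ _ NU(2)]) (use pN[OF y False] in \<open>auto simp: N_def\<close>)
      ultimately have "norm (p' y) * norm (DU (p y)) \<le> 1 * K" using K by (intro mult_mono) auto
      then have "norm (w y) \<le> K" using False by (simp add: w_def)
      moreover have "w y \<in> C" using D'(2) pos mem_cone[OF C_cone, of "DU (p y)" "p' y"] by (simp add: w_def)
      moreover have "p' y * Dl (p y) \<le> p' y * nu (DU (p y))" using D'(3) pos by (intro mult_left_mono) auto
      then have "m y \<le> nu (w y)" using nu_scale[of "DU (p y)" "p' y"] D'(2) pos by (simp add: m_def w_def)
      ultimately show ?thesis using D'(2) pos by (simp add: w_def)
    qed
    then show "w y \<in> C" "m y \<le> nu (w y)" "p' y \<noteq> 0 \<Longrightarrow> w y \<noteq> 0" "norm (w y) \<le> K" by auto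
  qed
  define \<gamma> where "\<gamma> y = (A (p y), \<theta> (p y))" for y
  have vel: "matrix_inv (fst (\<gamma> y)) ** vector_derivative (\<lambda>s. fst (\<gamma> s)) (at y) = w y" if y: "y \<in> {0<..<T}" for y
    using matrix_inv_mult_cancel(1)[OF det[OF op(2)[OF y]], of "w y"] vector_derivative_at[OF Aw[OF y]] by (simp add: \<gamma>_def)
  have adm: "admissible C x0 x1 T \<gamma>"
    unfolding admissible_def
  proof (intro conjI ballI)
    show "0 < T" by fact
    have "(4 * K)-lipschitz_on {0..T} \<gamma>"
    proof (rule lipschitz_onI)
      fix y z assume yz: "y \<in> {0..T}" "z \<in> {0..T}"
      have "dist (\<gamma> y) (\<gamma> z) \<le> dist (F (p y)) (F (p z))"
        using dist_fst_le[of "F (p y)" "F (p z)"] by (simp add: \<gamma>_def Fs)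
      also have "\<dots> \<le> 4 * K * \<bar>p y - p z\<bar>"
        using arc_lipschitz[OF F pS[OF yz(1)] pS[OF yz(2)]] by (simp add: dist_norm)
      also have "\<dots> \<le> 4 * K * dist y z"
        using lipschitz_onD[OF pL yz] K by (intro mult_left_mono) (auto simp: dist_real_def)
      finally show "dist (\<gamma> y) (\<gamma> z) \<le> 4 * K * dist y z" .
    qed (use K in simp)
    then show "\<exists>L. L-lipschitz_on {0..T} \<gamma>" by blast
    show "\<gamma> t \<in> Gt" if "t \<in> {0..T}" for t unfolding \<gamma>_def by (rule FGt[OF pS[OF that]])
    show "\<gamma> 0 = x0" "\<gamma> T = x1" using F0 FS by (simp_all add: \<gamma>_def p0 pT Fs)
    have "AE t in lebesgue. t \<in> {0..T} \<longrightarrow> (\<lambda>s. fst (\<gamma> s)) differentiable (at t) \<and>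
        matrix_inv (fst (\<gamma> t)) ** vector_derivative (\<lambda>s. fst (\<gamma> s)) (at t) \<in> C - {0}"
    proof (rule AE_I')
      show "{y\<in>{0<..<T}. p' y = 0} \<union> {0, T} \<in> null_sets lebesgue"
        using Z unfolding negligible_iff_null_sets[symmetric] by (intro negligible_Un) auto
      show "{t \<in> space lebesgue. \<not> (t \<in> {0..T} \<longrightarrow> (\<lambda>s. fst (\<gamma> s)) differentiable (at t) \<and>
        matrix_inv (fst (\<gamma> t)) ** vector_derivative (\<lambda>s. fst (\<gamma> s)) (at t) \<in> C - {0})} \<subseteq> {y\<in>{0<..<T}. p' y = 0} \<union> {0, T}"
      proof
        fix t assume t: "t \<in> {t \<in> space lebesgue. \<not> (t \<in> {0..T} \<longrightarrow> (\<lambda>s. fst (\<gamma> s)) differentiable (at t) \<and>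
          matrix_inv (fst (\<gamma> t)) ** vector_derivative (\<lambda>s. fst (\<gamma> s)) (at t) \<in> C - {0})}"
        show "t \<in> {y\<in>{0<..<T}. p' y = 0} \<union> {0, T}"
        proof (rule ccontr)
          assume c: "t \<notin> {y\<in>{0<..<T}. p' y = 0} \<union> {0, T}"
          then have t': "t \<in> {0<..<T}" "p' t \<noteq> 0" using t by auto
          have "(\<lambda>s. fst (\<gamma> s)) differentiable (at t)"
            using Aw[OF t'(1)] by (auto simp: \<gamma>_def intro: differentiableI_vector)
          then show False using t vel[OF t'(1)] wC[OF t'(1)] t'(2) by auto
        qed
      qed
    qed
    then show "AE t in lborel. t \<in> {0..T} \<longrightarrow> (\<lambda>s. fst (\<gamma> s)) differentiable (at t) \<and>
        matrix_inv (fst (\<gamma> t)) ** vector_derivative (\<lambda>s. fst (\<gamma> s)) (at t) \<in> C - {0}"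
      by (simp only: AE_completion_iff)
  qed
  define n where "n y = nu (matrix_inv (fst (\<gamma> y)) ** vector_derivative (\<lambda>s. fst (\<gamma> s)) (at y))" for y
  have nw: "n y = nu (w y)" if "y \<in> {0<..<T}" for y using vel[OF that] by (simp add: n_def)
  \<comment> \<open>Clamping makes the curve continuous on the whole line, so that its difference
    quotients are continuous functions.\<close>
  define Q where "Q y = A (p (max 0 (min T y)))" for y
  have LQ: "K-lipschitz_on UNIV Q"
  proof -
    have "(1 * K)-lipschitz_on {0..T} (\<lambda>y. A (p y))"
      using lipschitz_on_compose2[OF pL, of K A] LA pS
      by (metis (no_types, lifting) image_subsetI lipschitz_on_subset mult.commute)
    then show ?thesis unfolding Q_def using lipschitz_clamp[of "1 * K" 0 T "\<lambda>y. A (p y)"] T by simp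
  qed
  have cQ: "continuous_on UNIV Q" by (rule lipschitz_on_continuous_on[OF LQ])
  \<comment> \<open>The derivative exists at every point of the open interval, so it is a pointwise
    limit of continuous quotients and hence Borel; multiplication by \<open>adjugate (Q y)\<close>
    recovers \<open>w\<close>.\<close>
  define H where "H y = indicator {0<..<T} y *\<^sub>R (A (p y) ** w y)" for y
  have Hb: "H \<in> borel_measurable borel"
  proof (rule borel_measurable_LIMSEQ_metric)
    fix i :: nat
    have "continuous_on UNIV (\<lambda>y. (real i + 1) *\<^sub>R (Q (y + 1 / (real i + 1)) - Q y))"
      by (intro continuous_intros continuous_on_compose2[OF cQ] cQ) auto
    then have "(\<lambda>y. (real i + 1) *\<^sub>R (Q (y + 1 / (real i + 1)) - Q y)) \<in> borel_measurable borel"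
      by (rule borel_measurable_continuous_onI)
    then show "(\<lambda>y. indicator {0<..<T} y *\<^sub>R ((real i + 1) *\<^sub>R (Q (y + 1 / (real i + 1)) - Q y))) \<in> borel_measurable borel"
      by (rule borel_measurable_scaleR[rotated]) auto
  next
    fix y :: real
    show "(\<lambda>i. indicator {0<..<T} y *\<^sub>R ((real i + 1) *\<^sub>R (Q (y + 1 / (real i + 1)) - Q y))) \<longlonglongrightarrow> H y"
    proof (cases "y \<in> {0<..<T}")
      case True
      have "(Q has_vector_derivative A (p y) ** w y) (at y)"
        by (rule has_vector_derivative_transform_within_open[OF Aw[OF True], of "{0<..<T}"]) (use True in \<open>auto simp: Q_def\<close>)
      from has_vector_derivative_imp_seq_limit[OF this] show ?thesis using True by (simp add: H_def)
    qed (simp add: H_def)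
  qed
  have wb: "(\<lambda>y. indicator {0<..<T} y *\<^sub>R w y) \<in> borel_measurable borel"
  proof -
    have "(\<lambda>y. adjugate (Q y) ** H y) \<in> borel_measurable borel"
    proof (rule borel_measurable_continuous_Pair[where f = Q and g = H and H = "\<lambda>a b. adjugate a ** b"])
      show "H \<in> borel_measurable borel" by (rule Hb)
      show "Q \<in> borel_measurable borel" using cQ by (rule borel_measurable_continuous_onI)
      show "continuous_on UNIV (\<lambda>x :: (real^2^2) \<times> (real^2^2). adjugate (fst x) ** snd x)"
        by (intro bounded_bilinear.continuous_on[OF bounded_bilinear_mat22_mult] continuous_intros)
    qed
    moreover have "adjugate (Q y) ** H y = indicator {0<..<T} y *\<^sub>R w y" for y
    proof (cases "y \<in> {0<..<T}")
      case True
      then have "Q y = A (p y)" by (simp add: Q_def)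
      then show ?thesis
        using True det[OF op(2)[OF True]] matrix_inv_mult_cancel(1)[of "A (p y)" "w y"] matrix_inv_eq_adjugate[of "A (p y)"]
        by (simp add: H_def)
    qed (simp add: H_def bounded_bilinear.zero_right[OF bounded_bilinear_mat22_mult])
    ultimately show ?thesis by simp
  qed
  have nb: "(\<lambda>y. indicator {0..T} y *\<^sub>R n y) \<in> borel_measurable borel"
  proof -
    have "(\<lambda>y. indicator {0<..<T} y * (if indicator {0<..<T} y *\<^sub>R w y \<in> sl2 then nu (indicator {0<..<T} y *\<^sub>R w y) else 0)) \<in> borel_measurable borel"
      by (intro borel_measurable_times measurable_compose[OF wb nu_borel]) auto
    \<comment> \<open>The endpoint values of \<open>n\<close> are unknown, but altering a Borel
      function at two points keeps it Borel.\<close>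
    then have "(\<lambda>y. if y = 0 then n 0 else if y = T then n T else
      indicator {0<..<T} y * (if indicator {0<..<T} y *\<^sub>R w y \<in> sl2 then nu (indicator {0<..<T} y *\<^sub>R w y) else 0)) \<in> borel_measurable borel"
      by (intro measurable_If measurable_const) auto
    moreover have "indicator {0..T} y *\<^sub>R n y = (if y = 0 then n 0 else if y = T then n T else
      indicator {0<..<T} y * (if indicator {0<..<T} y *\<^sub>R w y \<in> sl2 then nu (indicator {0<..<T} y *\<^sub>R w y) else 0))" for y
    proof (cases "y \<in> {0<..<T}")
      case True
      then have "w y \<in> sl2" using wC(1) C_sl2 by blast
      then show ?thesis using True nw by auto
    qed (use T in \<open>auto simp: indicator_def\<close>)
    ultimately show ?thesis by simp
  qed
  have nint: "set_integrable lborel {0..T} n"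
    unfolding set_integrable_def
  proof (rule Bochner_Integration.integrable_bound)
    show "integrable lborel (\<lambda>y. indicator {0..T} y *\<^sub>R (B * K))" 
      using T by (intro integrable_scaleR_left integrable_real_indicator) auto
    show "(\<lambda>y. indicator {0..T} y *\<^sub>R n y) \<in> borel_measurable lborel" using nb by simp
    show "AE y in lborel. norm (indicator {0..T} y *\<^sub>R n y) \<le> norm (indicator {0..T} y *\<^sub>R (B * K))"
      using AE_lborel_singleton[of 0] AE_lborel_singleton[of T]
    proof eventually_elim
      case (elim y)
      show ?case
      proof (cases "y \<in> {0..T}")
        case True
        then have y: "y \<in> {0<..<T}" using elim by auto
        have "nu (w y) \<le> B * norm (w y)" by (rule nu_le[OF wC(1)[OF y]])
        also have "\<dots> \<le> B * K" using wC(4)[OF y] B by (intro mult_left_mono)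
        finally show ?thesis using True nw[OF y] nu_nonneg[OF wC(1)[OF y]] by simp
      qed simp
    qed
  qed
  have "(n has_integral len T \<gamma>) {0..T}"
    using set_borel_integral_eq_integral[OF nint] by (simp add: len_def n_def has_integral_integral)
  then have n1: "((\<lambda>y. if y \<in> {0, T} then 0 else n y) has_integral len T \<gamma>) {0..T}"
    by (rule has_integral_spike_finite[of "{0, T}", rotated 2]) auto
  have "(1 * K)-lipschitz_on {0..T} (\<lambda>y. l (p y))"
    using lipschitz_on_compose2[OF pL, of K l] Ll pS
    by (metis (no_types, lifting) image_subsetI lipschitz_on_subset mult.commute)
  from lipschitz_has_integral_derivative[OF this, of "{0, T}" m]
  have "(m has_integral l (p T) - l (p 0)) {0..T}" using T lm by auto
  then have "(m has_integral l S) {0..T}" by (simp add: p0 pT l0)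
  then have m1: "((\<lambda>y. if y \<in> {0, T} then 0 else m y) has_integral l S) {0..T}"
    by (rule has_integral_spike_finite[of "{0, T}", rotated 2]) auto
  have "l S \<le> len T \<gamma>"
    by (rule has_integral_le[OF m1 n1]) (use wC(2) nw in auto)
  with adm show ?thesis unfolding l_def by blast
qed

end

section \<open>From the given cone and anti-norm to the locale\<close>

lemma anti_norm_hypograph_closed:
  fixes nu :: "real^2^2 \<Rightarrow> ereal"
  assumes C: "C \<subseteq> sl2" "closed C" and an: "anti_norm C nu" and usc: "usc_on sl2 nu"
  shows "closed {(v, r). v \<in> C \<and> r \<le> real_of_ereal (nu v)}"
  unfolding closed_sequential_limits
proof (intro allI impI, elim conjE)
  fix x :: "nat \<Rightarrow> (real^2^2) \<times> real" and y
  assume x: "\<forall>n. x n \<in> {(v, r). v \<in> C \<and> r \<le> real_of_ereal (nu v)}" and lim: "x \<longlonglongrightarrow> y"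
  have real: "nu v = ereal (real_of_ereal (nu v))" if "v \<in> C" for v
    using an that C(1) by (intro ereal_real'[symmetric]) (auto simp: anti_norm_def)
  obtain v r where y: "y = (v, r)" by fastforce
  have xn: "fst (x n) \<in> C" "snd (x n) \<le> real_of_ereal (nu (fst (x n)))" for n using x by (auto simp: case_prod_beta)
  have limv: "(\<lambda>n. fst (x n)) \<longlonglongrightarrow> v" and limr: "(\<lambda>n. snd (x n)) \<longlonglongrightarrow> r"
    using tendsto_fst[OF lim] tendsto_snd[OF lim] by (simp_all add: y)
  have v: "v \<in> C" using closed_sequentially[OF C(2) xn(1) limv] .
  have "r \<le> real_of_ereal (nu v)"
  proof (rule ccontr)
    assume "\<not> r \<le> real_of_ereal (nu v)"
    then have lt: "real_of_ereal (nu v) < r" by simp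
    define a where "a = (real_of_ereal (nu v) + r) / 2"
    have a: "real_of_ereal (nu v) < a" "a < r" using lt by (auto simp: a_def)
    have "nu v < ereal a" using real[OF v] a(1) by (metis ereal_less_eq(3) not_le)
    then obtain d where d: "d > 0" "\<And>w. w \<in> sl2 \<Longrightarrow> dist w v < d \<Longrightarrow> nu w < ereal a"
      using usc v C(1) unfolding usc_on_def by blast
    have "\<forall>\<^sub>F n in sequentially. dist (fst (x n)) v < d" using tendstoD[OF limv d(1)] .
    moreover have "\<forall>\<^sub>F n in sequentially. a < snd (x n)" using order_tendstoD(1)[OF limr a(2)] .
    ultimately have "\<forall>\<^sub>F n in sequentially. False"
    proof eventually_elim
      case (elim n)
      have "nu (fst (x n)) < ereal a" using d(2) elim(1) xn(1)[of n] C(1) by blast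
      then have "real_of_ereal (nu (fst (x n))) < a" using real[OF xn(1)[of n]] by (metis ereal_less_eq(3) not_le)
      then show False using elim(2) xn(2)[of n] by simp
    qed
    then show False by simp
  qed
  then show "y \<in> {(v, r). v \<in> C \<and> r \<le> real_of_ereal (nu v)}" using v y by simp
qed

lemma closed_sl2: "closed sl2"
proof -
  have eq: "sl2 = {v :: real^2^2. v$2$2 = - v$1$1}" using sl2_iff by blast
  show ?thesis unfolding eq by (intro closed_Collect_eq continuous_intros)
qed

text \<open>Strict sublevel sets are relatively open in the closed set \<open>sl2\<close>. The value
  0 off \<open>sl2\<close> is imposed because \<open>nu\<close> is unconstrained there.\<close>

lemma usc_borel:
  fixes nu :: "real^2^2 \<Rightarrow> ereal"
  assumes usc: "usc_on sl2 nu"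
  shows "(\<lambda>v. if v \<in> sl2 then real_of_ereal (nu v) else 0) \<in> borel_measurable borel"
proof -
  have "(\<lambda>v. if v \<in> sl2 then nu v else 0) \<in> borel_measurable borel"
  proof (rule borel_measurableI_less)
    fix a :: ereal
    have "\<forall>v\<in>{v\<in>sl2. nu v < a}. \<exists>d>0. \<forall>w\<in>sl2. dist w v < d \<longrightarrow> nu w < a"
      using usc unfolding usc_on_def by blast
    then obtain d where d: "\<forall>v\<in>{v\<in>sl2. nu v < a}. d v > 0 \<and> (\<forall>w\<in>sl2. dist w v < d v \<longrightarrow> nu w < a)"
      by (rule bchoice[THEN exE])
    define W where "W = (\<Union>v\<in>{v\<in>sl2. nu v < a}. ball v (d v))"
    have W: "open W" unfolding W_def by auto
    have "W \<inter> sl2 = {v\<in>sl2. nu v < a}"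
    proof (intro equalityI subsetI)
      fix w assume "w \<in> W \<inter> sl2"
      then obtain v where v: "v \<in> {v\<in>sl2. nu v < a}" "w \<in> ball v (d v)" and w: "w \<in> sl2" unfolding W_def by blast
      have "nu w < a" using conjunct2[OF bspec[OF d v(1)]] v(2) w by (simp add: dist_commute)
      then show "w \<in> {v\<in>sl2. nu v < a}" using w by simp
    next
      fix w assume w: "w \<in> {v\<in>sl2. nu v < a}"
      have "d w > 0" using bspec[OF d w] by (rule conjunct1)
      then have "w \<in> ball w (d w)" by simp
      then have "w \<in> W" unfolding W_def by (rule UN_I[OF w])
      then show "w \<in> W \<inter> sl2" using w by simp
    qed
    then have "{v\<in>space borel. (if v \<in> sl2 then nu v else 0) < a} = (W \<inter> sl2) \<union> (if 0 < a then - sl2 else {})"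
      by auto
    also have "\<dots> \<in> sets borel" using W closed_sl2 by auto
    finally show "{v\<in>space borel. (if v \<in> sl2 then nu v else 0) < a} \<in> sets borel" .
  qed
  then have "(\<lambda>v. real_of_ereal (if v \<in> sl2 then nu v else 0)) \<in> borel_measurable borel"
    by (rule borel_measurable_real_of_ereal)
  moreover have "(\<lambda>v. real_of_ereal (if v \<in> sl2 then nu v else 0)) = (\<lambda>v. if v \<in> sl2 then real_of_ereal (nu v) else 0)"
    by auto
  ultimately show ?thesis by simp
qed

text \<open>If the values on unit vectors of \<open>C\<close> were unbounded, a limit point
  \<open>v\<close> of unit vectors with values tending to infinity would have
  \<open>(v, nu v + 1)\<close> in the closed hypograph. Homogeneity extends the bound to all of
  \<open>C\<close>.\<close>

lemma anti_norm_le_norm: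
  fixes nu :: "real^2^2 \<Rightarrow> ereal"
  assumes C: "C \<subseteq> sl2" "closed C" "cone C" and an: "anti_norm C nu" and usc: "usc_on sl2 nu"
  obtains B where "B \<ge> 0" "\<And>v. v \<in> C \<Longrightarrow> real_of_ereal (nu v) \<le> B * norm v"
proof -
  let ?n = "\<lambda>v. real_of_ereal (nu v)"
  have scale: "?n (c *\<^sub>R v) = c * ?n v" if "v \<in> C" "c > 0" for v c
    using an that C(1) by (auto simp: anti_norm_def subset_iff)
  have "\<exists>B. \<forall>v\<in>C \<inter> sphere 0 1. ?n v \<le> B"
  proof (rule ccontr)
    assume "\<not> (\<exists>B. \<forall>v\<in>C \<inter> sphere 0 1. ?n v \<le> B)"
    then have "\<forall>i::nat. \<exists>v\<in>C \<inter> sphere 0 1. real i < ?n v" by (meson not_le)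
    then obtain x where x: "\<And>i::nat. x i \<in> C \<inter> sphere 0 1" "\<And>i::nat. real i < ?n (x i)" by metis
    have "compact (C \<inter> sphere 0 1)" using C(2) by (intro closed_Int_compact) auto
    then obtain v r where v: "v \<in> C \<inter> sphere 0 1" "strict_mono (r :: nat \<Rightarrow> nat)" "(x \<circ> r) \<longlonglongrightarrow> v"
      using x(1) unfolding compact_def by blast
    have lim: "(\<lambda>i. (x (r i), ?n v + 1)) \<longlonglongrightarrow> (v, ?n v + 1)"
      using v(3) by (intro tendsto_Pair tendsto_const) (simp add: o_def)
    obtain i0 :: nat where i0: "?n v + 1 \<le> real i0" using real_arch_simple by blast
    have lim': "(\<lambda>i. (x (r (i + i0)), ?n v + 1)) \<longlonglongrightarrow> (v, ?n v + 1)"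
      using LIMSEQ_ignore_initial_segment[OF lim, of i0] .
    have "(v, ?n v + 1) \<in> {(v, r). v \<in> C \<and> r \<le> ?n v}"
    proof (rule closed_sequentially[OF anti_norm_hypograph_closed[OF C(1,2) an usc] _ lim'])
      fix i
      have "real i0 \<le> real (r (i + i0))" using seq_suble[OF v(2), of "i + i0"] by simp
      then have "?n v + 1 \<le> ?n (x (r (i + i0)))" using i0 x(2)[of "r (i + i0)"] by linarith
      then show "(x (r (i + i0)), ?n v + 1) \<in> {(v, r). v \<in> C \<and> r \<le> ?n v}" using x(1) by simp
    qed
    then show False by simp
  qed
  then obtain B where "\<forall>v\<in>C \<inter> sphere 0 1. ?n v \<le> B" by blast
  then have B: "?n v \<le> B" if "v \<in> C" "norm v = 1" for v using that by simp
  show thesis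
  proof (rule that[of "max B 0"])
    fix v assume v: "v \<in> C"
    show "?n v \<le> max B 0 * norm v"
    proof (cases "v = 0")
      case True
      \<comment> \<open>Homogeneity at the zero vector equates a real number with its double, hence
        it is 0.\<close>
      then have "?n 0 = 2 * ?n 0" using scale[of 0 2] v by simp
      then show ?thesis using True by simp
    next
      case False
      have "?n v = norm v * ?n ((1 / norm v) *\<^sub>R v)" using scale[OF v, of "1 / norm v"] False by simp
      also have "\<dots> \<le> norm v * max B 0"
        using B[of "(1 / norm v) *\<^sub>R v"] mem_cone[OF C(3) v, of "1 / norm v"] False
        by (intro mult_left_mono) (auto simp: le_max_iff_disj)
      finally show ?thesis by (simp add: mult.commute)
    qed
  qed simp
qed

lemma timelike_cone_of_structure:
  fixes C :: "(real^2^2) set" and nu :: "real^2^2 \<Rightarrow> ereal"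
  assumes "C \<subseteq> sl2" and "closed C" and "convex C" and "cone C" and "acute C"
    and an: "anti_norm C nu" and usc: "usc_on sl2 nu"
    and int: "C - {0} \<subseteq> sl2_interior {v \<in> sl2. killing v v \<le> 0}"
  obtains e k B where "timelike_cone C (\<lambda>v. real_of_ereal (nu v)) e k B"
proof -
  have det: "det v > 0" if "v \<in> C - {0}" for v using det_pos_if_interior int that by blast
  obtain e :: real where e: "e = 1 \<or> e = -1" "\<And>v. v \<in> C - {0} \<Longrightarrow> e * v$2$1 > 0"
    using timelike_cone_sign[OF assms(1,3,4,5) det] by blast
  have pos: "e * rot_form v x y > 0" if "v \<in> C - {0}" "x \<noteq> 0 \<or> y \<noteq> 0" for v x y
    using rot_form_pos[OF _ det[OF that(1)] e(2)[OF that(1)] that(2)] that(1) assms(1) by blast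
  obtain k where k: "k > 0" "\<And>v x y. v \<in> C \<Longrightarrow> k * norm v * (x\<^sup>2 + y\<^sup>2) \<le> e * rot_form v x y"
    using rot_form_lower_bound[OF assms(2,4) pos] by metis
  obtain B where B: "B \<ge> 0" "\<And>v. v \<in> C \<Longrightarrow> real_of_ereal (nu v) \<le> B * norm v"
    using anti_norm_le_norm[OF assms(1,2,4) an usc] by metis
  have real: "nu v = ereal (real_of_ereal (nu v))" if "v \<in> C" for v
    using an that assms(1) by (intro ereal_real'[symmetric]) (auto simp: anti_norm_def)
  have "timelike_cone C (\<lambda>v. real_of_ereal (nu v)) e k B"
  proof
    show "norm v \<le> e * (v$2$1 - v$1$2)" if "v \<in> C" for v
    proof (cases "v = 0")
      case False
      then show ?thesis using norm_le_tau[OF _ det e(2) e(1)] that assms(1) by auto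
    qed simp
    show "0 \<le> real_of_ereal (nu v)" if "v \<in> C" for v
      using an that by (auto simp: anti_norm_def real_of_ereal_pos)
    show "real_of_ereal (nu v) + real_of_ereal (nu w) \<le> real_of_ereal (nu (v + w))" if "v \<in> C" "w \<in> C" for v w
    proof -
      have "v + w \<in> C" using that assms(3,4) convex_cone by blast
      moreover have "nu v + nu w \<le> nu (v + w)" using an that assms(1) unfolding anti_norm_def by blast
      ultimately show ?thesis using real[of v] real[of w] real[of "v + w"] that by (metis ereal_less_eq(3) plus_ereal.simps(1))
    qed
    show "real_of_ereal (nu (c *\<^sub>R v)) = c * real_of_ereal (nu v)" if "v \<in> C" "c > 0" for v c
      using an that assms(1) by (auto simp: anti_norm_def subset_iff)
    show "closed {(v, r). v \<in> C \<and> r \<le> real_of_ereal (nu v)}"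
      by (rule anti_norm_hypograph_closed[OF assms(1,2) an usc])
  qed (use assms e k B usc_borel[OF usc] in auto)
  then show thesis by (rule that)
qed

theorem theorem4:
  fixes C :: "(real^2^2) set" and nu :: "real^2^2 \<Rightarrow> ereal"
    and x0 x1 :: "(real^2^2) \<times> real"
  assumes "C \<subseteq> sl2" and "closed C" and "convex C" and "cone C" and "acute C"
    and "anti_norm C nu" and "usc_on sl2 nu"
    and "C - {0} \<subseteq> sl2_interior {v \<in> sl2. killing v v \<le> 0}"
    and "x0 \<in> Gt"
    and "attainable C x0 x1"
  shows "\<exists>t1 \<gamma>. admissible C x0 x1 t1 \<gamma> \<and>
           (\<forall>t1' \<gamma>'. admissible C x0 x1 t1' \<gamma>' \<longrightarrow>
              curve_length nu t1' \<gamma>' \<le> curve_length nu t1 \<gamma>)"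
proof -
  obtain e k B where "timelike_cone C (\<lambda>v. real_of_ereal (nu v)) e k B"
    using timelike_cone_of_structure[OF assms(1-8)] by blast
  then interpret timelike_cone C "\<lambda>v. real_of_ereal (nu v)" e k B .
  define S where "S = e * (clock x1 - clock x0)"
  \<comment> \<open>Both constants depend on the endpoints only, so every competitor yields an arc
    of the same class and \<open>Fmax\<close> applies to it.\<close>
  define K where "K = bound_const (norm (fst x0)) S"
  obtain T0 \<gamma>0 where adm0: "admissible C x0 x1 T0 \<gamma>0" using assms(10) by (auto simp: attainable_def)
  have S: "S > 0" unfolding S_def by (rule admissible_controlled(1)[OF adm0])
  obtain F0 where F0: "arc x0 x1 K S F0"
    using admissible_arc[OF adm0] unfolding K_def S_def by blast
  obtain F where F: "arc x0 x1 K S F" and Fmax: "\<And>G. arc x0 x1 K S G \<Longrightarrow> snd (snd (G S)) \<le> snd (snd (F S))"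
    using arc_max_exists[OF F0 S] by blast
  obtain T \<gamma> where adm: "admissible C x0 x1 T \<gamma>" and le: "snd (snd (F S)) \<le> len T \<gamma>"
    using arc_realizable[OF F S] by blast
  have len: "curve_length nu T \<gamma> = len T \<gamma>" for T \<gamma> by (simp add: curve_length_def len_def)
  have "curve_length nu T' \<gamma>' \<le> curve_length nu T \<gamma>" if adm': "admissible C x0 x1 T' \<gamma>'" for T' \<gamma>'
  proof -
    obtain G where "arc x0 x1 K S G" "snd (snd (G S)) = len T' \<gamma>'"
      using admissible_arc[OF adm'] unfolding K_def S_def by blast
    then show ?thesis using Fmax[of G] le by (simp add: len)
  qed
  with adm show ?thesis by blast
qed

end
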